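(* Let $(X,\mathcal U)$ and $(Y,\mathcal V)$ be two tame filtered CW-complexes together with covers by subcomplexes, both covers having the same finite nerve $K=N_{\mathcal U}=N_{\mathcal V}$, and let $\varepsilon\ge0$. Suppose that there are $(\varepsilon,K)$-acyclic carriers $F^\varepsilon:X^{\mathcal U}\rightrightarrows Y^{\mathcal V}$ and $G^\varepsilon:Y^{\mathcal V}\rightrightarrows X^{\mathcal U}$, together with shift $(2\varepsilon,K)$-acyclic carriers $I^{2\varepsilon}_{X^{\mathcal U}}:X^{\mathcal U}\rightrightarrows X^{\mathcal U}$ and $I^{2\varepsilon}_{Y^{\mathcal V}}:Y^{\mathcal V}\rightrightarrows Y^{\mathcal V}$, such that $$G^\varepsilon_\tau\circ F^\varepsilon_\tau\subseteq(I^{2\varepsilon}_{X^{\mathcal U}})_\tau\quad\text{and}\quad F^\varepsilon_\tau\circ G^\varepsilon_\tau\subseteq(I^{2\varepsilon}_{Y^{\mathcal V}})_\tau$$ for each simplex $\tau\in K$. Then there are double complex morphisms $\phi^\varepsilon:C_{*,*}(X,\mathcal U)\to C_{*,*}(Y,\mathcal V)[\varepsilon]$ and $\psi^\varepsilon:C_{*,*}(Y,\mathcal V)\to C_{*,*}(X,\mathcal U)[\varepsilon]$ (natural in the filtration parameter) which induce a first page interleaving, i.e. an $(\varepsilon,1)$-interleaving, between $E^*_{*,*}(X,\mathcal U)$ and $E^*_{*,*}(Y,\mathcal V)$.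
   Context: Conventions. CW-complexes are finite and regular, with the cell structure part of the data; cells are open cells; homology is cellular homology with coefficients in a fixed field. A filtered CW-complex $X$ is a functor $r\mapsto X_r$ from $(\mathbb R,\le)$ to finite regular CW-complexes in which all maps $X(r\le s):X_r\to X_s$ are inclusions of subcomplexes. It is tame if $\mathbb R$ decomposes into finitely many right-open intervals along each of which $X$ is constant. $X[\varepsilon]_r=X_{r+\varepsilon}$, and $\Sigma^\varepsilon X:X\to X[\varepsilon]$ is the shift. A cover $\mathcal U=\{U_i\}_{i\in I}$ of $X$ by subcomplexes is a cover of $\operatorname{colim}X$ by subcomplexes $U_i$, each filtered by $(U_i)_r=U_i\cap X_r$. $N_{\mathcal U}$ is its nerve and $X^{\mathcal U}$ is the diagram over $N_{\mathcal U}$ with $X^{\mathcal U}(J)=\bigcap_{j\in J}U_j$ and maps $X^{\mathcal U}(\tau\preceq\sigma):X^{\mathcal U}(\sigma)\to X^{\mathcal U}(\tau)$ the inclusions, for $\tau$ a face of $\sigma$. Carriers. A carrier $F:\Phi\rightrightarrows\Gamma$ assigns to each cell $\sigma$ of $\Phi$ a subcomplex $F(\sigma)$ of $\Gamma$ with $F(\tau)\subseteq F(\sigma)$ whenever $\tau$ is a face of $\sigma$; it is acyclic if each $F(\sigma)$ is nonempty and acyclic (homology of a point). A chain map $w:C_*(\Phi)\to C_*(\Gamma)$ is carried by $F$ if all cells occurring in $w(\sigma)$ lie in $F(\sigma)$, for each cell $\sigma$. $F\subseteq G$ means $F(\sigma)\subseteq G(\sigma)$ for all $\sigma$; $(H\circ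 F)(\sigma)=\bigcup_{\tau\in F(\sigma)}H(\tau)$. An $\varepsilon$-acyclic carrier $F^\varepsilon:A\rightrightarrows B$ between filtered CW-complexes is a family of acyclic carriers $F^\varepsilon_a:A_a\rightrightarrows B_{a+\varepsilon}$, $a\in\mathbb R$, such that $B(a+\varepsilon\le b+\varepsilon)(F^\varepsilon_a(c))\subseteq F^\varepsilon_b(A(a\le b)(c))$ for all $a\le b$ and cells $c$ of $A_a$. A shift carrier $A\rightrightarrows A$ (with parameter $\varepsilon$) is an $\varepsilon$-acyclic carrier carrying the chain map of $\Sigma^\varepsilon A$. For diagrams $\mathcal D=X^{\mathcal U}$, $\mathcal L=Y^{\mathcal V}$ over $K$ an $(\varepsilon,K)$-acyclic carrier $F^\varepsilon:\mathcal D\rightrightarrows\mathcal L$ is a family of $\varepsilon$-acyclic carriers $F_\sigma^\varepsilon:\mathcal D(\sigma)\rightrightarrows\mathcal L(\sigma)$, $\sigma\in K$, such that for all $\tau\preceq\sigma$ and cells $c\in\mathcal D(\sigma)$: $\mathcal L(\tau\preceq\sigma)(F^\varepsilon_\sigma(c))\subseteq F^\varepsilon_\tau(\mathcal D(\tau\preceq\sigma)(c))$, and $F^\varepsilon_\tau(\mathcal D(\tau\preceq\sigma)\Sigma^r\mathcal D(\sigma)(c))$ is acyclic for all $r\ge0$. A shift $(2\varepsilon,K)$-acyclic carrier $\mathcal D\rightrightarrows\mathcal D$ is a $(2\varepsilon,K)$-acyclic carrier each of whose components is a shift carrier (carries $\Sigma^{2\varepsilon}\mathcal D(\sigma)$).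 Spectral sequences. $C_{p,q}(X,\mathcal U)_r=\bigoplus_{\sigma\in N_{\mathcal U}^p}C^{\rm cell}_q(X^{\mathcal U}(\sigma)_r)$ with vertical differential $(-1)^p$ times the cellular differential and horizontal differential the Čech differential $c\mapsto\sum_i(-1)^iX^{\mathcal U}(\sigma_i\prec\sigma)_*(c)$ ($\sigma_i$ the codimension-one faces of $\sigma$). $E^*_{p,q}(X,\mathcal U)$ is the spectral sequence (for each $r\in\mathbb R$, functorially in $r$) of its total complex filtered by $p$, with $E^1_{p,q}(X,\mathcal U)=\bigoplus_{\sigma\in N^p_{\mathcal U}}\mathrm{PH}_q(X^{\mathcal U}(\sigma))$. Functors $\mathcal A,\mathcal B$ from $(\mathbb R,\le)$ to spectral sequences are $(\varepsilon,n)$-interleaved if there are morphisms $\psi:\mathcal A\to\mathcal B[\varepsilon]$, $\varphi:\mathcal B\to\mathcal A[\varepsilon]$ defined on pages $\ge n$ with $\varphi[\varepsilon]\circ\psi=\Sigma^{2\varepsilon}\mathcal A$ and $\psi[\varepsilon]\circ\varphi=\Sigma^{2\varepsilon}\mathcal B$ on all pages $\ge n$. *)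

theory Defs
  imports "HOL-Homology.Homology" "HOL-Algebra.Module"
begin

text \<open>The cells are open cells, i.e. subsets of the underlying space. The last field chooses an
  orientation of each cell, which is needed to have the cells as a basis of the cellular chains.\<close>

record 'a cw =
  cw_space :: "'a topology"
  cells :: "'a set set"
  cdim :: "'a set \<Rightarrow> nat"
  orient :: "'a set \<Rightarrow> 'a chain set"

definition closed_ball :: "nat \<Rightarrow> (nat \<Rightarrow> real) topology" where
  "closed_ball n = subtopology (Euclidean_space n) {x. (\<Sum>i<n. (x i)\<^sup>2) \<le> 1}"

definition open_ball :: "nat \<Rightarrow> (nat \<Rightarrow> real) set" where
  "open_ball n = {x \<in> topspace (Euclidean_space n). (\<Sum>i<n. (x i)\<^sup>2) < 1}"

definition cell_closure :: "'a cw \<Rightarrow> 'a set \<Rightarrow> 'a set" where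
  "cell_closure X \<sigma> = cw_space X closure_of \<sigma>"

definition cell_frontier :: "'a cw \<Rightarrow> 'a set \<Rightarrow> 'a set" where
  "cell_frontier X \<sigma> = cell_closure X \<sigma> - \<sigma>"

definition cell_face :: "'a cw \<Rightarrow> 'a set \<Rightarrow> 'a set \<Rightarrow> bool" where
  "cell_face X \<tau> \<sigma> \<longleftrightarrow> \<tau> \<subseteq> cell_closure X \<sigma>"

definition cell_homology_group :: "'a cw \<Rightarrow> 'a set \<Rightarrow> 'a chain set monoid" where
  "cell_homology_group X \<sigma> =
     relative_homology_group (int (cdim X \<sigma>))
       (subtopology (cw_space X) (cell_closure X \<sigma>)) (cell_frontier X \<sigma>)"

text \<open>A finite regular CW-complex with oriented cells: the closed cells are closed balls, and the
  frontier of a cell is a union of cells of smaller dimension. As there are finitely many cells,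
  the topology is automatically the weak one. An orientation of an \<open>n\<close>-cell is a generator
  of the infinite cyclic group \<open>H\<^sub>n(cl \<sigma>, cl \<sigma> - \<sigma>)\<close> (integral singular homology).\<close>

definition finite_regular_cw :: "'a cw \<Rightarrow> bool" where
  "finite_regular_cw X \<longleftrightarrow>
     Hausdorff_space (cw_space X) \<and>
     finite (cells X) \<and>
     disjoint (cells X) \<and>
     \<Union>(cells X) = topspace (cw_space X) \<and>
     (\<forall>\<sigma>\<in>cells X.
        (\<exists>h. homeomorphic_map (closed_ball (cdim X \<sigma>))
               (subtopology (cw_space X) (cell_closure X \<sigma>)) h \<and>
             h ` open_ball (cdim X \<sigma>) = \<sigma>) \<and>
        cell_frontier X \<sigma> = \<Union>{\<tau> \<in> cells X. cell_face X \<tau> \<sigma> \<and> cdim X \<tau> < cdim X \<sigma>} \<and>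
        orient X \<sigma> \<in> carrier (cell_homology_group X \<sigma>) \<and>
        carrier (cell_homology_group X \<sigma>) = generate (cell_homology_group X \<sigma>) {orient X \<sigma>})"

text \<open>A subcomplex is given by its set of cells.\<close>

definition subcomplex :: "'a cw \<Rightarrow> 'a set set \<Rightarrow> bool" where
  "subcomplex X S \<longleftrightarrow> S \<subseteq> cells X \<and> (\<forall>\<sigma>\<in>S. \<forall>\<tau>\<in>cells X. cell_face X \<tau> \<sigma> \<longrightarrow> \<tau> \<in> S)"

text \<open>Vector spaces over a field \<open>'k\<close> are HOL-Algebra module records; the ring operations of these
  records are irrelevant.\<close>

definition linear_map ::
    "('k, 'v) module \<Rightarrow> ('k, 'w) module \<Rightarrow> ('v \<Rightarrow> 'w) \<Rightarrow> bool" where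
  "linear_map M N f \<longleftrightarrow>
     f \<in> carrier M \<rightarrow> carrier N \<and>
     (\<forall>x\<in>carrier M. \<forall>y\<in>carrier M. f (x \<oplus>\<^bsub>M\<^esub> y) = f x \<oplus>\<^bsub>N\<^esub> f y) \<and>
     (\<forall>a. \<forall>x\<in>carrier M. f (a \<odot>\<^bsub>M\<^esub> x) = a \<odot>\<^bsub>N\<^esub> f x)"

definition one_dimensional :: "('k, 'v) module \<Rightarrow> bool" where
  "one_dimensional M \<longleftrightarrow>
     (\<exists>z\<in>carrier M. z \<noteq> \<zero>\<^bsub>M\<^esub> \<and> (\<forall>x\<in>carrier M. \<exists>a. x = a \<odot>\<^bsub>M\<^esub> z))"

text \<open>The vector space with basis \<open>S\<close>, for finite \<open>S\<close>.\<close>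

definition chain_module :: "'s set \<Rightarrow> ('k::field, 's \<Rightarrow> 'k) module" where
  "chain_module S =
     \<lparr>carrier = {x. \<forall>s. x s \<noteq> 0 \<longrightarrow> s \<in> S}, mult = undefined, one = undefined,
      zero = (\<lambda>s. 0), add = (\<lambda>x y s. x s + y s), smult = (\<lambda>a x s. a * x s)\<rparr>"

text \<open>The quotient of a space \<open>Z\<close> of chains by a subspace \<open>B\<close>; its elements are the cosets of \<open>B\<close>.\<close>

definition quotient_module ::
    "('s \<Rightarrow> 'k::field) set \<Rightarrow> ('s \<Rightarrow> 'k) set \<Rightarrow> ('k, ('s \<Rightarrow> 'k) set) module" where
  "quotient_module Z B =
     \<lparr>carrier = {{(\<lambda>s. x s + b s) |b. b \<in> B} |x. x \<in> Z}, mult = undefined, one = undefined,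
      zero = B,
      add = (\<lambda>P Q. {(\<lambda>s. x s + y s) |x y. x \<in> P \<and> y \<in> Q}),
      smult = (\<lambda>a P. {(\<lambda>s. a * x s + b s) |x b. x \<in> P \<and> b \<in> B})\<rparr>"

text \<open>The map of quotients induced by a map \<open>f\<close> of chains, where \<open>B\<close> is the subspace by which the
  target is divided: \<open>[x] \<mapsto> [f x]\<close>.\<close>

definition induced_map ::
    "('t \<Rightarrow> 'k::field) set \<Rightarrow> (('s \<Rightarrow> 'k) \<Rightarrow> 't \<Rightarrow> 'k) \<Rightarrow> ('s \<Rightarrow> 'k) set \<Rightarrow> ('t \<Rightarrow> 'k) set" where
  "induced_map B f P = {(\<lambda>t. f x t + b t) |x b. x \<in> P \<and> b \<in> B}"

text \<open>For a face \<open>\<tau>\<close> of codimension one of an \<open>n\<close>-cell \<open>\<sigma>\<close>, the incidence number is the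
  coefficient of \<open>\<tau>\<close> in the image of the orientation of \<open>\<sigma>\<close> under
  \<open>H\<^sub>n(cl \<sigma>, fr \<sigma>) \<rightarrow> H(fr \<sigma>, fr \<sigma> - \<tau>)\<close> (degree \<open>n - 1\<close>); by excision, the latter group is infinite
  cyclic and generated by the image of the orientation of \<open>\<tau>\<close>.\<close>

definition incidence :: "'a cw \<Rightarrow> 'a set \<Rightarrow> 'a set \<Rightarrow> int" where
  "incidence X \<sigma> \<tau> =
     (if \<sigma> \<in> cells X \<and> \<tau> \<in> cells X \<and> cell_face X \<tau> \<sigma> \<and> cdim X \<sigma> = cdim X \<tau> + 1
      then
        (let cl_\<sigma> = subtopology (cw_space X) (cell_closure X \<sigma>);
             fr_\<sigma> = subtopology (cw_space X) (cell_frontier X \<sigma>);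
             cl_\<tau> = subtopology (cw_space X) (cell_closure X \<tau>);
             C = cell_frontier X \<sigma> - \<tau>
         in THE m.
              hom_relboundary (int (cdim X \<sigma>)) cl_\<sigma> (cell_frontier X \<sigma>) C (orient X \<sigma>) =
              hom_induced (int (cdim X \<tau>)) cl_\<tau> (cell_frontier X \<tau>) fr_\<sigma> C id (orient X \<tau>)
                [^]\<^bsub>relative_homology_group (int (cdim X \<tau>)) fr_\<sigma> C\<^esub> m)
      else 0)"

definition cell_boundary :: "'a cw \<Rightarrow> ('a set \<Rightarrow> 'k::field) \<Rightarrow> 'a set \<Rightarrow> 'k" where
  "cell_boundary X x \<tau> = (\<Sum>\<sigma>\<in>cells X. of_int (incidence X \<sigma> \<tau>) * x \<sigma>)"

definition cell_chains :: "'a cw \<Rightarrow> 'a set set \<Rightarrow> nat \<Rightarrow> ('a set \<Rightarrow> 'k::field) set" where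
  "cell_chains X S n = carrier (chain_module {\<sigma> \<in> S. cdim X \<sigma> = n})"

definition cell_homology ::
    "'a cw \<Rightarrow> 'a set set \<Rightarrow> nat \<Rightarrow> ('k::field, ('a set \<Rightarrow> 'k) set) module" where
  "cell_homology X S n =
     quotient_module {x \<in> cell_chains X S n. cell_boundary X x = (\<lambda>\<tau>. 0)}
       (cell_boundary X ` cell_chains X S (n + 1))"

definition acyclic_complex :: "'k::field itself \<Rightarrow> 'a cw \<Rightarrow> 'a set set \<Rightarrow> bool" where
  "acyclic_complex k X S \<longleftrightarrow>
     one_dimensional (cell_homology X S 0 :: ('k, _) module) \<and>
     (\<forall>n>0. carrier (cell_homology X S n :: ('k, _) module) =
              {\<zero>\<^bsub>(cell_homology X S n :: ('k, _) module)\<^esub>})"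

text \<open>A tame filtered complex has a finite colimit \<open>X\<close>, and is given by the subcomplexes \<open>A r\<close> of \<open>X\<close>;
  the maps \<open>A r \<rightarrow> A s\<close> are the inclusions.\<close>

definition filtered_cw :: "'a cw \<Rightarrow> (real \<Rightarrow> 'a set set) \<Rightarrow> bool" where
  "filtered_cw X A \<longleftrightarrow>
     finite_regular_cw X \<and> (\<forall>r. subcomplex X (A r)) \<and> mono A \<and> (\<Union>r. A r) = cells X"

definition right_open_interval :: "real set \<Rightarrow> bool" where
  "right_open_interval T \<longleftrightarrow>
     T = UNIV \<or> (\<exists>b. T = {..<b}) \<or> (\<exists>a. T = {a..}) \<or> (\<exists>a b. a < b \<and> T = {a..<b})"

definition tame :: "(real \<Rightarrow> 'a set set) \<Rightarrow> bool" where
  "tame A \<longleftrightarrow>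
     (\<exists>P. finite P \<and> disjoint P \<and> \<Union>P = UNIV \<and>
        (\<forall>T\<in>P. right_open_interval T \<and> (\<forall>r\<in>T. \<forall>s\<in>T. A r = A s)))"

definition cw_cover :: "'a cw \<Rightarrow> 'i set \<Rightarrow> ('i \<Rightarrow> 'a set set) \<Rightarrow> bool" where
  "cw_cover X I U \<longleftrightarrow> (\<forall>i\<in>I. subcomplex X (U i)) \<and> (\<Union>i\<in>I. U i) = cells X"

definition nerve :: "'i set \<Rightarrow> ('i \<Rightarrow> 'a set set) \<Rightarrow> 'i set set" where
  "nerve I U = {J. finite J \<and> J \<noteq> {} \<and> J \<subseteq> I \<and> (\<Inter>j\<in>J. U j) \<noteq> {}}"

text \<open>The diagram \<open>X\<^sup>U\<close>, evaluated at a simplex of the nerve and a filtration value. All its maps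
  are inclusions of sets of cells.\<close>

definition cover_diagram ::
    "(real \<Rightarrow> 'a set set) \<Rightarrow> ('i \<Rightarrow> 'a set set) \<Rightarrow> 'i set \<Rightarrow> real \<Rightarrow> 'a set set" where
  "cover_diagram A U J r = (\<Inter>j\<in>J. U j) \<inter> A r"

definition cell_carrier ::
    "'a cw \<Rightarrow> 'a set set \<Rightarrow> 'b cw \<Rightarrow> 'b set set \<Rightarrow> ('a set \<Rightarrow> 'b set set) \<Rightarrow> bool" where
  "cell_carrier X \<Phi> Y \<Gamma> F \<longleftrightarrow>
     (\<forall>\<sigma>\<in>\<Phi>. subcomplex Y (F \<sigma>) \<and> F \<sigma> \<subseteq> \<Gamma>) \<and>
     (\<forall>\<sigma>\<in>\<Phi>. \<forall>\<tau>\<in>\<Phi>. cell_face X \<tau> \<sigma> \<longrightarrow> F \<tau> \<subseteq> F \<sigma>)"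

definition acyclic_carrier ::
    "'k::field itself \<Rightarrow> 'a cw \<Rightarrow> 'a set set \<Rightarrow> 'b cw \<Rightarrow> 'b set set \<Rightarrow> ('a set \<Rightarrow> 'b set set) \<Rightarrow> bool" where
  "acyclic_carrier k X \<Phi> Y \<Gamma> F \<longleftrightarrow>
     cell_carrier X \<Phi> Y \<Gamma> F \<and> (\<forall>\<sigma>\<in>\<Phi>. F \<sigma> \<noteq> {} \<and> acyclic_complex k Y (F \<sigma>))"

definition carried_by ::
    "'a set set \<Rightarrow> ('a set \<Rightarrow> 'b set set) \<Rightarrow> (('a set \<Rightarrow> 'k::field) \<Rightarrow> 'b set \<Rightarrow> 'k) \<Rightarrow> bool" where
  "carried_by \<Phi> F w \<longleftrightarrow> (\<forall>\<sigma>\<in>\<Phi>. \<forall>\<tau>. w (\<lambda>\<rho>. of_bool (\<rho> = \<sigma>)) \<tau> \<noteq> 0 \<longrightarrow> \<tau> \<in> F \<sigma>)"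

definition carrier_comp ::
    "('b set \<Rightarrow> 'c set set) \<Rightarrow> ('a set \<Rightarrow> 'b set set) \<Rightarrow> 'a set \<Rightarrow> 'c set set" where
  "carrier_comp H F \<sigma> = (\<Union>\<tau>\<in>F \<sigma>. H \<tau>)"

definition carrier_le ::
    "'a set set \<Rightarrow> ('a set \<Rightarrow> 'b set set) \<Rightarrow> ('a set \<Rightarrow> 'b set set) \<Rightarrow> bool" where
  "carrier_le \<Phi> F G \<longleftrightarrow> (\<forall>\<sigma>\<in>\<Phi>. F \<sigma> \<subseteq> G \<sigma>)"

definition eps_acyclic_carrier ::
    "'k::field itself \<Rightarrow> real \<Rightarrow> 'a cw \<Rightarrow> (real \<Rightarrow> 'a set set) \<Rightarrow> 'b cw \<Rightarrow> (real \<Rightarrow> 'b set set)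
     \<Rightarrow> (real \<Rightarrow> 'a set \<Rightarrow> 'b set set) \<Rightarrow> bool" where
  "eps_acyclic_carrier k \<epsilon> X A Y B F \<longleftrightarrow>
     (\<forall>a. acyclic_carrier k X (A a) Y (B (a + \<epsilon>)) (F a)) \<and>
     (\<forall>a b. a \<le> b \<longrightarrow> (\<forall>c\<in>A a. F a c \<subseteq> F b c))"

text \<open>The chain map of a shift \<open>A a \<rightarrow> A (a + \<epsilon>)\<close> is the identity on chains, as it is induced by
  an inclusion.\<close>

definition shift_carrier ::
    "'k::field itself \<Rightarrow> real \<Rightarrow> 'a cw \<Rightarrow> (real \<Rightarrow> 'a set set) \<Rightarrow> (real \<Rightarrow> 'a set \<Rightarrow> 'a set set) \<Rightarrow> bool" where
  "shift_carrier k \<epsilon> X A F \<longleftrightarrow>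
     eps_acyclic_carrier k \<epsilon> X A X A F \<and>
     (\<forall>a. carried_by (A a) (F a) (\<lambda>x :: 'a set \<Rightarrow> 'k. x))"

definition eps_K_acyclic_carrier ::
    "'k::field itself \<Rightarrow> real \<Rightarrow> 'i set set \<Rightarrow> 'a cw \<Rightarrow> ('i set \<Rightarrow> real \<Rightarrow> 'a set set)
     \<Rightarrow> 'b cw \<Rightarrow> ('i set \<Rightarrow> real \<Rightarrow> 'b set set) \<Rightarrow> ('i set \<Rightarrow> real \<Rightarrow> 'a set \<Rightarrow> 'b set set) \<Rightarrow> bool" where
  "eps_K_acyclic_carrier k \<epsilon> K X D Y L F \<longleftrightarrow>
     (\<forall>\<sigma>\<in>K. eps_acyclic_carrier k \<epsilon> X (D \<sigma>) Y (L \<sigma>) (F \<sigma>)) \<and>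
     (\<forall>\<sigma>\<in>K. \<forall>\<tau>\<in>K. \<tau> \<subseteq> \<sigma> \<longrightarrow>
        (\<forall>a. \<forall>c\<in>D \<sigma> a. F \<sigma> a c \<subseteq> F \<tau> a c \<and>
           (\<forall>r\<ge>0. acyclic_complex k Y (F \<tau> (a + r) c))))"

definition shift_K_acyclic_carrier ::
    "'k::field itself \<Rightarrow> real \<Rightarrow> 'i set set \<Rightarrow> 'a cw \<Rightarrow> ('i set \<Rightarrow> real \<Rightarrow> 'a set set)
     \<Rightarrow> ('i set \<Rightarrow> real \<Rightarrow> 'a set \<Rightarrow> 'a set set) \<Rightarrow> bool" where
  "shift_K_acyclic_carrier k \<epsilon> K X D F \<longleftrightarrow>
     eps_K_acyclic_carrier k \<epsilon> K X D X D F \<and> (\<forall>\<sigma>\<in>K. shift_carrier k \<epsilon> X (D \<sigma>) (F \<sigma>))"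

text \<open>The double complex of a diagram \<open>D\<close> of subcomplexes of \<open>X\<close> over \<open>K\<close>. It has a basis of pairs
  \<open>(\<sigma>, c)\<close> of a simplex and a cell of \<open>D \<sigma> r\<close>, of bidegree \<open>(card \<sigma> - 1, cdim X c)\<close>.
  The total space is the direct sum of all bidegrees.\<close>

definition dc_total ::
    "'i set set \<Rightarrow> ('i set \<Rightarrow> real \<Rightarrow> 'a set set) \<Rightarrow> real \<Rightarrow> ('k::field, 'i set \<times> 'a set \<Rightarrow> 'k) module" where
  "dc_total K D r = chain_module {(\<sigma>, c). \<sigma> \<in> K \<and> c \<in> D \<sigma> r}"

definition dc_component ::
    "'a cw \<Rightarrow> 'i set set \<Rightarrow> ('i set \<Rightarrow> real \<Rightarrow> 'a set set) \<Rightarrow> real \<Rightarrow> nat \<Rightarrow> nat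
     \<Rightarrow> ('k::field, 'i set \<times> 'a set \<Rightarrow> 'k) module" where
  "dc_component X K D r p q =
     chain_module {(\<sigma>, c). \<sigma> \<in> K \<and> c \<in> D \<sigma> r \<and> card \<sigma> = p + 1 \<and> cdim X c = q}"

definition dc_vertical ::
    "'a cw \<Rightarrow> ('i set \<times> 'a set \<Rightarrow> 'k::field) \<Rightarrow> 'i set \<times> 'a set \<Rightarrow> 'k" where
  "dc_vertical X x = (\<lambda>(\<sigma>, c). (-1) ^ (card \<sigma> - 1) * cell_boundary X (\<lambda>e. x (\<sigma>, e)) c)"

text \<open>The coefficient at \<open>(\<tau>, c)\<close> collects the contributions of all simplices \<open>\<sigma>\<close> of which \<open>\<tau>\<close> is the
  \<open>i\<close>-th face, i.e. \<open>\<sigma>\<close> with its vertex \<open>v\<close> at position \<open>i\<close> omitted.\<close>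

definition dc_horizontal ::
    "'i::linorder set set \<Rightarrow> ('i set \<times> 'a set \<Rightarrow> 'k::field) \<Rightarrow> 'i set \<times> 'a set \<Rightarrow> 'k" where
  "dc_horizontal K x =
     (\<lambda>(\<tau>, c). if \<tau> \<in> K
        then \<Sum>\<sigma>\<in>K. \<Sum>v\<in>\<sigma>. if \<sigma> - {v} = \<tau> then (-1) ^ card {j \<in> \<sigma>. j < v} * x (\<sigma>, c) else 0
        else 0)"

definition dc_differential ::
    "'a cw \<Rightarrow> 'i::linorder set set \<Rightarrow> ('i set \<times> 'a set \<Rightarrow> 'k::field) \<Rightarrow> 'i set \<times> 'a set \<Rightarrow> 'k" where
  "dc_differential X K x = (\<lambda>s. dc_vertical X x s + dc_horizontal K x s)"

text \<open>A morphism of double complexes from that of \<open>(X, D)\<close> to that of \<open>(Y, L)\<close> shifted by \<open>\<epsilon>\<close>,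
  natural in the filtration parameter.\<close>

definition dc_morphism ::
    "real \<Rightarrow> 'i::linorder set set \<Rightarrow> 'a cw \<Rightarrow> ('i set \<Rightarrow> real \<Rightarrow> 'a set set)
     \<Rightarrow> 'b cw \<Rightarrow> ('i set \<Rightarrow> real \<Rightarrow> 'b set set)
     \<Rightarrow> (real \<Rightarrow> ('i set \<times> 'a set \<Rightarrow> 'k::field) \<Rightarrow> 'i set \<times> 'b set \<Rightarrow> 'k) \<Rightarrow> bool" where
  "dc_morphism \<epsilon> K X D Y L \<phi> \<longleftrightarrow>
     (\<forall>r. linear_map (dc_total K D r) (dc_total K L (r + \<epsilon>)) (\<phi> r) \<and>
        (\<forall>p q. \<phi> r \<in> carrier (dc_component X K D r p q) \<rightarrow> carrier (dc_component Y K L (r + \<epsilon>) p q)) \<and>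
        (\<forall>x\<in>carrier (dc_total K D r).
           \<phi> r (dc_vertical X x) = dc_vertical Y (\<phi> r x) \<and>
           \<phi> r (dc_horizontal K x) = dc_horizontal K (\<phi> r x) \<and>
           (\<forall>s\<ge>r. \<phi> s x = \<phi> r x)))"

text \<open>The differential of the \<open>n\<close>-th page maps bidegree \<open>(p, q)\<close> to \<open>(p - n, q + n - 1)\<close>. The
  isomorphism of the homology of the \<open>n\<close>-th page with the next one is given by the map from the
  kernel of the differential to the next page.\<close>

record ('k, 'v) spectral_sequence =
  page :: "nat \<Rightarrow> int \<Rightarrow> int \<Rightarrow> ('k, 'v) module"
  page_diff :: "nat \<Rightarrow> int \<Rightarrow> int \<Rightarrow> 'v \<Rightarrow> 'v"
  next_page :: "nat \<Rightarrow> int \<Rightarrow> int \<Rightarrow> 'v \<Rightarrow> 'v"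

definition ss_morphism ::
    "nat \<Rightarrow> ('k, 'v) spectral_sequence \<Rightarrow> ('k, 'w) spectral_sequence
     \<Rightarrow> (nat \<Rightarrow> int \<Rightarrow> int \<Rightarrow> 'v \<Rightarrow> 'w) \<Rightarrow> bool" where
  "ss_morphism n S T f \<longleftrightarrow>
     (\<forall>m\<ge>n. \<forall>p q.
        linear_map (page S m p q) (page T m p q) (f m p q) \<and>
        (\<forall>x\<in>carrier (page S m p q).
           f m (p - int m) (q + int m - 1) (page_diff S m p q x) = page_diff T m p q (f m p q x) \<and>
           (page_diff S m p q x = \<zero>\<^bsub>page S m (p - int m) (q + int m - 1)\<^esub> \<longrightarrow>
              f (m + 1) p q (next_page S m p q x) = next_page T m p q (f m p q x))))"

text \<open>The data of a functor from \<open>(\<real>, \<le>)\<close> to spectral sequences; \<open>ss_trans r s\<close> is the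
  morphism from \<open>r\<close> to \<open>s\<close>, for \<open>r \<le> s\<close>.\<close>

record ('k, 'v) persistent_ss =
  ss_at :: "real \<Rightarrow> ('k, 'v) spectral_sequence"
  ss_trans :: "real \<Rightarrow> real \<Rightarrow> nat \<Rightarrow> int \<Rightarrow> int \<Rightarrow> 'v \<Rightarrow> 'v"

definition ss_shift_morphism ::
    "real \<Rightarrow> nat \<Rightarrow> ('k, 'v) persistent_ss \<Rightarrow> ('k, 'w) persistent_ss
     \<Rightarrow> (real \<Rightarrow> nat \<Rightarrow> int \<Rightarrow> int \<Rightarrow> 'v \<Rightarrow> 'w) \<Rightarrow> bool" where
  "ss_shift_morphism \<epsilon> n \<A> \<B> f \<longleftrightarrow>
     (\<forall>r. ss_morphism n (ss_at \<A> r) (ss_at \<B> (r + \<epsilon>)) (f r)) \<and>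
     (\<forall>r s. r \<le> s \<longrightarrow> (\<forall>m\<ge>n. \<forall>p q. \<forall>x\<in>carrier (page (ss_at \<A> r) m p q).
        f s m p q (ss_trans \<A> r s m p q x) = ss_trans \<B> (r + \<epsilon>) (s + \<epsilon>) m p q (f r m p q x)))"

definition ss_interleaving ::
    "real \<Rightarrow> nat \<Rightarrow> ('k, 'v) persistent_ss \<Rightarrow> ('k, 'w) persistent_ss
     \<Rightarrow> (real \<Rightarrow> nat \<Rightarrow> int \<Rightarrow> int \<Rightarrow> 'v \<Rightarrow> 'w) \<Rightarrow> (real \<Rightarrow> nat \<Rightarrow> int \<Rightarrow> int \<Rightarrow> 'w \<Rightarrow> 'v) \<Rightarrow> bool" where
  "ss_interleaving \<epsilon> n \<A> \<B> f g \<longleftrightarrow>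
     ss_shift_morphism \<epsilon> n \<A> \<B> f \<and> ss_shift_morphism \<epsilon> n \<B> \<A> g \<and>
     (\<forall>r. \<forall>m\<ge>n. \<forall>p q.
        (\<forall>x\<in>carrier (page (ss_at \<A> r) m p q).
           g (r + \<epsilon>) m p q (f r m p q x) = ss_trans \<A> r (r + 2 * \<epsilon>) m p q x) \<and>
        (\<forall>y\<in>carrier (page (ss_at \<B> r) m p q).
           f (r + \<epsilon>) m p q (g r m p q y) = ss_trans \<B> r (r + 2 * \<epsilon>) m p q y))"

text \<open>The spectral sequence of the total complex filtered by the horizontal degree, with
  \<open>Z\<^sup>n\<^sub>p = {x \<in> F\<^sub>p. d x \<in> F\<^sub>p\<^sub>-\<^sub>n}\<close>, \<open>B\<^sup>n\<^sub>p = Z\<^sup>n\<^sup>-\<^sup>1\<^sub>p\<^sub>-\<^sub>1 + d Z\<^sup>n\<^sup>-\<^sup>1\<^sub>p\<^sub>+\<^sub>n\<^sub>-\<^sub>1\<close> and \<open>E\<^sup>n\<^sub>p = Z\<^sup>n\<^sub>p / B\<^sup>n\<^sub>p\<close>.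
  The first argument of \<open>dc_cycles\<close> and \<open>dc_boundaries\<close> is the page; it is an integer
  because page 0 involves the index \<open>-1\<close>.\<close>

definition dc_filtration ::
    "'a cw \<Rightarrow> 'i set set \<Rightarrow> ('i set \<Rightarrow> real \<Rightarrow> 'a set set) \<Rightarrow> real \<Rightarrow> int \<Rightarrow> int
     \<Rightarrow> ('i set \<times> 'a set \<Rightarrow> 'k::field) set" where
  "dc_filtration X K D r p k =
     carrier (chain_module {(\<sigma>, c). \<sigma> \<in> K \<and> c \<in> D \<sigma> r \<and>
       int (card \<sigma>) - 1 \<le> p \<and> int (card \<sigma>) - 1 + int (cdim X c) = k})"

definition dc_cycles ::
    "int \<Rightarrow> 'a cw \<Rightarrow> 'i::linorder set set \<Rightarrow> ('i set \<Rightarrow> real \<Rightarrow> 'a set set) \<Rightarrow> real \<Rightarrow> int \<Rightarrow> int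
     \<Rightarrow> ('i set \<times> 'a set \<Rightarrow> 'k::field) set" where
  "dc_cycles n X K D r p q =
     {x \<in> dc_filtration X K D r p (p + q).
        dc_differential X K x \<in> dc_filtration X K D r (p - n) (p + q - 1)}"

definition dc_boundaries ::
    "int \<Rightarrow> 'a cw \<Rightarrow> 'i::linorder set set \<Rightarrow> ('i set \<Rightarrow> real \<Rightarrow> 'a set set) \<Rightarrow> real \<Rightarrow> int \<Rightarrow> int
     \<Rightarrow> ('i set \<times> 'a set \<Rightarrow> 'k::field) set" where
  "dc_boundaries n X K D r p q =
     {(\<lambda>s. z s + dc_differential X K w s) |z w.
        z \<in> dc_cycles (n - 1) X K D r (p - 1) (q + 1) \<and>
        w \<in> dc_cycles (n - 1) X K D r (p + n - 1) (q - n + 2)}"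

definition dc_spectral_sequence ::
    "'a cw \<Rightarrow> 'i::linorder set set \<Rightarrow> ('i set \<Rightarrow> real \<Rightarrow> 'a set set) \<Rightarrow> real
     \<Rightarrow> ('k::field, ('i set \<times> 'a set \<Rightarrow> 'k) set) spectral_sequence" where
  "dc_spectral_sequence X K D r =
     \<lparr>page = (\<lambda>n p q. quotient_module (dc_cycles (int n) X K D r p q) (dc_boundaries (int n) X K D r p q)),
      page_diff = (\<lambda>n p q.
        induced_map (dc_boundaries (int n) X K D r (p - int n) (q + int n - 1)) (dc_differential X K)),
      next_page = (\<lambda>n p q P.
        induced_map (dc_boundaries (int n + 1) X K D r p q) (\<lambda>x. x)
          (P \<inter> dc_cycles (int n + 1) X K D r p q))\<rparr>"

definition dc_induced ::
    "real \<Rightarrow> 'i::linorder set set \<Rightarrow> 'b cw \<Rightarrow> ('i set \<Rightarrow> real \<Rightarrow> 'b set set)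
     \<Rightarrow> (real \<Rightarrow> ('i set \<times> 'a set \<Rightarrow> 'k::field) \<Rightarrow> 'i set \<times> 'b set \<Rightarrow> 'k)
     \<Rightarrow> real \<Rightarrow> nat \<Rightarrow> int \<Rightarrow> int \<Rightarrow> ('i set \<times> 'a set \<Rightarrow> 'k) set \<Rightarrow> ('i set \<times> 'b set \<Rightarrow> 'k) set" where
  "dc_induced \<epsilon> K Y L \<phi> r n p q =
     induced_map (dc_boundaries (int n) Y K L (r + \<epsilon>) p q) (\<phi> r)"

definition persistent_spectral_sequence ::
    "'a cw \<Rightarrow> 'i::linorder set set \<Rightarrow> ('i set \<Rightarrow> real \<Rightarrow> 'a set set)
     \<Rightarrow> ('k::field, ('i set \<times> 'a set \<Rightarrow> 'k) set) persistent_ss" where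
  "persistent_spectral_sequence X K D =
     \<lparr>ss_at = dc_spectral_sequence X K D,
      ss_trans = (\<lambda>r s n p q. induced_map (dc_boundaries (int n) X K D s p q) (\<lambda>x. x))\<rparr>"

end

theory Submission
  imports Defs
begin

text \<open>The carriers of all simplices and filtration values are nested. On a cell \<open>c\<close>, the carrier of the
  largest simplex whose intersection contains \<open>c\<close>, taken at the filtration value where it is smallest,
  lies in all the other ones. These choices form a single acyclic carrier on \<open>X\<close>, so the method of
  acyclic carriers yields one chain map \<open>f\<close> from \<open>X\<close> to \<open>Y\<close> which, restricted to the pieces of the
  diagram, commutes strictly with all inclusions and hence is a morphism of double complexes.

  The composite \<open>g f\<close> and the identity are carried on each piece by the shift carrier, hence chain
  homotopic there. These homotopies need not be natural: if \<open>x\<close> is a cycle of page \<open>n \<ge> 1\<close>, then a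
  homotopy applied to the columns of horizontal degree \<open>p\<close> writes \<open>g f x - x\<close> as \<open>z + d w\<close> with
  \<open>w \<in> F\<^sub>p\<close> and \<open>z \<in> F\<^sub>p\<^sub>-\<^sub>1\<close>, which suffices for it to be a boundary of page \<open>n\<close>.

  The method of acyclic carriers needs that the cellular boundary squares to zero and that there is
  an augmentation. As the incidence numbers are defined by singular homology, both come from the
  following: for an \<open>n\<close>-cell \<open>\<sigma>\<close> with frontier \<open>S\<close>, and \<open>R\<close> the union of the faces of dimension less
  than \<open>n - 1\<close>, classes in \<open>H\<^sub>n\<^sub>-\<^sub>1(S, R)\<close> are detected in the groups \<open>H\<^sub>n\<^sub>-\<^sub>1(S, S - \<tau>)\<close> of the facets \<open>\<tau>\<close>,
  by excision and the exact sequences of triples. So the boundary of the orientation of \<open>\<sigma>\<close> is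
  the sum of the orientations of the facets, weighted by the incidence numbers.\<close>

section \<open>Excision for a cell\<close>

text \<open>Chain maps chosen separately for each simplex would commute with the inclusions of the
  diagram only up to homotopy, which is too weak for a morphism of double complexes; this forces a
  single choice per cell. An infimum of filtration values need not be attained, so the smallest
  carrier is found differently: the carriers of one cell at a fixed simplex form a chain of
  subcomplexes of a finite complex, and one of minimal cardinality lies in all the others.

  Homotopies may be chosen independently on the pieces because the horizontal boundary of
  \<open>w\<close> drops to \<open>F_{p-1}\<close>, where it is absorbed by \<open>z\<close>. From
  page 1 on, the columns of horizontal degree \<open>p\<close> of a page cycle are themselves
  cycles, so the term of the homotopy formula that involves their boundary vanishes.

  One augmentation is fixed on each complex, and both \<open>f\<close> and \<open>g\<close> are
  built to respect this pair. Hence \<open>g f\<close> minus the identity has augmentation zero,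
  which starts the induction for the homotopy. Vertices may be oriented with either sign; comparing
  them in the homology of a point gives a consistent choice.\<close>

lemma closed_ball_altdef:
  "closed_ball n = subtopology (powertop_real UNIV) {x. (\<forall>i\<ge>n. x i = 0) \<and> (\<Sum>i<n. (x i)\<^sup>2) \<le> 1}"
  by (simp add: closed_ball_def Euclidean_space_def subtopology_subtopology Collect_conj_eq)

lemma topspace_closed_ball:
  "topspace (closed_ball n) = {x. (\<forall>i\<ge>n. x i = 0) \<and> (\<Sum>i<n. (x i)\<^sup>2) \<le> 1}"
  by (simp add: closed_ball_altdef)

lemma open_ball_altdef: "open_ball n = {x. (\<forall>i\<ge>n. x i = 0) \<and> (\<Sum>i<n. (x i)\<^sup>2) < 1}"
  by (auto simp: open_ball_def topspace_Euclidean_space)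

lemma open_ball_subset: "open_ball n \<subseteq> topspace (closed_ball n)"
  by (auto simp: open_ball_altdef topspace_closed_ball)

lemma open_ball_nonempty: "open_ball n \<noteq> {}"
proof -
  have "(\<lambda>i. 0) \<in> open_ball n" by (simp add: open_ball_altdef)
  then show ?thesis by blast
qed

lemma continuous_map_closed_ball_coordinate: "continuous_map (closed_ball n) euclideanreal (\<lambda>x. x i)"
  unfolding closed_ball_altdef
  by (intro continuous_map_from_subtopology continuous_map_product_projection) simp

text \<open>At \<open>t = 1\<close>, the complement of the ball of radius 1/2 is pushed to the unit sphere. So removing
  an open cell and removing the half of it give the same homology, and the closure of
  the half lies in the open cell, as excision requires.\<close>

definition clipped_dilation :: "nat \<Rightarrow> real \<Rightarrow> (nat \<Rightarrow> real) \<Rightarrow> nat \<Rightarrow> real" where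
  "clipped_dilation n t x =
     (\<lambda>i. (1 + t) / max 1 ((1 + t) * sqrt (\<Sum>i<n. (x i)\<^sup>2)) * x i)"

lemma clipped_dilation_norm:
  assumes "0 \<le> t"
  shows "sqrt (\<Sum>i<n. (clipped_dilation n t x i)\<^sup>2) = min 1 ((1 + t) * sqrt (\<Sum>i<n. (x i)\<^sup>2))"
proof -
  let ?N = "sqrt (\<Sum>i<n. (x i)\<^sup>2)"
  let ?c = "(1 + t) / max 1 ((1 + t) * ?N)"
  have c: "?c \<ge> 0" using assms by simp
  have "(\<Sum>i<n. (clipped_dilation n t x i)\<^sup>2) = ?c\<^sup>2 * (\<Sum>i<n. (x i)\<^sup>2)"
    unfolding clipped_dilation_def power_mult_distrib sum_distrib_left by simp
  then have "sqrt (\<Sum>i<n. (clipped_dilation n t x i)\<^sup>2) = ?c * ?N"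
    using c by (simp only: real_sqrt_mult real_sqrt_abs abs_of_nonneg)
  also have "\<dots> = min 1 ((1 + t) * ?N)"
    by (auto simp: max_def min_def divide_simps)
  finally show ?thesis .
qed

lemma clipped_dilation_0:
  assumes "x \<in> topspace (closed_ball n)"
  shows "clipped_dilation n 0 x = x"
proof -
  have "sqrt (\<Sum>i<n. (x i)\<^sup>2) \<le> 1"
    using assms by (simp add: topspace_closed_ball)
  then have "max 1 (sqrt (\<Sum>i<n. (x i)\<^sup>2)) = 1" by simp
  then show ?thesis by (simp add: clipped_dilation_def)
qed

text \<open>Because the sphere stays fixed at all times, the homotopy on a closed cell extends by
  the identity to the space around it.\<close>

lemma clipped_dilation_sphere:
  assumes "(\<Sum>i<n. (x i)\<^sup>2) = 1" "0 \<le> t"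
  shows "clipped_dilation n t x = x"
  using assms by (auto simp: clipped_dilation_def max_def)

lemma clipped_dilation_closed_ball:
  assumes "x \<in> topspace (closed_ball n)" "0 \<le> t"
  shows "clipped_dilation n t x \<in> topspace (closed_ball n)"
proof -
  have "sqrt (\<Sum>i<n. (clipped_dilation n t x i)\<^sup>2) \<le> 1"
    using clipped_dilation_norm[OF assms(2)] by simp
  moreover have "\<forall>i\<ge>n. clipped_dilation n t x i = 0"
    using assms(1) by (simp add: clipped_dilation_def topspace_closed_ball)
  ultimately show ?thesis by (simp add: topspace_closed_ball)
qed

lemma continuous_map_clipped_dilation:
  "continuous_map (prod_topology (top_of_set {0..1}) (closed_ball n)) (closed_ball n)
     (\<lambda>(t, x). clipped_dilation n t x)"
proof -
  let ?P = "prod_topology (top_of_set {0..1::real}) (closed_ball n)"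
  have f: "continuous_map ?P euclideanreal fst"
    using continuous_map_fst[of "top_of_set {0..1::real}" "closed_ball n"]
    by (simp add: continuous_map_in_subtopology)
  have s: "continuous_map ?P euclideanreal (\<lambda>z. snd z i)" for i
    using continuous_map_compose[OF continuous_map_snd continuous_map_closed_ball_coordinate]
    by (simp add: o_def)
  have N: "continuous_map ?P euclideanreal (\<lambda>z. sqrt (\<Sum>i<n. (snd z i)\<^sup>2))"
    by (intro continuous_map_sqrt continuous_map_sum continuous_map_real_pow s) auto
  have "continuous_map ?P euclideanreal
          (\<lambda>z. (1 + fst z) / max 1 ((1 + fst z) * sqrt (\<Sum>i<n. (snd z i)\<^sup>2)) * snd z i)" for i
    by (intro continuous_map_real_mult continuous_map_real_divide continuous_map_add
        continuous_map_real_max N f s) (auto simp: max_def)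
  then have "continuous_map ?P (powertop_real UNIV) (\<lambda>z. clipped_dilation n (fst z) (snd z))"
    by (simp add: continuous_map_componentwise_UNIV clipped_dilation_def)
  moreover have "clipped_dilation n (fst z) (snd z) \<in> topspace (closed_ball n)"
    if "z \<in> topspace ?P" for z
    using that by (auto intro!: clipped_dilation_closed_ball)
  ultimately show ?thesis
    unfolding closed_ball_altdef by (auto simp: continuous_map_in_subtopology case_prod_unfold)
qed

text \<open>The model is a maximal cell of a subcomplex: the closed cell \<open>C\<close> is a ball,
  and its interior \<open>\<rho>\<close> is open in all of \<open>W\<close>, so the rest of
  \<open>W\<close> touches \<open>C\<close> only along the frontier.\<close>

locale attached_cell =
  fixes W :: "'a topology" and C \<rho> :: "'a set" and n :: nat and h :: "(nat \<Rightarrow> real) \<Rightarrow> 'a"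
  assumes closedin_C: "closedin W C"
    and openin_rho: "openin W \<rho>"
    and rho_image: "h ` open_ball n = \<rho>"
    and h: "homeomorphic_map (closed_ball n) (subtopology W C) h"
begin

definition "h' = (SOME g. homeomorphic_maps (closed_ball n) (subtopology W C) h g)"

lemma h': "homeomorphic_maps (closed_ball n) (subtopology W C) h h'"
  unfolding h'_def using h unfolding homeomorphic_map_maps by (rule someI_ex)

lemma C_sub: "C \<subseteq> topspace W"
  using closedin_C by (rule closedin_subset)

lemma h_image: "h ` topspace (closed_ball n) = C"
  using homeomorphic_imp_surjective_map[OF h] C_sub by (simp add: inf_absorb2)

lemma rho_sub: "\<rho> \<subseteq> C"
  using h_image open_ball_subset rho_image by blast

lemma h'_h: "x \<in> topspace (closed_ball n) \<Longrightarrow> h' (h x) = x"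
  using h' by (auto simp: homeomorphic_maps_def)

lemma h_h': "w \<in> C \<Longrightarrow> h (h' w) = w"
  using h' C_sub by (auto simp: homeomorphic_maps_def)

lemma h'_in: "w \<in> C \<Longrightarrow> h' w \<in> topspace (closed_ball n)"
  using h' C_sub by (auto simp: homeomorphic_maps_def continuous_map_def Pi_iff)

lemma h_in_rho:
  assumes "x \<in> topspace (closed_ball n)" shows "h x \<in> \<rho> \<longleftrightarrow> x \<in> open_ball n"
proof
  assume "h x \<in> \<rho>"
  then obtain y where y: "y \<in> open_ball n" "h x = h y"
    unfolding rho_image[symmetric] by auto
  then have "y = x" using h'_h[OF assms] h'_h[of y] open_ball_subset by (metis subsetD)
  with y show "x \<in> open_ball n" by simp
next
  assume "x \<in> open_ball n"
  then show "h x \<in> \<rho>" unfolding rho_image[symmetric] by (rule imageI)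
qed

definition half :: "'a set" where
  "half = h ` {x \<in> topspace (closed_ball n). sqrt (\<Sum>i<n. (x i)\<^sup>2) \<le> 1/2}"

lemma h_in_half:
  "x \<in> topspace (closed_ball n) \<Longrightarrow> h x \<in> half \<longleftrightarrow> sqrt (\<Sum>i<n. (x i)\<^sup>2) \<le> 1/2"
proof
  assume x: "x \<in> topspace (closed_ball n)" and "h x \<in> half"
  then obtain y where y: "y \<in> topspace (closed_ball n)" "h x = h y" "sqrt (\<Sum>i<n. (y i)\<^sup>2) \<le> 1/2"
    by (auto simp: half_def)
  then have "x = y" using x h'_h by metis
  with y show "sqrt (\<Sum>i<n. (x i)\<^sup>2) \<le> 1/2" by simp
qed (auto simp: half_def)

lemma half_sub: "half \<subseteq> \<rho>"
proof
  fix w assume "w \<in> half"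
  then obtain x where x: "x \<in> topspace (closed_ball n)" "w = h x" "sqrt (\<Sum>i<n. (x i)\<^sup>2) \<le> 1/2"
    by (auto simp: half_def)
  have "sqrt (\<Sum>i<n. (x i)\<^sup>2) < 1" using x(3) by linarith
  then have "x \<in> open_ball n" using x(1) by (simp add: open_ball_altdef topspace_closed_ball)
  then show "w \<in> \<rho>" using x rho_image by blast
qed

lemma closedin_half: "closedin W half"
proof -
  let ?H = "{x \<in> topspace (closed_ball n). (\<lambda>x. sqrt (\<Sum>i<n. (x i)\<^sup>2)) x \<in> {..1/2}}"
  have "continuous_map (closed_ball n) euclideanreal (\<lambda>x. sqrt (\<Sum>i<n. (x i)\<^sup>2))"
    by (intro continuous_map_sqrt continuous_map_sum continuous_map_real_pow
        continuous_map_closed_ball_coordinate) auto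
  then have "closedin (closed_ball n) ?H"
    by (intro closedin_continuous_map_preimage[where Y = euclideanreal]) auto
  then have "closedin (subtopology W C) (h ` ?H)"
    using homeomorphic_map_closedness[OF h closedin_subset] by blast
  moreover have "h ` ?H = half" by (simp add: half_def)
  ultimately show ?thesis using closedin_trans_full[OF _ closedin_C] by simp
qed

definition push :: "real \<times> 'a \<Rightarrow> 'a" where
  "push = (\<lambda>(t, w). if w \<in> C then h (clipped_dilation n t (h' w)) else w)"

lemma push_0: "push (0, w) = w"
  by (simp add: push_def clipped_dilation_0 h'_in h_h')

lemma push_outside:
  assumes "w \<notin> \<rho>" "0 \<le> t" shows "push (t, w) = w"
proof (cases "w \<in> C")
  case True
  have "h' w \<notin> open_ball n" using assms(1) True h_in_rho[OF h'_in[OF True]] h_h' by simp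
  then have "(\<Sum>i<n. (h' w i)\<^sup>2) = 1"
    using h'_in[OF True] by (auto simp: open_ball_altdef topspace_closed_ball)
  then show ?thesis using True assms(2) by (simp add: push_def clipped_dilation_sphere h_h')
qed (simp add: push_def)

lemma push_half:
  assumes "w \<notin> half" "0 \<le> t" shows "push (t, w) \<notin> half"
proof (cases "w \<in> C")
  case True
  let ?N = "sqrt (\<Sum>i<n. (h' w i)\<^sup>2)"
  have "\<not> ?N \<le> 1/2" using h_in_half[OF h'_in[OF True]] assms(1) h_h'[OF True] by simp
  moreover have "?N \<le> (1 + t) * ?N"
    using assms(2) mult_right_mono[of 1 "1 + t" ?N] by (simp add: sum_nonneg)
  ultimately have "\<not> min 1 ((1 + t) * ?N) \<le> 1/2" by linarith
  then show ?thesis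
    using True h_in_half[OF clipped_dilation_closed_ball[OF h'_in[OF True] assms(2)]]
    by (simp add: push_def clipped_dilation_norm[OF assms(2)])
qed (use assms in \<open>simp add: push_def\<close>)

lemma push_1:
  assumes "w \<notin> half" shows "push (1, w) \<notin> \<rho>"
proof (cases "w \<in> C")
  case True
  let ?N = "sqrt (\<Sum>i<n. (h' w i)\<^sup>2)"
  let ?x = "clipped_dilation n 1 (h' w)"
  have "\<not> ?N \<le> 1/2" using h_in_half[OF h'_in[OF True]] assms(1) h_h'[OF True] by simp
  then have "sqrt (\<Sum>i<n. (?x i)\<^sup>2) = 1" by (simp add: clipped_dilation_norm)
  then have "?x \<notin> open_ball n" by (simp add: open_ball_altdef)
  then show ?thesis
    using True h_in_rho[OF clipped_dilation_closed_ball[OF h'_in[OF True], of 1]]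
    by (simp add: push_def)
qed (use assms rho_sub in \<open>auto simp: push_def\<close>)

text \<open>The sets \<open>C\<close> and \<open>W - \<rho>\<close> are closed, the latter because
  \<open>\<rho>\<close> is open. They overlap in the sphere \<open>C - \<rho>\<close>, where the
  dilation is the identity, so the two formulas can be pasted.\<close>

lemma continuous_map_push: "continuous_map (prod_topology (top_of_set {0..1}) W) W push"
proof -
  let ?P = "prod_topology (top_of_set {0..1::real}) W"
  let ?T = "\<lambda>b. if b then {0..1::real} \<times> C else {0..1} \<times> (topspace W - \<rho>)"
  let ?f = "\<lambda>b (t, w). if b then h (clipped_dilation n t (h' w)) else w"
  show ?thesis
  proof (rule pasting_lemma_closed[where I = UNIV and T = ?T and f = ?f])
    show "closedin ?P (?T b)" for b
      using closedin_C openin_rho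
      by (auto simp: closedin_prod_Times_iff)
  next
    fix b
    have 1: "continuous_map (prod_topology (top_of_set {0..1::real}) (subtopology W C)) W
               (\<lambda>(t, w). h (clipped_dilation n t (h' w)))"
    proof -
      have "continuous_map (subtopology W C) (closed_ball n) h'"
        using h' by (simp add: homeomorphic_maps_def)
      then have "continuous_map (prod_topology (top_of_set {0..1::real}) (subtopology W C))
                   (prod_topology (top_of_set {0..1::real}) (closed_ball n)) (\<lambda>(t, w). (t, h' w))"
        using continuous_map_prod_top[of "top_of_set {0..1::real}" "subtopology W C"
            "top_of_set {0..1::real}" "closed_ball n" id h'] by simp
      from continuous_map_compose[OF this continuous_map_clipped_dilation]
      have "continuous_map (prod_topology (top_of_set {0..1::real}) (subtopology W C)) (closed_ball n)
               (\<lambda>(t, w). clipped_dilation n t (h' w))"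
        by (simp add: o_def case_prod_unfold)
      moreover have "continuous_map (closed_ball n) W h"
        using homeomorphic_imp_continuous_map[OF h] by (simp add: continuous_map_in_subtopology)
      ultimately have "continuous_map (prod_topology (top_of_set {0..1::real}) (subtopology W C)) W
               (h \<circ> (\<lambda>(t, w). clipped_dilation n t (h' w)))"
        by (rule continuous_map_compose)
      then show ?thesis by (simp add: o_def case_prod_unfold)
    qed
    have 2: "continuous_map (subtopology ?P ({0..1} \<times> (topspace W - \<rho>))) W snd"
      by (intro continuous_map_from_subtopology continuous_map_snd)
    show "continuous_map (subtopology ?P (?T b)) W (?f b)"
    proof (cases b)
      case True
      have "prod_topology (top_of_set {0..1::real}) (subtopology W C)
              = subtopology ?P ({0..1} \<times> C)"
        by (simp add: prod_topology_subtopology subtopology_subtopology Times_Int_Times)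
      then show ?thesis using 1 True by simp
    next
      case False
      have "(\<lambda>(t, w). w) = (snd :: real \<times> 'a \<Rightarrow> 'a)" by auto
      then show ?thesis using 2 False by simp
    qed
  next
    fix b c and z :: "real \<times> 'a"
    assume "z \<in> topspace ?P \<inter> ?T b \<inter> ?T c"
    moreover have "h (clipped_dilation n t (h' w)) = w" if "w \<in> C" "w \<notin> \<rho>" "0 \<le> t" for t w
      using push_outside[OF that(2,3)] that(1) by (simp add: push_def)
    ultimately show "?f b z = ?f c z" by (auto split: if_splits)
  next
    fix z assume "z \<in> topspace ?P"
    then show "\<exists>j. j \<in> UNIV \<and> z \<in> ?T j \<and> push z = ?f j z"
      using rho_sub by (intro exI[of _ "snd z \<in> C"]) (auto simp: push_def)
  qed simp
qed

text \<open>The push at time 1 is a homotopy inverse of the inclusion of pairs: it sends the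
  complement of \<open>half\<close> into the complement of \<open>\<rho>\<close>, and at every time
  the push preserves both complements.\<close>

lemma collar_iso:
  "hom_induced p W (topspace W - \<rho>) W (topspace W - half) id
     \<in> iso (relative_homology_group p W (topspace W - \<rho>))
           (relative_homology_group p W (topspace W - half))"
proof (rule homotopy_equivalence_relative_homology_group_isomorphism)
  let ?e = "\<lambda>w. push (1, w)"
  have top: "push (t, w) \<in> topspace W" if "t \<in> {0..1}" "w \<in> topspace W" for t w
    using continuous_map_push that by (auto simp: continuous_map_def Pi_iff)
  show "continuous_map W W ?e"
    using continuous_map_compose[OF _ continuous_map_push, of W "\<lambda>w. (1, w)"]
    by (simp add: o_def continuous_map_pairedI)
  show "?e \<in> topspace W - half \<rightarrow> topspace W - \<rho>"
    using top push_1 by auto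
  have H: "homotopic_with P W W ?e id"
    if "\<And>t. t \<in> {0..1} \<Longrightarrow> P (\<lambda>w. push (t, w))" for P :: "('a \<Rightarrow> 'a) \<Rightarrow> bool"
  proof -
    have "homotopic_with P W W id ?e"
      unfolding homotopic_with_def
      using continuous_map_push that push_0 by (intro exI[of _ push]) auto
    then show ?thesis by (rule homotopic_with_symD)
  qed
  show "homotopic_with (\<lambda>f. f \<in> topspace W - \<rho> \<rightarrow> topspace W - \<rho>) W W (?e \<circ> id) id"
    unfolding comp_id by (rule H) (use push_outside in auto)
  show "homotopic_with (\<lambda>f. f \<in> topspace W - half \<rightarrow> topspace W - half) W W (id \<circ> ?e) id"
    unfolding id_comp by (rule H) (use top push_half in auto)
qed (use half_sub in auto)

text \<open>This makes \<open>collar_iso\<close> available inside the closed cell as well as in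
  \<open>W\<close>.\<close>

lemma attached_cell_self: "attached_cell (subtopology W C) C \<rho> n h"
proof
  show "openin (subtopology W C) \<rho>"
    unfolding openin_subtopology using openin_rho rho_sub by (intro exI[of _ \<rho>]) auto
  show "homeomorphic_map (closed_ball n) (subtopology (subtopology W C) C) h"
    using h by (simp add: subtopology_subtopology)
qed (use C_sub rho_image in auto)

text \<open>Excision of \<open>W - C\<close> cannot be applied to \<open>W - \<rho>\<close>
  directly, since its interior may miss frontier points of \<open>C\<close>. It does apply after
  \<open>\<rho>\<close> is shrunk to \<open>half\<close>; the two collar isomorphisms, in
  \<open>C\<close> and in \<open>W\<close>, transfer the result back through a commuting
  square.\<close>

lemma cell_iso:
  "hom_induced p (subtopology W C) (C - \<rho>) W (topspace W - \<rho>) id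
     \<in> iso (relative_homology_group p (subtopology W C) (C - \<rho>))
           (relative_homology_group p W (topspace W - \<rho>))"
proof -
  let ?CR = "relative_homology_group p (subtopology W C) (C - \<rho>)"
  let ?CH = "relative_homology_group p (subtopology W C) (C - half)"
  let ?WR = "relative_homology_group p W (topspace W - \<rho>)"
  let ?WH = "relative_homology_group p W (topspace W - half)"
  interpret C: attached_cell "subtopology W C" C \<rho> n h by (rule attached_cell_self)
  have top: "topspace (subtopology W C) = C" using C_sub by auto
  let ?i = "hom_induced p (subtopology W C) (C - \<rho>) W (topspace W - \<rho>) id"
  let ?j = "hom_induced p W (topspace W - \<rho>) W (topspace W - half) id"
  let ?k = "hom_induced p (subtopology W C) (C - \<rho>) (subtopology W C) (C - half) id"
  let ?l = "hom_induced p (subtopology W C) (C - half) W (topspace W - half) id"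
  have j: "?j \<in> iso ?WR ?WH" by (rule collar_iso)
  have k: "?k \<in> iso ?CR ?CH"
    using C.collar_iso[of p] unfolding top .
  have l: "?l \<in> iso ?CH ?WH"
  proof -
    \<comment> \<open>The closed set \<open>W - \<rho>\<close> separates the two: it contains
      \<open>W - C\<close> and lies in the open set \<open>W - half\<close>.\<close>
    have "W closure_of (topspace W - C) \<subseteq> topspace W - \<rho>"
      using openin_rho rho_sub by (intro closure_of_minimal) auto
    also have "\<dots> \<subseteq> W interior_of (topspace W - half)"
      using closedin_half half_sub by (subst interior_of_openin) auto
    finally have "hom_induced p (subtopology W (topspace W - (topspace W - C)))
        (topspace W - half - (topspace W - C)) (subtopology W (topspace W)) (topspace W - half) id
      \<in> iso (relative_homology_group p (subtopology W (topspace W - (topspace W - C)))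
              (topspace W - half - (topspace W - C)))
            (relative_homology_group p (subtopology W (topspace W)) (topspace W - half))"
      by (rule homology_excision_axiom) auto
    moreover have "topspace W - (topspace W - C) = C" using C_sub by auto
    moreover have "topspace W - half - (topspace W - C) = C - half" using C_sub by auto
    ultimately show ?thesis by simp
  qed
  have i: "?i \<in> hom ?CR ?WR" by (rule hom_induced_hom)
  have comm: "?j (?i x) = ?l (?k x)" for x
    using half_sub C_sub by (subst (1 2) hom_induced_compose')
      (auto simp: continuous_map_in_subtopology continuous_map_from_subtopology)
  have "bij_betw (?l \<circ> ?k) (carrier ?CR) (carrier ?WH)"
    using k l unfolding iso_def by (intro bij_betw_trans[where f = ?k]) blast+
  moreover have "?j \<circ> ?i = ?l \<circ> ?k" using comm by auto
  ultimately have b: "bij_betw (?j \<circ> ?i) (carrier ?CR) (carrier ?WH)" by simp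
  \<comment> \<open>Two out of three: \<open>?j\<close> and \<open>?j \<circ> ?i\<close> are
    bijective, hence so is \<open>?i\<close>.\<close>
  have "bij_betw ?i (carrier ?CR) (carrier ?WR)"
  proof (rule iffD2[OF bij_betw_comp_iff2 b])
    show "bij_betw ?j (carrier ?WR) (carrier ?WH)"
      using j unfolding iso_def by blast
    show "?i ` carrier ?CR \<subseteq> carrier ?WR"
      using hom_carrier[OF i] .
  qed
  then show ?thesis using i by (simp add: iso_def)
qed

end

section \<open>Incidence numbers\<close>

lemma hom_finprod:
  assumes "comm_group G" "comm_group H" "f \<in> hom G H" "finite T" "a \<in> T \<rightarrow> carrier G"
  shows "f (finprod G a T) = finprod H (\<lambda>t. f (a t)) T"
  using assms(4,5)
proof (induction T rule: finite_induct)
  interpret G: comm_group G by fact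
  interpret H: comm_group H by fact
  interpret f: group_hom G H f by unfold_locales (use assms in auto)
  {
    case empty
    then show ?case by simp
  next
    case (insert t T)
    then have "f (finprod G a (insert t T)) = f (a t) \<otimes>\<^bsub>H\<^esub> f (finprod G a T)"
      by simp
    also have "\<dots> = finprod H (\<lambda>t. f (a t)) (insert t T)"
      using insert by (subst H.finprod_insert) (auto simp: Pi_iff)
    finally show ?case .
  }
qed

lemma finprod_int_pow:
  assumes "comm_group G" "finite T" "x \<in> carrier G"
  shows "finprod G (\<lambda>t. x [^]\<^bsub>G\<^esub> (m t :: int)) T = x [^]\<^bsub>G\<^esub> (\<Sum>t\<in>T. m t)"
proof -
  interpret comm_group G by fact
  show ?thesis
    using assms(2) by (induction T rule: finite_induct) (use assms(3) in \<open>auto simp: int_pow_mult\<close>)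
qed

lemma generator_of_infinite_cyclic:
  assumes "group G" "G \<cong> integer_group" "x \<in> carrier G" "carrier G = generate G {x}"
  shows "x [^]\<^bsub>G\<^esub> (m::int) = \<one>\<^bsub>G\<^esub> \<longleftrightarrow> m = 0"
proof -
  interpret group G by fact
  obtain f where "f \<in> iso G integer_group"
    using assms(2) by (auto simp: is_iso_def)
  then have "bij_betw f (carrier G) UNIV" by (simp add: iso_def integer_group_def)
  then have "infinite (carrier G)" using bij_betw_finite infinite_UNIV_int by blast
  \<comment> \<open>An infinite set has \<open>card\<close> 0, and order 0 stands for infinite
    order.\<close>
  then have "ord x = 0" using generate_pow_card[OF assms(3)] assms(4) by simp
  then show ?thesis using int_pow_eq_id[OF assms(3)] by simp
qed

lemma iso_generator_pow_eq_one:
  assumes "f \<in> iso G H" "group G" "group H" "x \<in> carrier G"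
    and "\<And>m::int. x [^]\<^bsub>G\<^esub> m = \<one>\<^bsub>G\<^esub> \<longleftrightarrow> m = 0"
  shows "f x [^]\<^bsub>H\<^esub> (m::int) = \<one>\<^bsub>H\<^esub> \<longleftrightarrow> m = 0"
proof -
  have f: "f \<in> hom G H" using assms(1) by (simp add: iso_def)
  interpret f: group_hom G H f by (simp add: group_hom_def group_hom_axioms_def assms(2,3) f)
  have inj: "inj_on f (carrier G)" using assms(1) by (simp add: iso_def bij_betw_def)
  have "f x [^]\<^bsub>H\<^esub> m = \<one>\<^bsub>H\<^esub> \<longleftrightarrow> f (x [^]\<^bsub>G\<^esub> m) = f \<one>\<^bsub>G\<^esub>"
    using assms(4) by (simp add: f.hom_int_pow)
  also have "\<dots> \<longleftrightarrow> x [^]\<^bsub>G\<^esub> m = \<one>\<^bsub>G\<^esub>"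
    using inj_on_eq_iff[OF inj, of "x [^]\<^bsub>G\<^esub> m" "\<one>\<^bsub>G\<^esub>"] assms(4) by simp
  finally show ?thesis using assms(5) by simp
qed

lemma integer_group_generator:
  assumes "group G" "G \<cong> integer_group"
  obtains g where "g \<in> carrier G" "\<And>x. x \<in> carrier G \<Longrightarrow> \<exists>m::int. x = g [^]\<^bsub>G\<^esub> m"
    "\<And>m::int. g [^]\<^bsub>G\<^esub> m = \<one>\<^bsub>G\<^esub> \<longleftrightarrow> m = 0"
proof -
  obtain f where f: "f \<in> iso integer_group G"
    using group.iso_sym[OF assms] by (auto simp: is_iso_def)
  then have hom: "f \<in> hom integer_group G" by (simp add: iso_def)
  have pow: "f m = f 1 [^]\<^bsub>G\<^esub> m" for m
    using hom_int_pow[OF hom _ group_integer_group assms(1), of 1 m] by simp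
  have im: "f ` UNIV = carrier G" using f by (simp add: iso_def bij_betw_def)
  show ?thesis
  proof (rule that)
    show "f 1 \<in> carrier G" using im by blast
    show "\<exists>m::int. x = f 1 [^]\<^bsub>G\<^esub> m" if x: "x \<in> carrier G" for x
    proof -
      obtain m where "x = f m" using x unfolding im[symmetric] by (rule rangeE)
      with pow[of m] show ?thesis by (intro exI[of _ m]) (simp only:)
    qed
    show "f 1 [^]\<^bsub>G\<^esub> (m::int) = \<one>\<^bsub>G\<^esub> \<longleftrightarrow> m = 0" for m
      by (rule iso_generator_pow_eq_one[OF f group_integer_group assms(1)]) simp_all
  qed
qed

section \<open>Homology of a ball modulo its sphere\<close>

lemma contractible_closed_ball: "contractible_space (closed_ball n)"
proof -
  let ?P = "prod_topology (top_of_set {0..1::real}) (closed_ball n)"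
  let ?h = "\<lambda>z i. (1 - fst z) * snd z i"
  have f: "continuous_map ?P euclideanreal fst"
    using continuous_map_fst[of "top_of_set {0..1::real}" "closed_ball n"]
    by (simp add: continuous_map_in_subtopology)
  have s: "continuous_map ?P euclideanreal (\<lambda>z. snd z i)" for i
    using continuous_map_compose[OF continuous_map_snd continuous_map_closed_ball_coordinate]
    by (simp add: o_def)
  have "continuous_map ?P (powertop_real UNIV) ?h"
    unfolding continuous_map_componentwise_UNIV
    by (intro allI continuous_map_real_mult continuous_map_diff f s) auto
  moreover have "(\<lambda>i. (1 - t) * x i) \<in> topspace (closed_ball n)"
    if "t \<in> {0..1}" "x \<in> topspace (closed_ball n)" for t x
  proof -
    have "(\<Sum>i<n. ((1 - t) * x i)\<^sup>2) = (1 - t)\<^sup>2 * (\<Sum>i<n. (x i)\<^sup>2)"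
      by (simp add: power_mult_distrib sum_distrib_left)
    also have "\<dots> \<le> 1 * 1"
      using that by (intro mult_mono) (auto simp: topspace_closed_ball power_le_one sum_nonneg)
    finally show ?thesis using that(2) by (simp add: topspace_closed_ball)
  qed
  ultimately have "continuous_map ?P (closed_ball n) ?h"
    unfolding closed_ball_altdef by (auto simp: continuous_map_in_subtopology)
  then have "homotopic_with (\<lambda>x. True) (closed_ball n) (closed_ball n) id (\<lambda>x i. 0)"
    unfolding homotopic_with_def by (intro exI[of _ ?h]) auto
  then show ?thesis unfolding contractible_space_def by blast
qed

text \<open>In positive dimension contractibility of the ball reduces the group to the reduced
  homology of the sphere. In dimension 0 the sphere is empty, and the group is \<open>H_0\<close> of
  a point.\<close>

lemma relative_homology_ball_sphere:
  "relative_homology_group (int n) (closed_ball n) (topspace (closed_ball n) - open_ball n) \<cong> integer_group"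
proof (cases n)
  case 0
  have "topspace (closed_ball 0) = {\<lambda>i. 0}" by (auto simp: topspace_closed_ball)
  moreover have "open_ball 0 = {\<lambda>i. 0}" by (auto simp: open_ball_altdef)
  ultimately show ?thesis using homology_coefficients[of "closed_ball 0"] 0 by simp
next
  case (Suc m)
  let ?S = "topspace (closed_ball n) - open_ball n"
  have S: "?S = {x. (\<forall>i\<ge>n. x i = 0) \<and> (\<Sum>i<n. (x i)\<^sup>2) = 1}"
    by (auto simp: topspace_closed_ball open_ball_altdef)
  have "subtopology (closed_ball n) ?S = nsphere m"
    unfolding S unfolding closed_ball_altdef nsphere subtopology_subtopology
    by (rule arg_cong[where f = "subtopology _"])
      (auto simp: Suc lessThan_Suc_atMost Suc_le_eq)
  moreover have "topspace (nsphere m) \<noteq> {}" using in_topspace_nsphere by blast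
  ultimately have "topspace (closed_ball n) \<inter> ?S \<noteq> {}"
    using topspace_subtopology by metis
  from isomorphic_group_relative_homology_of_contractible[OF contractible_closed_ball this, of "int n"]
  have "relative_homology_group (int n) (closed_ball n) ?S \<cong> reduced_homology_group (int m) (nsphere m)"
    using \<open>subtopology (closed_ball n) ?S = nsphere m\<close> Suc by simp
  then show ?thesis using reduced_homology_group_nsphere(1) iso_trans by blast
qed

section \<open>Closed cells, faces and subcomplexes\<close>

locale regular_cw =
  fixes X :: "'a cw"
  assumes regular: "finite_regular_cw X"
begin

lemma finite_cells: "finite (cells X)"
  and disjoint_cells: "disjoint (cells X)"
  and union_cells: "\<Union>(cells X) = topspace (cw_space X)"
  using regular by (simp_all add: finite_regular_cw_def)

lemma
  assumes "\<sigma> \<in> cells X"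
  shows cell_homeo: "\<exists>h. homeomorphic_map (closed_ball (cdim X \<sigma>))
            (subtopology (cw_space X) (cell_closure X \<sigma>)) h \<and> h ` open_ball (cdim X \<sigma>) = \<sigma>"
    and frontier_eq:
      "cell_frontier X \<sigma> = \<Union>{\<tau> \<in> cells X. cell_face X \<tau> \<sigma> \<and> cdim X \<tau> < cdim X \<sigma>}"
    and orient_carrier: "orient X \<sigma> \<in> carrier (cell_homology_group X \<sigma>)"
    and orient_generates:
      "carrier (cell_homology_group X \<sigma>) = generate (cell_homology_group X \<sigma>) {orient X \<sigma>}"
  using regular assms unfolding finite_regular_cw_def
  by - (elim conjE, drule (1) bspec, elim conjE, assumption)+

lemma cell_subset: "\<sigma> \<in> cells X \<Longrightarrow> \<sigma> \<subseteq> topspace (cw_space X)"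
  using union_cells by blast

lemma cell_nonempty: "\<sigma> \<in> cells X \<Longrightarrow> \<sigma> \<noteq> {}"
  using open_ball_nonempty[of "cdim X \<sigma>"] by (auto dest: cell_homeo)

lemma closure_superset: "\<sigma> \<in> cells X \<Longrightarrow> \<sigma> \<subseteq> cell_closure X \<sigma>"
  by (simp add: cell_closure_def cell_subset closure_of_subset)

lemma closedin_closure: "closedin (cw_space X) (cell_closure X \<sigma>)"
  unfolding cell_closure_def by simp

lemma closure_eq: "\<sigma> \<in> cells X \<Longrightarrow> cell_closure X \<sigma> = \<sigma> \<union> cell_frontier X \<sigma>"
  using closure_superset by (auto simp: cell_frontier_def)

lemma face_refl: "\<sigma> \<in> cells X \<Longrightarrow> cell_face X \<sigma> \<sigma>"
  unfolding cell_face_def by (rule closure_superset)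

lemma face_closure: "cell_face X \<tau> \<sigma> \<Longrightarrow> cell_closure X \<tau> \<subseteq> cell_closure X \<sigma>"
  unfolding cell_face_def cell_closure_def by (simp add: closure_of_minimal)

lemma face_trans: "cell_face X \<rho> \<tau> \<Longrightarrow> cell_face X \<tau> \<sigma> \<Longrightarrow> cell_face X \<rho> \<sigma>"
  using face_closure unfolding cell_face_def by blast

lemma cells_meet: "\<sigma> \<in> cells X \<Longrightarrow> \<tau> \<in> cells X \<Longrightarrow> x \<in> \<sigma> \<Longrightarrow> x \<in> \<tau> \<Longrightarrow> \<sigma> = \<tau>"
  using disjointD[OF disjoint_cells, of \<sigma> \<tau>] by blast

text \<open>A point of a proper face lies in the frontier, hence in some cell there of smaller
  dimension; as cells are disjoint, that cell is the face itself.\<close>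

lemma proper_face_dim:
  assumes "\<sigma> \<in> cells X" "\<tau> \<in> cells X" "cell_face X \<tau> \<sigma>" "\<tau> \<noteq> \<sigma>"
  shows "cdim X \<tau> < cdim X \<sigma>"
proof -
  obtain x where x: "x \<in> \<tau>" using cell_nonempty[OF assms(2)] by blast
  then have "x \<in> cell_frontier X \<sigma>"
    using assms cells_meet[of \<tau> \<sigma> x] unfolding cell_face_def cell_frontier_def by blast
  then obtain \<tau>' where "\<tau>' \<in> cells X" "cdim X \<tau>' < cdim X \<sigma>" "x \<in> \<tau>'"
    unfolding frontier_eq[OF assms(1)] by blast
  then show ?thesis using cells_meet[OF assms(2) _ x] by blast
qed

definition faces :: "'a set \<Rightarrow> 'a set set" where
  "faces \<sigma> = {\<tau> \<in> cells X. cell_face X \<tau> \<sigma> \<and> \<tau> \<noteq> \<sigma>}"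

lemma frontier_faces:
  assumes "\<sigma> \<in> cells X" shows "cell_frontier X \<sigma> = \<Union>(faces \<sigma>)"
proof -
  have "{\<tau> \<in> cells X. cell_face X \<tau> \<sigma> \<and> cdim X \<tau> < cdim X \<sigma>} = faces \<sigma>"
    using proper_face_dim[OF assms] by (auto simp: faces_def)
  then show ?thesis using frontier_eq[OF assms] by simp
qed

lemma closure_faces: "\<sigma> \<in> cells X \<Longrightarrow> cell_closure X \<sigma> = \<Union>{\<tau> \<in> cells X. cell_face X \<tau> \<sigma>}"
  using face_refl by (auto simp: closure_eq frontier_faces faces_def)

lemma subcomplex_cells: "subcomplex X S \<Longrightarrow> S \<subseteq> cells X"
  by (simp add: subcomplex_def)

lemma subcomplex_face:
  "subcomplex X S \<Longrightarrow> \<sigma> \<in> S \<Longrightarrow> \<tau> \<in> cells X \<Longrightarrow> cell_face X \<tau> \<sigma> \<Longrightarrow> \<tau> \<in> S"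
  by (simp add: subcomplex_def)

lemma subcomplex_Union: "subcomplex X S \<Longrightarrow> \<Union>S = (\<Union>\<sigma>\<in>S. cell_closure X \<sigma>)"
proof -
  assume S: "subcomplex X S"
  have "cell_closure X \<sigma> \<subseteq> \<Union>S" if "\<sigma> \<in> S" for \<sigma>
    unfolding closure_faces[OF subsetD[OF subcomplex_cells[OF S] that]]
    using subcomplex_face[OF S that] by blast
  moreover have "\<sigma> \<subseteq> cell_closure X \<sigma>" if "\<sigma> \<in> S" for \<sigma>
    using closure_superset subcomplex_cells[OF S] that by blast
  ultimately show ?thesis by blast
qed

lemma closedin_subcomplex:
  assumes "subcomplex X S" shows "closedin (cw_space X) (\<Union>S)"
proof -
  have "finite S" using assms finite_cells subcomplex_cells finite_subset by blast
  then show ?thesis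
    unfolding subcomplex_Union[OF assms] using closedin_closure by (intro closedin_Union) auto
qed

lemma subcomplex_faces:
  assumes "\<sigma> \<in> cells X" shows "subcomplex X (faces \<sigma>)"
  unfolding subcomplex_def
proof (intro conjI ballI impI)
  fix \<tau> \<rho> assume \<tau>: "\<tau> \<in> faces \<sigma>" and \<rho>: "\<rho> \<in> cells X" "cell_face X \<rho> \<tau>"
  have "\<rho> \<noteq> \<sigma>"
    using proper_face_dim[of \<sigma> \<tau>] proper_face_dim[of \<tau> \<sigma>] assms \<tau> \<rho> by (fastforce simp: faces_def)
  then show "\<rho> \<in> faces \<sigma>"
    using \<tau> \<rho> face_trans by (auto simp: faces_def)
qed (auto simp: faces_def)

lemma Union_inter_disjoint:
  assumes "S \<subseteq> cells X" "\<rho> \<in> cells X" "\<rho> \<notin> S" shows "\<Union>S \<inter> \<rho> = {}"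
proof -
  have "\<sigma> \<inter> \<rho> = {}" if "\<sigma> \<in> S" for \<sigma>
    using disjointD[OF disjoint_cells, of \<sigma> \<rho>] assms that by blast
  then show ?thesis by blast
qed

lemma Union_remove:
  assumes "S \<subseteq> cells X" "\<rho> \<in> S" shows "\<Union>(S - {\<rho>}) = \<Union>S - \<rho>"
  using Union_inter_disjoint[of "S - {\<rho>}" \<rho>] assms by blast

section \<open>Local homology at maximal cells\<close>

abbreviation H :: "int \<Rightarrow> 'a set \<Rightarrow> 'a set \<Rightarrow> 'a chain set monoid" where
  "H p S T \<equiv> relative_homology_group p (subtopology (cw_space X) S) T"

definition incl :: "int \<Rightarrow> 'a set \<Rightarrow> 'a set \<Rightarrow> 'a set \<Rightarrow> 'a set \<Rightarrow> 'a chain set \<Rightarrow> 'a chain set" where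
  "incl p S T S' T' = hom_induced p (subtopology (cw_space X) S) T (subtopology (cw_space X) S') T' id"

abbreviation cell_incl :: "int \<Rightarrow> 'a set \<Rightarrow> 'a set \<Rightarrow> 'a set \<Rightarrow> 'a chain set \<Rightarrow> 'a chain set" where
  "cell_incl p \<sigma> \<equiv> incl p (cell_closure X \<sigma>) (cell_frontier X \<sigma>)"

lemma incl_hom: "incl p S T S' T' \<in> hom (H p S T) (H p S' T')"
  unfolding incl_def by (rule hom_induced_hom)

lemma incl_carrier: "incl p S T S' T' x \<in> carrier (H p S' T')"
  unfolding incl_def by (rule hom_induced_carrier)

lemma group_hom_incl: "group_hom (H p S T) (H p S' T') (incl p S T S' T')"
  by (simp add: group_hom_def group_hom_axioms_def incl_hom)

lemma incl_compose:
  assumes "S \<subseteq> S'" "T \<subseteq> T'" "S' \<subseteq> S''" "T' \<subseteq> T''"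
  shows "incl p S' T' S'' T'' (incl p S T S' T' x) = incl p S T S'' T'' x"
proof -
  have "hom_induced p (subtopology (cw_space X) S') T' (subtopology (cw_space X) S'') T'' id
     (hom_induced p (subtopology (cw_space X) S) T (subtopology (cw_space X) S') T' id x)
    = hom_induced p (subtopology (cw_space X) S) T (subtopology (cw_space X) S'') T'' (id \<circ> id) x"
    by (rule hom_induced_compose')
      (use assms in \<open>auto simp: continuous_map_in_subtopology intro: continuous_map_from_subtopology\<close>)
  then show ?thesis by (simp add: incl_def)
qed

text \<open>The map factors through the trivial group \<open>H p T' T'\<close>: a class supported in
  the part that is divided out vanishes.\<close>

lemma incl_trivial:
  assumes "S \<subseteq> S'" "T \<subseteq> T'" "S \<subseteq> T'" "T' \<subseteq> S'"
  shows "incl p S T S' T' x = \<one>\<^bsub>H p S' T'\<^esub>"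
proof -
  have "incl p S T S' T' x = incl p T' T' S' T' (incl p S T T' T' x)"
    using assms by (subst incl_compose) auto
  moreover have "trivial_group (H p T' T')"
  proof -
    let ?Y = "subtopology (cw_space X) T'"
    \<comment> \<open>\<open>T'\<close> may contain points outside the space, so it is first
      replaced by the topspace of its subtopology.\<close>
    have "topspace ?Y \<inter> T' = topspace ?Y" by auto
    then have "H p T' T' = H p T' (topspace ?Y)"
      using relative_homology_group_restrict[of p ?Y T'] by (simp only:)
    then show ?thesis by (simp only: trivial_relative_homology_group_topspace)
  qed
  then have "incl p S T T' T' x = \<one>\<^bsub>H p T' T'\<^esub>"
    using incl_carrier[of p S T T' T' x] by (simp add: trivial_group_def)
  ultimately show ?thesis
    using group_hom.hom_one[OF group_hom_incl] by simp
qed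

lemma cell_group: "cell_homology_group X \<sigma> = H (int (cdim X \<sigma>)) (cell_closure X \<sigma>) (cell_frontier X \<sigma>)"
  by (simp add: cell_homology_group_def)

text \<open>Infinite order of the orientation makes incidence numbers unique, and it later turns
  identities between powers of orientations into identities between integers.\<close>

lemma orient_pow_eq_one:
  assumes "\<sigma> \<in> cells X"
  shows "orient X \<sigma> [^]\<^bsub>cell_homology_group X \<sigma>\<^esub> (m::int) = \<one>\<^bsub>cell_homology_group X \<sigma>\<^esub> \<longleftrightarrow> m = 0"
proof (rule generator_of_infinite_cyclic)
  obtain h where h: "homeomorphic_map (closed_ball (cdim X \<sigma>))
      (subtopology (cw_space X) (cell_closure X \<sigma>)) h" "h ` open_ball (cdim X \<sigma>) = \<sigma>"
    using cell_homeo[OF assms] by blast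
  let ?D = "closed_ball (cdim X \<sigma>)"
  have top: "h ` topspace ?D = cell_closure X \<sigma>"
    using homeomorphic_imp_surjective_map[OF h(1)] closedin_closure closedin_subset by fastforce
  have "h ` (topspace ?D - open_ball (cdim X \<sigma>)) = cell_frontier X \<sigma>"
    unfolding cell_frontier_def
    using inj_on_image_set_diff[OF homeomorphic_imp_injective_map[OF h(1)], of "topspace ?D"]
    by (simp add: top h(2) open_ball_subset)
  then have "relative_homology_group (int (cdim X \<sigma>)) ?D (topspace ?D - open_ball (cdim X \<sigma>))
      \<cong> cell_homology_group X \<sigma>"
    unfolding cell_homology_group_def
    by (intro is_isoI[OF homeomorphic_map_relative_homology_iso[OF h(1)]]) auto
  then show "cell_homology_group X \<sigma> \<cong> integer_group"
    using relative_homology_ball_sphere[of "cdim X \<sigma>"]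
    using group.iso_sym[OF group_relative_homology_group] iso_trans by blast
  show "group (cell_homology_group X \<sigma>)" by (simp add: cell_homology_group_def)
qed (fact orient_carrier[OF assms] orient_generates[OF assms])+

text \<open>That \<open>S - {\<rho>}\<close> is still a subcomplex means that \<open>\<rho>\<close>
  is a maximal cell. The union of the other cells is then closed, so \<open>\<rho>\<close> is open
  in \<open>\<Union>S\<close> and \<open>attached_cell\<close> applies.\<close>

lemma top_cell_iso:
  assumes S: "subcomplex X S" "subcomplex X (S - {\<rho>})" and \<rho>: "\<rho> \<in> S"
  shows "cell_incl p \<rho> (\<Union>S) (\<Union>S - \<rho>)
    \<in> iso (H p (cell_closure X \<rho>) (cell_frontier X \<rho>)) (H p (\<Union>S) (\<Union>S - \<rho>))"
proof -
  let ?W = "subtopology (cw_space X) (\<Union>S)"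
  let ?C = "cell_closure X \<rho>"
  have \<rho>X: "\<rho> \<in> cells X" using \<rho> S subcomplex_cells by blast
  have CS: "?C \<subseteq> \<Union>S" using subcomplex_Union[OF S(1)] \<rho> by blast
  have top: "topspace ?W = \<Union>S" using closedin_subset[OF closedin_subcomplex[OF S(1)]] by auto
  have sub: "subtopology ?W ?C = subtopology (cw_space X) ?C"
    using CS by (simp add: subtopology_subtopology inf_absorb2)
  obtain h where h: "homeomorphic_map (closed_ball (cdim X \<rho>)) (subtopology (cw_space X) ?C) h"
    "h ` open_ball (cdim X \<rho>) = \<rho>"
    using cell_homeo[OF \<rho>X] by blast
  have "attached_cell ?W ?C \<rho> (cdim X \<rho>) h"
  proof
    show "closedin ?W ?C"
      using closedin_closure CS by (rule closedin_subset_topspace)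
    have "closedin ?W (\<Union>(S - {\<rho>}))"
      using closedin_subcomplex[OF S(2)] by (rule closedin_subset_topspace) blast
    then have "openin ?W (topspace ?W - \<Union>(S - {\<rho>}))" by (rule openin_diff[OF openin_topspace])
    moreover have "\<Union>S - (\<Union>S - \<rho>) = \<rho>" using \<rho> by blast
    ultimately show "openin ?W \<rho>"
      using Union_remove[OF subcomplex_cells[OF S(1)] \<rho>] top by simp
  qed (use h sub in simp_all)
  from attached_cell.cell_iso[OF this, of p]
  show ?thesis unfolding incl_def sub top cell_frontier_def .
qed

lemma subcomplex_diff:
  assumes "subcomplex X S" "\<And>\<tau>. \<tau> \<in> T \<Longrightarrow> subcomplex X (S - {\<tau>})"
  shows "subcomplex X (S - T)"
  unfolding subcomplex_def
proof (intro conjI ballI impI)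
  fix \<sigma> \<rho> assume *: "\<sigma> \<in> S - T" "\<rho> \<in> cells X" "cell_face X \<rho> \<sigma>"
  have "\<rho> \<in> S" using subcomplex_face[OF assms(1)] * by blast
  moreover have "\<rho> \<notin> T"
  proof
    assume "\<rho> \<in> T"
    then have "\<rho> \<in> S - {\<rho>}"
      using subcomplex_face[OF assms(2) _ *(2,3)] *(1) by blast
    then show False by blast
  qed
  ultimately show "\<rho> \<in> S - T" by blast
qed (use subcomplex_cells[OF assms(1)] in blast)

text \<open>Maximal cells are removed one at a time. By the exact sequence of the triple, a class
  that dies once \<open>\<tau>\<close> is no longer divided out comes from the homology of the
  closed cell \<open>\<tau>\<close>, and this group embeds in the local group at
  \<open>\<tau>\<close>.\<close>

lemma top_cells_detect:
  assumes "finite T" "T \<subseteq> S" "subcomplex X S" "\<And>\<tau>. \<tau> \<in> T \<Longrightarrow> subcomplex X (S - {\<tau>})"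
    and "x \<in> carrier (H p (\<Union>S) (\<Union>(S - T)))"
    and "\<And>\<tau>. \<tau> \<in> T \<Longrightarrow> incl p (\<Union>S) (\<Union>(S - T)) (\<Union>S) (\<Union>S - \<tau>) x = \<one>\<^bsub>H p (\<Union>S) (\<Union>S - \<tau>)\<^esub>"
  shows "x = \<one>\<^bsub>H p (\<Union>S) (\<Union>(S - T))\<^esub>"
  using assms(1,2,4-)
proof (induction T arbitrary: x rule: finite_induct)
  case empty
  have "topspace (subtopology (cw_space X) (\<Union>S)) = \<Union>S"
    using closedin_subset[OF closedin_subcomplex[OF assms(3)]] by auto
  then have "trivial_group (H p (\<Union>S) (\<Union>S))"
    using trivial_relative_homology_group_topspace[of p "subtopology (cw_space X) (\<Union>S)"]
    by (simp only:)
  then show ?case using empty.prems by (simp add: trivial_group_def)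
next
  case (insert \<tau> T)
  let ?S = "\<Union>S" and ?S' = "\<Union>(S - T)" and ?R = "\<Union>(S - insert \<tau> T)"
  have \<tau>: "\<tau> \<in> S" "\<tau> \<in> S - T" using insert by auto
  have S': "subcomplex X (S - T)" using insert.prems(2) by (rule subcomplex_diff[OF assms(3)]) simp
  have eqR: "S - insert \<tau> T = S - T - {\<tau>}" by blast
  have R: "subcomplex X (S - T - {\<tau>})"
    unfolding eqR[symmetric] by (rule subcomplex_diff[OF assms(3) insert.prems(2)])
  have R': "?R = ?S' - \<tau>"
    unfolding eqR by (rule Union_remove[OF subcomplex_cells[OF S'] \<tau>(2)])
  have RS: "?R \<subseteq> ?S" "?S' \<subseteq> ?S" "?R \<subseteq> ?S'" by auto
  have sub: "?S' \<subseteq> ?S - \<mu>" "?R \<subseteq> ?S - \<mu>" if "\<mu> \<in> T" for \<mu>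
    using Union_remove[OF subcomplex_cells[OF assms(3)], of \<mu>] insert.prems(1) that by auto
  have R\<tau>: "?R \<subseteq> ?S - \<tau>" using R' RS by blast
  \<comment> \<open>With only \<open>T\<close> removed, the induction hypothesis kills the image of
    \<open>x\<close>, so exactness pulls \<open>x\<close> back to \<open>H p ?S' ?R\<close>.\<close>
  have "incl p ?S ?R ?S ?S' x = \<one>\<^bsub>H p ?S ?S'\<^esub>"
  proof (rule insert.IH)
    fix \<mu> assume \<mu>: "\<mu> \<in> T"
    show "incl p ?S ?S' ?S (?S - \<mu>) (incl p ?S ?R ?S ?S' x) = \<one>\<^bsub>H p ?S (?S - \<mu>)\<^esub>"
      using insert.prems(4)[of \<mu>] \<mu> RS sub[OF \<mu>] by (simp add: incl_compose)
    show "subcomplex X (S - {\<mu>})" using insert.prems(2) \<mu> by simp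
  qed (use insert.prems incl_carrier in auto)
  moreover have "subtopology (subtopology (cw_space X) ?S) ?S' = subtopology (cw_space X) ?S'"
    using RS(2) by (simp only: subtopology_subtopology inf_absorb2)
  then have "exact_seq ([H p ?S ?S', H p ?S ?R, H p ?S' ?R], [incl p ?S ?R ?S ?S', incl p ?S' ?R ?S ?R])"
    using homology_exactness_triple_3[OF RS(3), of p "subtopology (cw_space X) ?S"]
    by (simp only: incl_def)
  then have "kernel (H p ?S ?R) (H p ?S ?S') (incl p ?S ?R ?S ?S') = incl p ?S' ?R ?S ?R ` carrier (H p ?S' ?R)"
    by simp
  ultimately obtain y where y: "y \<in> carrier (H p ?S' ?R)" "x = incl p ?S' ?R ?S ?R y"
    using insert.prems(3) unfolding kernel_def by blast
  let ?C = "cell_closure X \<tau>" and ?F = "cell_frontier X \<tau>"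
  have C: "?C \<subseteq> ?S'" using subcomplex_Union[OF S'] \<tau>(2) by blast
  have F: "?F \<subseteq> ?R" using C unfolding R' cell_frontier_def by blast
  have "incl p ?C ?F ?S' ?R \<in> iso (H p ?C ?F) (H p ?S' ?R)"
    using top_cell_iso[OF S' R \<tau>(2)] unfolding R' .
  then obtain z where z: "z \<in> carrier (H p ?C ?F)" "y = incl p ?C ?F ?S' ?R z"
    using y(1) unfolding iso_def bij_betw_def by blast
  \<comment> \<open>The closed cell is excised a second time, now from the full \<open>?S\<close>.
    As \<open>z\<close> represents \<open>x\<close>, its image here is the local class of
    \<open>x\<close> at \<open>\<tau>\<close>, which is trivial.\<close>
  have i: "incl p ?C ?F ?S (?S - \<tau>) \<in> iso (H p ?C ?F) (H p ?S (?S - \<tau>))"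
    using insert.prems(2) by (rule top_cell_iso[OF assms(3) _ \<tau>(1)]) simp
  have "incl p ?C ?F ?S (?S - \<tau>) z = incl p ?S ?R ?S (?S - \<tau>) x"
    unfolding y(2) z(2) using C F RS R\<tau> by (subst (1 2) incl_compose) auto
  also have "\<dots> = \<one>\<^bsub>H p ?S (?S - \<tau>)\<^esub>" using insert.prems(4) by simp
  also have "\<dots> = incl p ?C ?F ?S (?S - \<tau>) \<one>\<^bsub>H p ?C ?F\<^esub>"
    using group_hom.hom_one[OF group_hom_incl] by simp
  finally have eq: "incl p ?C ?F ?S (?S - \<tau>) z = incl p ?C ?F ?S (?S - \<tau>) \<one>\<^bsub>H p ?C ?F\<^esub>" .
  have "inj_on (incl p ?C ?F ?S (?S - \<tau>)) (carrier (H p ?C ?F))"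
    using i by (simp add: iso_def bij_betw_def)
  from inj_onD[OF this eq z(1)] have "z = \<one>\<^bsub>H p ?C ?F\<^esub>"
    by (simp add: group.is_monoid monoid.one_closed)
  then show ?case
    unfolding y(2) z(2) by (simp only: group_hom.hom_one[OF group_hom_incl])
qed

section \<open>The cellular boundary from singular homology\<close>

definition bd :: "'a set \<Rightarrow> 'a chain set" where
  "bd \<sigma> = hom_boundary (int (cdim X \<sigma>)) (subtopology (cw_space X) (cell_closure X \<sigma>))
            (cell_frontier X \<sigma>) (orient X \<sigma>)"

lemma sub_frontier:
  "subtopology (subtopology (cw_space X) (cell_closure X \<sigma>)) (cell_frontier X \<sigma>)
     = subtopology (cw_space X) (cell_frontier X \<sigma>)"
proof -
  have "cell_closure X \<sigma> \<inter> cell_frontier X \<sigma> = cell_frontier X \<sigma>"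
    by (auto simp: cell_frontier_def)
  then show ?thesis by (simp only: subtopology_subtopology)
qed

lemma bd_carrier: "bd \<sigma> \<in> carrier (H (int (cdim X \<sigma>) - 1) (cell_frontier X \<sigma>) {})"
  unfolding bd_def using hom_boundary_carrier[of "int (cdim X \<sigma>)"
    "subtopology (cw_space X) (cell_closure X \<sigma>)" "cell_frontier X \<sigma>"]
  unfolding sub_frontier .

text \<open>In codimension one, a facet is maximal among the proper faces: a proper face strictly
  containing it would have a dimension strictly between two consecutive integers.\<close>

lemma remove_top_face:
  assumes \<sigma>: "\<sigma> \<in> cells X" and \<tau>: "\<tau> \<in> faces \<sigma>" and dim: "cdim X \<sigma> = cdim X \<tau> + 1"
  shows "subcomplex X (faces \<sigma> - {\<tau>})"
  unfolding subcomplex_def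
proof (intro conjI ballI impI)
  fix \<mu> \<rho> assume *: "\<mu> \<in> faces \<sigma> - {\<tau>}" "\<rho> \<in> cells X" "cell_face X \<rho> \<mu>"
  have "\<rho> \<noteq> \<tau>"
  proof
    assume "\<rho> = \<tau>"
    then have "cdim X \<tau> < cdim X \<mu>" using * proper_face_dim[of \<mu> \<tau>] by (auto simp: faces_def)
    moreover have "cdim X \<mu> < cdim X \<sigma>" using * proper_face_dim[OF \<sigma>] by (auto simp: faces_def)
    ultimately show False using dim by simp
  qed
  then show "\<rho> \<in> faces \<sigma> - {\<tau>}"
    using subcomplex_face[OF subcomplex_faces[OF \<sigma>]] * by blast
qed (auto simp: faces_def)

text \<open>By excision the local group at \<open>\<tau>\<close> is infinite cyclic, generated by
  the image of the orientation of \<open>\<tau>\<close>. So exactly one exponent satisfies the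
  equation, and the definite description in \<open>incidence\<close> denotes it.\<close>

lemma incidence_eq:
  assumes \<sigma>: "\<sigma> \<in> cells X" and \<tau>: "\<tau> \<in> faces \<sigma>" and dim: "cdim X \<sigma> = cdim X \<tau> + 1"
  defines "S \<equiv> cell_frontier X \<sigma>" and "p \<equiv> int (cdim X \<tau>)"
  shows "incl p S {} S (S - \<tau>) (bd \<sigma>) =
    cell_incl p \<tau> S (S - \<tau>) (orient X \<tau>)
      [^]\<^bsub>H p S (S - \<tau>)\<^esub> incidence X \<sigma> \<tau>"
proof -
  let ?o = "cell_incl p \<tau> S (S - \<tau>) (orient X \<tau>)"
  let ?G = "H p S (S - \<tau>)"
  let ?K = "H p (cell_closure X \<tau>) (cell_frontier X \<tau>)"
  have \<tau>X: "\<tau> \<in> cells X" "cell_face X \<tau> \<sigma>" using \<tau> by (auto simp: faces_def)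
  have SU: "S = \<Union>(faces \<sigma>)" unfolding S_def by (rule frontier_faces[OF \<sigma>])
  have iso: "cell_incl p \<tau> S (S - \<tau>) \<in> iso ?K ?G"
    unfolding SU by (rule top_cell_iso[OF subcomplex_faces[OF \<sigma>] remove_top_face[OF \<sigma> \<tau> dim] \<tau>])
  have oK: "orient X \<tau> \<in> carrier ?K"
    using orient_carrier[OF \<tau>X(1)] by (simp add: cell_group p_def)
  interpret i: group_hom ?K ?G "cell_incl p \<tau> S (S - \<tau>)"
    by (rule group_hom_incl)
  have pow1: "?o [^]\<^bsub>?G\<^esub> (m::int) = \<one>\<^bsub>?G\<^esub> \<longleftrightarrow> m = 0" for m
    using orient_pow_eq_one[OF \<tau>X(1)]
    by (intro iso_generator_pow_eq_one[OF iso _ _ oK]) (simp_all add: cell_group p_def)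
  have oG: "?o \<in> carrier ?G" by (rule incl_carrier)
  have uniq: "m = l" if "?o [^]\<^bsub>?G\<^esub> (m::int) = ?o [^]\<^bsub>?G\<^esub> l" for m l
  proof -
    have "?o [^]\<^bsub>?G\<^esub> (m - l) = \<one>\<^bsub>?G\<^esub>"
      using that oG by (simp add: i.H.int_pow_diff)
    then show ?thesis using pow1 by simp
  qed
  let ?b = "incl p S {} S (S - \<tau>) (bd \<sigma>)"
  have "cell_incl p \<tau> S (S - \<tau>) ` carrier ?K = carrier ?G"
    using iso by (simp add: iso_def bij_betw_def)
  then have "?b \<in> cell_incl p \<tau> S (S - \<tau>) ` carrier ?K"
    by (simp only: incl_carrier)
  then obtain z where z: "z \<in> carrier ?K" "?b = cell_incl p \<tau> S (S - \<tau>) z"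
    by blast
  have "z \<in> generate ?K {orient X \<tau>}"
    using orient_generates[OF \<tau>X(1)] z(1) by (simp only: cell_group p_def)
  then obtain m :: int where "z = orient X \<tau> [^]\<^bsub>?K\<^esub> m"
    using i.G.generate_pow[OF oK] by blast
  then have m: "?b = ?o [^]\<^bsub>?G\<^esub> m" using z(2) i.hom_int_pow[OF oK] by simp
  have p: "int (cdim X \<sigma>) - 1 = p" using dim by (simp add: p_def)
  have "hom_relboundary (int (cdim X \<sigma>)) (subtopology (cw_space X) (cell_closure X \<sigma>))
      (cell_frontier X \<sigma>) (cell_frontier X \<sigma> - \<tau>) (orient X \<sigma>) = ?b"
    by (simp only: hom_relboundary_def sub_frontier p comp_apply incl_def bd_def S_def)
  then have "incidence X \<sigma> \<tau> = (THE m. ?b = ?o [^]\<^bsub>?G\<^esub> m)"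
    unfolding incidence_def Let_def incl_def using \<tau>X \<sigma> dim by (simp add: S_def p_def)
  also have "\<dots> = m" using m uniq by (intro the_equality) auto
  finally show ?thesis using m by simp
qed

definition facets :: "'a set \<Rightarrow> 'a set set" where
  "facets \<sigma> = {\<tau> \<in> faces \<sigma>. cdim X \<sigma> = cdim X \<tau> + 1}"

lemma finite_facets: "finite (facets \<sigma>)"
  using finite_cells by (simp add: facets_def faces_def)

lemma facets_faces: "\<tau> \<in> facets \<sigma> \<Longrightarrow> \<tau> \<in> faces \<sigma>"
  and facets_cells: "\<tau> \<in> facets \<sigma> \<Longrightarrow> \<tau> \<in> cells X"
  and facets_dim: "\<tau> \<in> facets \<sigma> \<Longrightarrow> cdim X \<sigma> = cdim X \<tau> + 1"
  by (auto simp: facets_def faces_def)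

lemma face_of_facet:
  assumes "\<sigma> \<in> cells X" "\<tau> \<in> facets \<sigma>"
  shows "faces \<tau> \<subseteq> faces \<sigma> - facets \<sigma>"
proof
  fix \<mu> assume \<mu>: "\<mu> \<in> faces \<tau>"
  then have "cdim X \<mu> < cdim X \<tau>"
    using proper_face_dim[OF facets_cells[OF assms(2)]] by (simp add: faces_def)
  then have "\<mu> \<notin> facets \<sigma>" using facets_dim[OF assms(2)] facets_dim[of \<mu> \<sigma>] by fastforce
  moreover have "\<mu> \<in> faces \<sigma>"
    using subcomplex_face[OF subcomplex_faces[OF assms(1)] facets_faces[OF assms(2)], of \<mu>] \<mu>
    by (simp add: faces_def)
  ultimately show "\<mu> \<in> faces \<sigma> - facets \<sigma>" by blast
qed

lemma closure_facet:
  assumes "\<sigma> \<in> cells X" "\<tau> \<in> facets \<sigma>"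
  shows "cell_frontier X \<tau> \<subseteq> \<Union>(faces \<sigma> - facets \<sigma>)" "cell_closure X \<tau> \<subseteq> \<Union>(faces \<sigma>)"
    "\<mu> \<in> facets \<sigma> \<Longrightarrow> \<mu> \<noteq> \<tau> \<Longrightarrow> cell_closure X \<tau> \<subseteq> \<Union>(faces \<sigma>) - \<mu>"
    "\<Union>(faces \<sigma> - facets \<sigma>) \<subseteq> \<Union>(faces \<sigma>) - \<tau>"
proof -
  note \<tau>X = facets_cells[OF assms(2)]
  have sub: "faces \<sigma> \<subseteq> cells X" by (auto simp: faces_def)
  show 1: "cell_frontier X \<tau> \<subseteq> \<Union>(faces \<sigma> - facets \<sigma>)"
    unfolding frontier_faces[OF \<tau>X] using face_of_facet[OF assms] by blast
  have cl: "cell_closure X \<tau> = \<tau> \<union> cell_frontier X \<tau>" by (rule closure_eq[OF \<tau>X])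
  show 2: "cell_closure X \<tau> \<subseteq> \<Union>(faces \<sigma>)"
    unfolding cl using 1 facets_faces[OF assms(2)] by blast
  have 3: "\<Union>(faces \<sigma> - facets \<sigma>) \<inter> \<mu> = {}" if "\<mu> \<in> facets \<sigma>" for \<mu>
    using sub facets_cells[OF that] that by (intro Union_inter_disjoint) auto
  show "\<Union>(faces \<sigma> - facets \<sigma>) \<subseteq> \<Union>(faces \<sigma>) - \<tau>" using 3[OF assms(2)] by blast
  show "cell_closure X \<tau> \<subseteq> \<Union>(faces \<sigma>) - \<mu>" if \<mu>: "\<mu> \<in> facets \<sigma>" "\<mu> \<noteq> \<tau>"
  proof -
    have "\<tau> \<inter> \<mu> = {}" using disjointD[OF disjoint_cells \<tau>X facets_cells[OF \<mu>(1)]] \<mu>(2) by blast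
    then show ?thesis using 1 2 3[OF \<mu>(1)] unfolding cl by blast
  qed
qed

text \<open>Both sides are compared in the local group at each facet \<open>\<mu>\<close>. Every
  other facet has its closure inside \<open>S - \<mu>\<close> and contributes nothing, and the
  remaining term agrees with the boundary by \<open>incidence_eq\<close>.\<close>

lemma bd_eq_sum:
  assumes \<sigma>: "\<sigma> \<in> cells X" "1 \<le> cdim X \<sigma>"
  defines "S \<equiv> \<Union>(faces \<sigma>)" and "R \<equiv> \<Union>(faces \<sigma> - facets \<sigma>)" and "p \<equiv> int (cdim X \<sigma>) - 1"
  shows "incl p S {} S R (bd \<sigma>) =
    finprod (H p S R) (\<lambda>\<tau>. cell_incl p \<tau> S R (orient X \<tau>)
      [^]\<^bsub>H p S R\<^esub> incidence X \<sigma> \<tau>) (facets \<sigma>)" (is "?l = finprod _ ?a _")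
proof -
  let ?G = "H p S R"
  interpret G: comm_group ?G by simp
  have l: "?l \<in> carrier ?G" by (rule incl_carrier)
  have a: "?a \<in> facets \<sigma> \<rightarrow> carrier ?G" by (simp add: incl_carrier)
  then have r: "finprod ?G ?a (facets \<sigma>) \<in> carrier ?G" by (rule G.finprod_closed)
  have SF: "cell_frontier X \<sigma> = S" unfolding S_def by (rule frontier_faces[OF \<sigma>(1)])
  \<comment> \<open>Detection is stated for triviality of a class, so it is applied to the quotient
    of the two sides.\<close>
  let ?x = "?l \<otimes>\<^bsub>?G\<^esub> inv\<^bsub>?G\<^esub> finprod ?G ?a (facets \<sigma>)"
  have RS: "R \<subseteq> S" unfolding R_def S_def by blast
  have "?x = \<one>\<^bsub>?G\<^esub>"
  proof (rule top_cells_detect[of "facets \<sigma>" "faces \<sigma>" _ p, folded S_def R_def])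
    show "finite (facets \<sigma>)" by (rule finite_facets)
    show "facets \<sigma> \<subseteq> faces \<sigma>" using facets_faces by blast
    show "subcomplex X (faces \<sigma>)" by (rule subcomplex_faces[OF \<sigma>(1)])
    show "subcomplex X (faces \<sigma> - {\<tau>})" if "\<tau> \<in> facets \<sigma>" for \<tau>
      using remove_top_face[OF \<sigma>(1) facets_faces[OF that] facets_dim[OF that]] .
    show "?x \<in> carrier ?G" using l r by simp
  next
    fix \<mu> assume \<mu>: "\<mu> \<in> facets \<sigma>"
    let ?K = "H p S (S - \<mu>)"
    let ?j = "incl p S R S (S - \<mu>)"
    interpret j: group_hom ?G ?K ?j by (rule group_hom_incl)
    interpret K: comm_group ?K by simp
    have R\<mu>: "R \<subseteq> S - \<mu>" using closure_facet(4)[OF \<sigma>(1) \<mu>] unfolding R_def S_def .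
    have p: "int (cdim X \<tau>) = p" if "\<tau> \<in> facets \<sigma>" for \<tau>
      using facets_dim[OF that] by (simp add: p_def)
    have ja: "?j (?a \<tau>) = cell_incl p \<tau> S (S - \<mu>) (orient X \<tau>)
        [^]\<^bsub>?K\<^esub> incidence X \<sigma> \<tau>" if "\<tau> \<in> facets \<sigma>" for \<tau>
    proof -
      have "cell_closure X \<tau> \<subseteq> S" "cell_frontier X \<tau> \<subseteq> R"
        using closure_facet[OF \<sigma>(1) that] unfolding S_def R_def by auto
      then show ?thesis
        using R\<mu> RS by (simp only: j.hom_int_pow[OF incl_carrier] incl_compose order_refl)
    qed
    have one: "?j (?a \<tau>) = \<one>\<^bsub>?K\<^esub>" if "\<tau> \<in> facets \<sigma>" "\<tau> \<noteq> \<mu>" for \<tau>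
    proof -
      have cl: "cell_closure X \<tau> \<subseteq> S - \<mu>"
        using closure_facet(3)[OF \<sigma>(1) that(1) \<mu>] that(2) unfolding S_def by blast
      have "cell_frontier X \<tau> \<subseteq> S - \<mu>" using cl by (auto simp: cell_frontier_def)
      then show ?thesis using cl unfolding ja[OF that(1)] by (subst incl_trivial) auto
    qed
    have "?j (finprod ?G ?a (facets \<sigma>)) = finprod ?K (\<lambda>\<tau>. ?j (?a \<tau>)) (facets \<sigma>)"
      by (rule hom_finprod[OF _ _ j.homh finite_facets a]) simp_all
    also have "\<dots> = finprod ?K (\<lambda>\<tau>. if \<tau> = \<mu> then ?j (?a \<tau>) else \<one>\<^bsub>?K\<^esub>) (facets \<sigma>)"
      using one by (intro K.finprod_cong') (auto intro: incl_carrier)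
    also have "\<dots> = ?j (?a \<mu>)"
      by (rule K.finprod_singleton_swap[OF \<mu> finite_facets]) (auto intro: incl_carrier)
    also have "\<dots> = incl p S {} S (S - \<mu>) (bd \<sigma>)"
      unfolding ja[OF \<mu>] using incidence_eq[OF \<sigma>(1) facets_faces[OF \<mu>] facets_dim[OF \<mu>]]
      unfolding SF p[OF \<mu>] by (rule sym)
    also have "\<dots> = ?j ?l" using RS R\<mu> by (subst incl_compose) auto
    finally have "?j (finprod ?G ?a (facets \<sigma>)) = ?j ?l" .
    then have "?j ?x = \<one>\<^bsub>?K\<^esub>" using l r by (simp add: j.hom_mult j.hom_inv incl_carrier)
    then show "?j ?x = \<one>\<^bsub>?K\<^esub>" .
  qed
  from G.inv_equality[OF this G.inv_closed[OF r] l] show ?thesis using r by simp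
qed

lemma incidence_nonzero:
  "incidence X \<sigma> \<tau> \<noteq> 0 \<Longrightarrow> \<sigma> \<in> cells X \<and> \<tau> \<in> facets \<sigma>"
  by (auto simp: incidence_def facets_def faces_def split: if_splits)

text \<open>For \<open>\<rho>\<close> of codimension two, the connecting map of
  \<open>(S, R)\<close> followed by localization at \<open>\<rho>\<close> sends the orientation of a
  facet \<open>\<tau>\<close> to the \<open>incidence X \<tau> \<rho>\<close>-th power of that of
  \<open>\<rho>\<close>. The sum in \<open>bd_eq_sum\<close> comes from \<open>H(S)\<close>, so
  exactness sends it to the identity, and the exponent must be zero.\<close>

lemma incidence_incidence:
  assumes \<sigma>: "\<sigma> \<in> cells X" and \<rho>: "\<rho> \<in> cells X"
  shows "(\<Sum>\<tau>\<in>cells X. incidence X \<sigma> \<tau> * incidence X \<tau> \<rho>) = 0"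
proof (cases "cdim X \<sigma> = cdim X \<rho> + 2 \<and> \<rho> \<in> faces \<sigma>")
  case False
  have "incidence X \<sigma> \<tau> * incidence X \<tau> \<rho> = 0" if "\<tau> \<in> cells X" for \<tau>
  proof (rule ccontr)
    assume "incidence X \<sigma> \<tau> * incidence X \<tau> \<rho> \<noteq> 0"
    then have \<tau>: "\<tau> \<in> facets \<sigma>" "\<rho> \<in> facets \<tau>" using incidence_nonzero by auto
    then have "\<rho> \<in> faces \<sigma>" using face_of_facet[OF \<sigma> \<tau>(1)] facets_faces by blast
    with False facets_dim[OF \<tau>(1)] facets_dim[OF \<tau>(2)] show False by simp
  qed
  then show ?thesis by (intro sum.neutral ballI)
next
  case True
  define S where "S = \<Union>(faces \<sigma>)"
  define R where "R = \<Union>(faces \<sigma> - facets \<sigma>)"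
  define p where "p = int (cdim X \<sigma>) - 1"
  define q where "q = int (cdim X \<rho>)"
  have q: "p - 1 = q" using True by (simp add: p_def q_def)
  have RS: "R \<subseteq> S" unfolding R_def S_def by blast
  have \<rho>R: "\<rho> \<in> faces \<sigma> - facets \<sigma>" using True by (simp add: facets_def)
  have subR: "subcomplex X (faces \<sigma> - facets \<sigma>)"
    by (rule subcomplex_diff[OF subcomplex_faces[OF \<sigma>]
          remove_top_face[OF \<sigma> facets_faces facets_dim]])
  \<comment> \<open>Once the facets are gone, a cell of codimension two is maximal.\<close>
  have subR\<rho>: "subcomplex X (faces \<sigma> - facets \<sigma> - {\<rho>})"
    unfolding subcomplex_def
  proof (intro conjI ballI impI)
    fix \<mu> \<nu> assume *: "\<mu> \<in> faces \<sigma> - facets \<sigma> - {\<rho>}" "\<nu> \<in> cells X" "cell_face X \<nu> \<mu>"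
    have "\<nu> \<noteq> \<rho>"
    proof
      assume "\<nu> = \<rho>"
      then have "cdim X \<rho> < cdim X \<mu>" using * proper_face_dim[of \<mu> \<rho>] by (auto simp: faces_def)
      moreover have "cdim X \<mu> < cdim X \<sigma>" using * proper_face_dim[OF \<sigma>] by (auto simp: faces_def)
      ultimately show False using True * by (auto simp: facets_def)
    qed
    then show "\<nu> \<in> faces \<sigma> - facets \<sigma> - {\<rho>}"
      using subcomplex_face[OF subR _ *(2,3)] *(1) by blast
  qed (auto simp: faces_def)
  let ?o = "cell_incl q \<rho> R (R - \<rho>) (orient X \<rho>)"
  let ?G = "H p S R" and ?K = "H q R (R - \<rho>)"
  let ?D = "hom_boundary p (subtopology (cw_space X) S) R"
  let ?\<Psi> = "\<lambda>x. incl q R {} R (R - \<rho>) (?D x)"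
  have subRS: "subtopology (subtopology (cw_space X) S) R = subtopology (cw_space X) R"
    using RS by (simp only: subtopology_subtopology inf_absorb2)
  have iso: "cell_incl q \<rho> R (R - \<rho>)
      \<in> iso (H q (cell_closure X \<rho>) (cell_frontier X \<rho>)) ?K"
    unfolding R_def by (rule top_cell_iso[OF subR subR\<rho> \<rho>R])
  have oK: "orient X \<rho> \<in> carrier (H q (cell_closure X \<rho>) (cell_frontier X \<rho>))"
    using orient_carrier[OF \<rho>] by (simp add: cell_group q_def)
  have pow1: "?o [^]\<^bsub>?K\<^esub> (m::int) = \<one>\<^bsub>?K\<^esub> \<longleftrightarrow> m = 0" for m
    using orient_pow_eq_one[OF \<rho>]
    by (intro iso_generator_pow_eq_one[OF iso _ _ oK]) (simp_all add: cell_group q_def)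
  have Dhom: "?D \<in> hom ?G (H q R {})"
    using hom_boundary_hom[of p "subtopology (cw_space X) S" R] unfolding subRS q .
  have \<Psi>: "?\<Psi> \<in> hom ?G ?K"
    using hom_compose[OF Dhom incl_hom[of q R "{}" R "R - \<rho>"]] by (simp add: o_def)
  interpret \<Psi>: group_hom ?G ?K ?\<Psi> by (simp add: group_hom_def group_hom_axioms_def \<Psi>)
  let ?a = "\<lambda>\<tau>. cell_incl p \<tau> S R (orient X \<tau>)"
  have e: "?\<Psi> (?a \<tau>) = ?o [^]\<^bsub>?K\<^esub> incidence X \<tau> \<rho>" if \<tau>: "\<tau> \<in> facets \<sigma>" for \<tau>
  proof -
    note \<tau>X = facets_cells[OF \<tau>]
    let ?F = "cell_frontier X \<tau>" and ?C = "cell_closure X \<tau>"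
    have CS: "?C \<subseteq> S" "?F \<subseteq> R" using closure_facet[OF \<sigma> \<tau>] unfolding S_def R_def by auto
    have p\<tau>: "int (cdim X \<tau>) = p" using facets_dim[OF \<tau>] by (simp add: p_def)
    \<comment> \<open>Naturality of the connecting map for the inclusion of the closed cell
      \<open>\<tau>\<close> and its frontier into \<open>(S, R)\<close>.\<close>
    have nat: "?D (?a \<tau>) = incl q ?F {} R {} (bd \<tau>)"
    proof -
      have "(?D \<circ> hom_induced p (subtopology (cw_space X) ?C) ?F (subtopology (cw_space X) S) R id) =
         hom_induced (p - 1) (subtopology (subtopology (cw_space X) ?C) ?F) {}
           (subtopology (subtopology (cw_space X) S) R) {} id
         \<circ> hom_boundary p (subtopology (cw_space X) ?C) ?F"
        by (rule naturality_hom_induced)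
          (use CS in \<open>auto simp: continuous_map_in_subtopology intro: continuous_map_from_subtopology\<close>)
      from fun_cong[OF this, of "orient X \<tau>"] show ?thesis
        unfolding incl_def bd_def p\<tau> subRS sub_frontier q by (simp only: comp_apply)
    qed
    have "?\<Psi> (?a \<tau>) = incl q ?F {} R (R - \<rho>) (bd \<tau>)"
      unfolding nat using CS by (subst incl_compose) auto
    also have "\<dots> = ?o [^]\<^bsub>?K\<^esub> incidence X \<tau> \<rho>"
    proof (cases "\<rho> \<in> faces \<tau>")
      case \<rho>\<tau>: True
      have dim: "cdim X \<tau> = cdim X \<rho> + 1" using True facets_dim[OF \<tau>] by simp
      have cl: "cell_closure X \<rho> \<subseteq> ?F"
        using subcomplex_Union[OF subcomplex_faces[OF \<tau>X]] \<rho>\<tau> frontier_faces[OF \<tau>X] by auto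
      have fr: "cell_frontier X \<rho> \<subseteq> ?F - \<rho>" using cl by (auto simp: cell_frontier_def)
      interpret i: group_hom "H q ?F (?F - \<rho>)" ?K "incl q ?F (?F - \<rho>) R (R - \<rho>)"
        by (rule group_hom_incl)
      have "incl q ?F {} R (R - \<rho>) (bd \<tau>) =
          incl q ?F (?F - \<rho>) R (R - \<rho>) (incl q ?F {} ?F (?F - \<rho>) (bd \<tau>))"
        using CS(2) by (subst incl_compose) auto
      also have "\<dots> = incl q ?F (?F - \<rho>) R (R - \<rho>)
          (cell_incl q \<rho> ?F (?F - \<rho>) (orient X \<rho>)
             [^]\<^bsub>H q ?F (?F - \<rho>)\<^esub> incidence X \<tau> \<rho>)"
        using incidence_eq[OF \<tau>X \<rho>\<tau> dim] by (simp only: q_def)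
      also have "\<dots> = incl q ?F (?F - \<rho>) R (R - \<rho>)
          (cell_incl q \<rho> ?F (?F - \<rho>) (orient X \<rho>))
             [^]\<^bsub>?K\<^esub> incidence X \<tau> \<rho>"
        by (rule i.hom_int_pow[OF incl_carrier])
      also have "incl q ?F (?F - \<rho>) R (R - \<rho>)
          (cell_incl q \<rho> ?F (?F - \<rho>) (orient X \<rho>)) = ?o"
        using cl fr CS(2) by (intro incl_compose) auto
      finally show ?thesis .
    next
      case False
      \<comment> \<open>If \<open>\<rho>\<close> is not a face of \<open>\<tau>\<close>, the
        frontier of \<open>\<tau>\<close> lies in \<open>R - \<rho>\<close>, which is divided out;
        both sides are then trivial.\<close>
      have "incidence X \<tau> \<rho> = 0" using False incidence_nonzero facets_faces by blast
      moreover have "?F \<inter> \<rho> = {}"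
        unfolding frontier_faces[OF \<tau>X]
        by (rule Union_inter_disjoint[OF _ \<rho> False]) (auto simp: faces_def)
      then have "incl q ?F {} R (R - \<rho>) (bd \<tau>) = \<one>\<^bsub>?K\<^esub>"
        using CS(2) by (intro incl_trivial) auto
      ultimately show ?thesis by simp
    qed
    finally show ?thesis .
  qed
  have SF: "cell_frontier X \<sigma> = S" unfolding S_def by (rule frontier_faces[OF \<sigma>])
  \<comment> \<open>The class \<open>bd \<sigma>\<close> is absolute in \<open>S\<close>;
    consecutive maps in the exact sequence of \<open>(S, R)\<close> compose to zero.\<close>
  have D1: "?D (incl p S {} S R (bd \<sigma>)) = \<one>\<^bsub>H q R {}\<^esub>"
  proof -
    have "exact_seq ([H q R {}, ?G, H p S {}], [?D, incl p S {} S R])"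
      using homology_exactness_axiom_1[of p "subtopology (cw_space X) S" R]
      unfolding subRS q incl_def .
    then have "kernel ?G (H q R {}) ?D = incl p S {} S R ` carrier (H p S {})" by simp
    moreover have "bd \<sigma> \<in> carrier (H p S {})" using bd_carrier[of \<sigma>] unfolding SF p_def .
    ultimately have "incl p S {} S R (bd \<sigma>) \<in> kernel ?G (H q R {}) ?D" by (simp only: imageI)
    then show ?thesis by (simp add: kernel_def)
  qed
  have "\<one>\<^bsub>?K\<^esub> = ?\<Psi> (incl p S {} S R (bd \<sigma>))"
    unfolding D1 by (rule group_hom.hom_one[OF group_hom_incl, symmetric])
  also have "\<dots> = ?\<Psi> (finprod ?G (\<lambda>\<tau>. ?a \<tau> [^]\<^bsub>?G\<^esub> incidence X \<sigma> \<tau>) (facets \<sigma>))"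
    using bd_eq_sum[OF \<sigma>] True unfolding S_def R_def p_def by simp
  also have "\<dots> = finprod ?K (\<lambda>\<tau>. ?\<Psi> (?a \<tau> [^]\<^bsub>?G\<^esub> incidence X \<sigma> \<tau>)) (facets \<sigma>)"
    by (rule hom_finprod[OF _ _ \<Psi> finite_facets]) (simp_all add: incl_carrier)
  also have "\<dots> = finprod ?K (\<lambda>\<tau>. ?o [^]\<^bsub>?K\<^esub> (incidence X \<tau> \<rho> * incidence X \<sigma> \<tau>)) (facets \<sigma>)"
    by (rule comm_monoid.finprod_cong')
      (simp_all add: comm_group.axioms incl_carrier \<Psi>.hom_int_pow[OF incl_carrier] e
        group.int_pow_pow)
  also have "\<dots> = ?o [^]\<^bsub>?K\<^esub> (\<Sum>\<tau>\<in>facets \<sigma>. incidence X \<tau> \<rho> * incidence X \<sigma> \<tau>)"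
    by (rule finprod_int_pow[OF _ finite_facets]) (simp_all add: incl_carrier)
  finally have "(\<Sum>\<tau>\<in>facets \<sigma>. incidence X \<tau> \<rho> * incidence X \<sigma> \<tau>) = 0"
    by (simp only: pow1[symmetric])
  moreover have "(\<Sum>\<tau>\<in>cells X. incidence X \<sigma> \<tau> * incidence X \<tau> \<rho>) =
      (\<Sum>\<tau>\<in>facets \<sigma>. incidence X \<tau> \<rho> * incidence X \<sigma> \<tau>)"
    using incidence_nonzero[of \<sigma>] facets_cells
    by (intro sum.mono_neutral_cong_right finite_cells) auto
  ultimately show ?thesis by simp
qed

section \<open>Comparing the orientations of vertices\<close>

lemma vertex_frontier:
  assumes "v \<in> cells X" "cdim X v = 0" shows "cell_frontier X v = {}" "\<exists>a. cell_closure X v = {a}"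
proof -
  show 1: "cell_frontier X v = {}" using frontier_eq[OF assms(1)] assms(2) by simp
  obtain h :: "(nat \<Rightarrow> real) \<Rightarrow> 'a" where "h ` open_ball (cdim X v) = v"
    using cell_homeo[OF assms(1)] by blast
  moreover have "open_ball 0 = {\<lambda>i. 0}" by (auto simp: open_ball_altdef)
  ultimately have "v = {h (\<lambda>i. 0)}" using assms(2) by simp
  then show "\<exists>a. cell_closure X v = {a}" using closure_eq[OF assms(1)] 1 by auto
qed

text \<open>The sign \<open>s v\<close> records where the collapse to a point sends the orientation
  of \<open>v\<close>. For a single vertex the collapse is an isomorphism, so the sign is a unit.
  The boundary of an edge dies in the closed edge and hence in the point, which is the second
  claim.\<close>

lemma vertex_signs:
  "\<exists>s :: 'a set \<Rightarrow> int. (\<forall>v\<in>cells X. cdim X v = 0 \<longrightarrow> \<bar>s v\<bar> = 1) \<and>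
     (\<forall>e\<in>cells X. cdim X e = 1 \<longrightarrow> (\<Sum>v\<in>cells X. incidence X e v * s v) = 0)"
proof -
  let ?P = "discrete_topology {()}"
  let ?H = "homology_group 0 ?P"
  have "?H \<cong> integer_group" by (rule homology_coefficients[of _ "()"]) simp
  then obtain g where g: "g \<in> carrier ?H" "\<And>x. x \<in> carrier ?H \<Longrightarrow> \<exists>m::int. x = g [^]\<^bsub>?H\<^esub> m"
    "\<And>m::int. g [^]\<^bsub>?H\<^esub> m = \<one>\<^bsub>?H\<^esub> \<longleftrightarrow> m = 0"
    by (rule integer_group_generator[rotated]) simp_all
  define \<pi> where "\<pi> S = hom_induced 0 (subtopology (cw_space X) S) {} ?P {} (\<lambda>x. ())" for S :: "'a set"
  have \<pi>: "group_hom (H 0 S {}) ?H (\<pi> S)" for S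
    unfolding \<pi>_def by (simp add: group_hom_def group_hom_axioms_def hom_induced_hom)
  have \<pi>_incl: "\<pi> S (incl 0 T {} S {} x) = \<pi> T x" if "T \<subseteq> S" for S T x
  proof -
    have "\<pi> S (incl 0 T {} S {} x) = hom_induced 0 (subtopology (cw_space X) T) {} ?P {} ((\<lambda>x. ()) \<circ> id) x"
      unfolding \<pi>_def incl_def by (rule hom_induced_compose')
        (use that in \<open>auto simp: continuous_map_in_subtopology intro: continuous_map_from_subtopology\<close>)
    then show ?thesis by (simp add: \<pi>_def o_def)
  qed
  define o' where "o' v = \<pi> (cell_closure X v) (orient X v)" for v
  have o'_carrier: "o' v \<in> carrier ?H" for v
    unfolding o'_def \<pi>_def by (rule hom_induced_carrier)
  define s where "s v = (SOME m::int. o' v = g [^]\<^bsub>?H\<^esub> m)" for v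
  have s: "o' v = g [^]\<^bsub>?H\<^esub> s v" for v
    unfolding s_def using g(2)[OF o'_carrier] by (rule someI_ex)
  have "\<bar>s v\<bar> = 1" if v: "v \<in> cells X" "cdim X v = 0" for v
  proof -
    let ?C = "cell_closure X v"
    let ?K = "H 0 ?C {}"
    interpret \<pi>: group_hom ?K ?H "\<pi> ?C" by (rule \<pi>)
    have Kv: "cell_homology_group X v = ?K"
      by (simp add: cell_group v(2) vertex_frontier(1)[OF v])
    have oK: "orient X v \<in> carrier ?K" using orient_carrier[OF v(1)] unfolding Kv .
    obtain a where a: "?C = {a}" using vertex_frontier(2)[OF v] by blast
    have "a \<in> topspace (cw_space X)" using closedin_subset[OF closedin_closure[of v]] a by simp
    then have "topspace (subtopology (cw_space X) ?C) = {a}" using a by auto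
    then have "homeomorphic_map (subtopology (cw_space X) ?C) ?P (\<lambda>x. ())"
      by (force simp: homeomorphic_map_maps homeomorphic_maps_def)
    then have "\<pi> ?C \<in> iso ?K ?H" unfolding \<pi>_def by (rule homeomorphic_map_homology_iso)
    then have "\<pi> ?C ` carrier ?K = carrier ?H" by (simp add: iso_def bij_betw_def)
    then obtain z where z: "z \<in> carrier ?K" "g = \<pi> ?C z" using g(1) by blast
    have "z \<in> generate ?K {orient X v}"
      using orient_generates[OF v(1)] z(1) unfolding Kv by simp
    then obtain m :: int where "z = orient X v [^]\<^bsub>?K\<^esub> m"
      using \<pi>.G.generate_pow[OF oK] by blast
    then have "g = o' v [^]\<^bsub>?H\<^esub> m" using z(2) by (simp only: \<pi>.hom_int_pow[OF oK] o'_def)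
    \<comment> \<open>The generator is a power of the image of the orientation, which is itself a
      power of the generator; the exponents multiply to 1.\<close>
    then have "g = g [^]\<^bsub>?H\<^esub> (s v * m)" unfolding s by (simp only: \<pi>.H.int_pow_pow[OF g(1)])
    then have "g [^]\<^bsub>?H\<^esub> (s v * m - 1) = \<one>\<^bsub>?H\<^esub>"
      using g(1) \<pi>.H.int_pow_diff[OF g(1), of "s v * m" 1] by simp
    then have "s v * m = 1" using g(3) by simp
    then have "\<bar>s v * m\<bar> = 1" by simp
    then show ?thesis by (rule abs_zmult_eq_1)
  qed
  moreover have "(\<Sum>v\<in>cells X. incidence X e v * s v) = 0" if e: "e \<in> cells X" "cdim X e = 1" for e
  proof -
    let ?S = "\<Union>(faces e)" and ?C = "cell_closure X e"
    let ?G = "H 0 ?S {}"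
    interpret \<pi>: group_hom ?G ?H "\<pi> ?S" by (rule \<pi>)
    have dim: "cdim X v = 0" if "v \<in> facets e" for v using facets_dim[OF that] e(2) by simp
    \<comment> \<open>All proper faces of an edge are vertices, so the set divided out in
      \<open>bd_eq_sum\<close> is empty and its formula holds in absolute homology.\<close>
    have "faces e \<subseteq> facets e"
      using proper_face_dim[OF e(1)] e(2) by (auto simp: facets_def faces_def)
    then have R: "\<Union>(faces e - facets e) = {}" by blast
    let ?a = "\<lambda>v. incl 0 (cell_closure X v) {} ?S {} (orient X v)"
    have SF: "cell_frontier X e = ?S" by (rule frontier_faces[OF e(1)])
    have be: "bd e \<in> carrier ?G" using bd_carrier[of e] e(2) by (simp add: SF)
    have a: "\<pi> ?S (?a v) = g [^]\<^bsub>?H\<^esub> s v" if "v \<in> facets e" for v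
      unfolding s[symmetric] o'_def using closure_facet(2)[OF e(1) that] by (rule \<pi>_incl)
    have "bd e = incl 0 ?S {} ?S {} (bd e)"
      unfolding incl_def by (rule hom_induced_id[OF be, symmetric])
    also have "\<dots> = finprod ?G (\<lambda>v. cell_incl 0 v ?S {} (orient X v)
        [^]\<^bsub>?G\<^esub> incidence X e v) (facets e)"
      using bd_eq_sum[OF e(1)] e(2) unfolding R by simp
    also have "\<dots> = finprod ?G (\<lambda>v. ?a v [^]\<^bsub>?G\<^esub> incidence X e v) (facets e)"
      by (rule comm_monoid.finprod_cong')
        (use dim facets_cells in \<open>auto simp: vertex_frontier(1) comm_group.axioms incl_carrier\<close>)
    finally have bd: "bd e = finprod ?G (\<lambda>v. ?a v [^]\<^bsub>?G\<^esub> incidence X e v) (facets e)" .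
    \<comment> \<open>By exactness, the boundary of the edge becomes trivial in the closed
      edge.\<close>
    have "exact_seq ([H 0 ?C {}, H 0 ?S {}, H 1 ?C ?S],
        [incl 0 ?S {} ?C {}, hom_boundary 1 (subtopology (cw_space X) ?C) ?S])"
      using homology_exactness_axiom_2[of 1 "subtopology (cw_space X) ?C" ?S] sub_frontier[of e]
      by (simp only: SF incl_def diff_self)
    then have "kernel ?G (H 0 ?C {}) (incl 0 ?S {} ?C {}) =
        hom_boundary 1 (subtopology (cw_space X) ?C) ?S ` carrier (H 1 ?C ?S)" by simp
    moreover have "orient X e \<in> carrier (H 1 ?C ?S)"
      using orient_carrier[OF e(1)] e(2) by (simp add: cell_group SF)
    then have "bd e \<in> hom_boundary 1 (subtopology (cw_space X) ?C) ?S ` carrier (H 1 ?C ?S)"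
      unfolding bd_def SF using e(2) by simp
    ultimately have "bd e \<in> kernel ?G (H 0 ?C {}) (incl 0 ?S {} ?C {})" by (simp only:)
    then have "incl 0 ?S {} ?C {} (bd e) = \<one>\<^bsub>H 0 ?C {}\<^esub>" by (simp add: kernel_def)
    then have "\<pi> ?C (incl 0 ?S {} ?C {} (bd e)) = \<one>\<^bsub>?H\<^esub>"
      by (simp only: group_hom.hom_one[OF \<pi>])
    moreover have "?S \<subseteq> ?C" using SF by (auto simp: cell_frontier_def)
    ultimately have "\<one>\<^bsub>?H\<^esub> = \<pi> ?S (bd e)" by (simp add: \<pi>_incl)
    also have "\<dots> = finprod ?H (\<lambda>v. \<pi> ?S (?a v [^]\<^bsub>?G\<^esub> incidence X e v)) (facets e)"
      unfolding bd by (rule hom_finprod[OF _ _ \<pi>.homh finite_facets]) (simp_all add: incl_carrier)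
    also have "\<dots> = finprod ?H (\<lambda>v. g [^]\<^bsub>?H\<^esub> (s v * incidence X e v)) (facets e)"
      by (rule comm_monoid.finprod_cong')
        (simp_all add: comm_group.axioms g(1) \<pi>.hom_int_pow[OF incl_carrier] a group.int_pow_pow)
    also have "\<dots> = g [^]\<^bsub>?H\<^esub> (\<Sum>v\<in>facets e. s v * incidence X e v)"
      by (rule finprod_int_pow[OF _ finite_facets g(1)]) simp
    finally have "(\<Sum>v\<in>facets e. s v * incidence X e v) = 0"
      by (simp only: g(3)[symmetric])
    moreover have "(\<Sum>v\<in>cells X. incidence X e v * s v) = (\<Sum>v\<in>facets e. s v * incidence X e v)"
      using incidence_nonzero[of e] facets_cells
      by (intro sum.mono_neutral_cong_right finite_cells) auto
    ultimately show ?thesis by simp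
  qed
  ultimately show ?thesis by blast
qed

end

section \<open>Acyclic carriers\<close>

definition lin_ext :: "'a cw \<Rightarrow> ('a set \<Rightarrow> 'b \<Rightarrow> 'k) \<Rightarrow> ('a set \<Rightarrow> 'k) \<Rightarrow> 'b \<Rightarrow> 'k::field" where
  "lin_ext X f x = (\<lambda>t. \<Sum>c\<in>cells X. x c * f c t)"

definition bdry :: "'a cw \<Rightarrow> 'a set \<Rightarrow> 'a set \<Rightarrow> 'k::field" where
  "bdry X c = (\<lambda>\<tau>. of_int (incidence X c \<tau>))"

text \<open>The value at a vertex is a unit rather than 1, as vertices may have either orientation.\<close>

definition augmentation :: "'a cw \<Rightarrow> ('a set \<Rightarrow> 'k::field) \<Rightarrow> bool" where
  "augmentation X \<eta> \<longleftrightarrow>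
     (\<forall>v\<in>cells X. \<eta> v \<noteq> 0 \<longleftrightarrow> cdim X v = 0) \<and>
     (\<forall>x. (\<Sum>v\<in>cells X. \<eta> v * cell_boundary X x v) = 0)"

lemma cell_boundary_lin_ext: "cell_boundary X x = lin_ext X (bdry X) x"
  by (simp add: fun_eq_iff cell_boundary_def lin_ext_def bdry_def mult.commute)

lemma lin_ext_lin_ext:
  "lin_ext Y g (lin_ext X f x) = lin_ext X (\<lambda>c. lin_ext Y g (f c)) x"
  by (auto simp: lin_ext_def sum_distrib_left sum_distrib_right mult.assoc intro: sum.swap)

lemma lin_ext_functional:
  "(\<Sum>v\<in>V. \<eta> v * lin_ext X f x v) = (\<Sum>c\<in>cells X. x c * (\<Sum>v\<in>V. \<eta> v * f c v))"
  by (simp add: lin_ext_def sum_distrib_left mult.left_commute) (rule sum.swap)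

lemma lin_ext_add: "lin_ext X f (\<lambda>c. x c + y c) = (\<lambda>t. lin_ext X f x t + lin_ext X f y t)"
  by (simp add: lin_ext_def distrib_right sum.distrib)

lemma lin_ext_diff: "lin_ext X f (\<lambda>c. x c - y c) = (\<lambda>t. lin_ext X f x t - lin_ext X f y t)"
  by (simp add: lin_ext_def left_diff_distrib sum_subtractf)

lemma lin_ext_scale: "lin_ext X f (\<lambda>c. a * x c) = (\<lambda>t. a * lin_ext X f x t)"
  by (simp add: lin_ext_def sum_distrib_left mult.assoc)

lemma lin_ext_diff_fun: "lin_ext X (\<lambda>c t. f c t - g c t) x = (\<lambda>t. lin_ext X f x t - lin_ext X g x t)"
  by (simp add: lin_ext_def right_diff_distrib sum_subtractf)

lemma lin_ext_cong:
  assumes "\<And>c. c \<in> cells X \<Longrightarrow> x c \<noteq> 0 \<Longrightarrow> f c = g c"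
  shows "lin_ext X f x = lin_ext X g x"
proof -
  have "x c * f c t = x c * g c t" if "c \<in> cells X" for c t
    using assms[OF that] by (cases "x c = 0") simp_all
  then show ?thesis unfolding lin_ext_def by (intro ext sum.cong) auto
qed

lemma lin_ext_zero: "lin_ext X f (\<lambda>c. 0) = (\<lambda>t. 0)"
  by (simp add: lin_ext_def)

lemma lin_ext_zero_fun: "lin_ext X (\<lambda>c t. 0) x = (\<lambda>t. 0)"
  by (simp add: lin_ext_def)

lemma in_cell_chains: "x \<in> cell_chains X S n \<longleftrightarrow> (\<forall>c. x c \<noteq> 0 \<longrightarrow> c \<in> S \<and> cdim X c = n)"
  by (simp add: cell_chains_def chain_module_def)

lemma lin_ext_cell_chains:
  assumes "\<And>c. c \<in> cells X \<Longrightarrow> x c \<noteq> 0 \<Longrightarrow> f c \<in> cell_chains Y S n"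
  shows "lin_ext X f x \<in> cell_chains Y S n"
  unfolding in_cell_chains
proof (intro allI impI)
  fix t assume "lin_ext X f x t \<noteq> 0"
  then obtain c where "c \<in> cells X" "x c * f c t \<noteq> 0"
    unfolding lin_ext_def by (meson sum.neutral)
  then show "t \<in> S \<and> cdim Y t = n" using assms[of c] by (auto simp: in_cell_chains)
qed

lemma cell_chains_mono: "x \<in> cell_chains X S n \<Longrightarrow> S \<subseteq> T \<Longrightarrow> x \<in> cell_chains X T n"
  by (auto simp: in_cell_chains)

lemma cell_chains_diff:
  "x \<in> cell_chains X S n \<Longrightarrow> y \<in> cell_chains X S n \<Longrightarrow> (\<lambda>c. x c - y c) \<in> cell_chains X S n"
  unfolding in_cell_chains by (metis diff_self)

context regular_cw begin

lemma bdry_nonzero: "bdry X c \<tau> \<noteq> (0::'k::field) \<Longrightarrow> c \<in> cells X \<and> \<tau> \<in> facets c"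
  using incidence_nonzero[of c \<tau>] by (cases "incidence X c \<tau> = 0") (simp_all add: bdry_def)

lemma lin_ext_bdry_bdry: "lin_ext X (bdry X) (bdry X c) = (\<lambda>\<tau>. 0 :: 'k::field)"
proof
  fix \<tau>
  show "lin_ext X (bdry X) (bdry X c) \<tau> = (0 :: 'k)"
  proof (cases "c \<in> cells X \<and> \<tau> \<in> cells X")
    case True
    have "lin_ext X (bdry X) (bdry X c) \<tau> =
        (of_int (\<Sum>\<sigma>\<in>cells X. incidence X c \<sigma> * incidence X \<sigma> \<tau>) :: 'k)"
      by (simp add: lin_ext_def bdry_def)
    then show ?thesis using incidence_incidence True by simp
  next
    case False
    then have "bdry X c \<sigma> * bdry X \<sigma> \<tau> = (0::'k)" for \<sigma>
      using bdry_nonzero[of c \<sigma>] bdry_nonzero[of \<sigma> \<tau>] facets_cells by (metis mult_eq_0_iff)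
    then show ?thesis unfolding lin_ext_def by (intro sum.neutral ballI)
  qed
qed

lemma cell_boundary_cell_boundary: "cell_boundary X (cell_boundary X x) = (\<lambda>\<tau>. 0 :: 'k::field)"
  unfolding cell_boundary_lin_ext lin_ext_lin_ext lin_ext_bdry_bdry lin_ext_zero_fun ..

lemma cell_boundary_0:
  assumes x: "x \<in> cell_chains X S 0"
  shows "cell_boundary X x = (\<lambda>\<tau>. 0)"
proof
  fix \<tau>
  have "of_int (incidence X c \<tau>) * x c = 0" for c
    using incidence_nonzero[of c \<tau>] facets_dim[of \<tau> c] x by (fastforce simp: in_cell_chains)
  then show "cell_boundary X x \<tau> = 0" unfolding cell_boundary_def by (intro sum.neutral ballI)
qed

lemma augmentation_exists: "\<exists>\<eta> :: 'a set \<Rightarrow> 'k::field. augmentation X \<eta>"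
proof -
  obtain s :: "'a set \<Rightarrow> int" where
    s1: "\<And>v. v \<in> cells X \<Longrightarrow> cdim X v = 0 \<Longrightarrow> \<bar>s v\<bar> = 1" and
    s2: "\<And>e. e \<in> cells X \<Longrightarrow> cdim X e = 1 \<Longrightarrow> (\<Sum>v\<in>cells X. incidence X e v * s v) = 0"
    using vertex_signs by blast
  define \<eta> :: "'a set \<Rightarrow> 'k" where "\<eta> v = (if cdim X v = 0 then of_int (s v) else 0)" for v
  have 1: "\<eta> v \<noteq> 0 \<longleftrightarrow> cdim X v = 0" if "v \<in> cells X" for v
  proof -
    \<comment> \<open>A sign stays nonzero in a field of any characteristic, so the augmentation
      does not vanish on vertices.\<close>
    have "s v = 1 \<or> s v = -1" if "cdim X v = 0" using s1[OF \<open>v \<in> cells X\<close> that] by linarith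
    then show ?thesis by (auto simp: \<eta>_def)
  qed
  have e: "(\<Sum>v\<in>cells X. \<eta> v * bdry X e v) = 0" if "e \<in> cells X" for e
  proof (cases "cdim X e = 1")
    case True
    have "\<eta> v * bdry X e v = of_int (incidence X e v * s v)" for v
      using incidence_nonzero[of e v] facets_dim[of v e] True
      by (cases "incidence X e v = 0") (simp_all add: \<eta>_def bdry_def)
    then have "(\<Sum>v\<in>cells X. \<eta> v * bdry X e v) = of_int (\<Sum>v\<in>cells X. incidence X e v * s v)"
      by simp
    then show ?thesis using s2[OF that True] by simp
  next
    case False
    have "\<eta> v * bdry X e v = 0" for v
      using incidence_nonzero[of e v] facets_dim[of v e] False
      by (cases "incidence X e v = 0") (auto simp: \<eta>_def bdry_def)
    then show ?thesis by (intro sum.neutral ballI)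
  qed
  have "augmentation X \<eta>"
    using 1 e by (simp add: augmentation_def cell_boundary_lin_ext lin_ext_functional)
  then show ?thesis by blast
qed

lemma augmentation_bdry:
  assumes "augmentation X \<eta>" "c \<in> cells X"
  shows "(\<Sum>v\<in>cells X. bdry X c v * \<eta> v) = 0"
proof -
  have eq: "cell_boundary X (\<lambda>d. of_bool (d = c)) = bdry X c"
    using assms(2) finite_cells
    by (simp add: fun_eq_iff cell_boundary_def bdry_def of_bool_def if_distrib cong: if_cong)
  have "(\<Sum>v\<in>cells X. \<eta> v * cell_boundary X (\<lambda>d. of_bool (d = c)) v) = 0"
    using assms(1) unfolding augmentation_def by blast
  then show ?thesis unfolding eq by (simp add: mult.commute)
qed

lemma augmentation_positive:
  assumes "augmentation X \<eta>" "x \<in> cell_chains X S (Suc n)"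
  shows "(\<Sum>v\<in>cells X. \<eta> v * x v) = 0"
  using assms by (intro sum.neutral) (force simp: augmentation_def in_cell_chains)

section \<open>Exactness of the augmented complex\<close>

lemma acyclic_vertex:
  assumes "acyclic_complex TYPE('k::field) X S"
  shows "\<exists>v\<in>S. cdim X v = 0"
proof (rule ccontr)
  assume "\<not> ?thesis"
  then have z: "x = (\<lambda>c. 0)" if "x \<in> cell_chains X S 0" for x :: "'a set \<Rightarrow> 'k"
    using that by (fastforce simp: in_cell_chains)
  let ?H = "cell_homology X S 0 :: ('k, _) module"
  let ?B = "cell_boundary X ` cell_chains X S (0 + 1) :: ('a set \<Rightarrow> 'k) set"
  obtain z where zH: "z \<in> carrier ?H" "z \<noteq> \<zero>\<^bsub>?H\<^esub>"
    using assms unfolding acyclic_complex_def one_dimensional_def by blast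
  then obtain x where x: "x \<in> cell_chains X S 0" "z = {(\<lambda>s. x s + b s) |b. b \<in> ?B}"
    by (auto simp: cell_homology_def quotient_module_def)
  have "z = ?B" unfolding x(2) z[OF x(1)] by simp
  then show False using zH(2) by (simp add: cell_homology_def quotient_module_def)
qed

text \<open>In positive degrees this is vanishing homology. In degree 0, \<open>H_0\<close> is
  spanned by one class, whose augmentation is nonzero because that of a vertex is; so a chain of
  augmentation zero is the zero multiple of it modulo boundaries.\<close>

lemma acyclic_exact:
  fixes y :: "'a set \<Rightarrow> 'k::field"
  assumes S: "subcomplex X S" and acyclic: "acyclic_complex TYPE('k) X S" and \<eta>: "augmentation X \<eta>"
    and y: "y \<in> cell_chains X S n" "cell_boundary X y = (\<lambda>\<tau>. 0)" "(\<Sum>v\<in>cells X. \<eta> v * y v) = 0"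
  shows "\<exists>w\<in>cell_chains X S (Suc n). cell_boundary X w = y"
proof -
  let ?H = "cell_homology X S n :: ('k, _) module"
  let ?B = "cell_boundary X ` cell_chains X S (Suc n) :: ('a set \<Rightarrow> 'k) set"
  have carrier: "carrier ?H = {{(\<lambda>s. x s + b s) |b. b \<in> ?B} |x. x \<in> cell_chains X S n \<and> cell_boundary X x = (\<lambda>\<tau>. 0)}"
    and zero: "\<zero>\<^bsub>?H\<^esub> = ?B"
    and smult: "a \<odot>\<^bsub>?H\<^esub> P = {(\<lambda>s. a * x s + b s) |x b. x \<in> P \<and> b \<in> ?B}" for a P
    by (simp_all add: cell_homology_def quotient_module_def)
  have B0: "(\<lambda>s. 0) \<in> ?B"
    by (rule image_eqI[of _ _ "\<lambda>s. 0"]) (simp_all add: in_cell_chains cell_boundary_def fun_eq_iff)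
  have "y \<in> ?B"
  proof (cases n)
    case (Suc m)
    have "{(\<lambda>s. y s + b s) |b. b \<in> ?B} \<in> carrier ?H" unfolding carrier using y by blast
    then have "{(\<lambda>s. y s + b s) |b. b \<in> ?B} = ?B"
      using acyclic zero Suc unfolding acyclic_complex_def by auto
    moreover have "y \<in> {(\<lambda>s. y s + b s) |b. b \<in> ?B}" using B0 by force
    ultimately show ?thesis by simp
  next
    case 0
    let ?\<eta> = "\<lambda>x. \<Sum>v\<in>cells X. \<eta> v * x v"
    have \<eta>B: "?\<eta> b = 0" if "b \<in> ?B" for b using that \<eta> unfolding augmentation_def by blast
    obtain z where z: "z \<in> carrier ?H" "\<And>x. x \<in> carrier ?H \<Longrightarrow> \<exists>a. x = a \<odot>\<^bsub>?H\<^esub> z"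
      using acyclic 0 unfolding acyclic_complex_def one_dimensional_def by blast
    obtain z0 where z0: "z = {(\<lambda>s. z0 s + b s) |b. b \<in> ?B}" using z(1) unfolding carrier by blast
    have *: "\<exists>a b b'. b \<in> ?B \<and> b' \<in> ?B \<and> x = (\<lambda>s. a * (z0 s + b s) + b' s)"
      if x: "x \<in> cell_chains X S 0" for x
    proof -
      have "{(\<lambda>s. x s + b s) |b. b \<in> ?B} \<in> carrier ?H"
        unfolding carrier using x cell_boundary_0[OF x] 0 by blast
      then obtain a where "{(\<lambda>s. x s + b s) |b. b \<in> ?B} = a \<odot>\<^bsub>?H\<^esub> z" using z(2) by blast
      moreover have "x \<in> {(\<lambda>s. x s + b s) |b. b \<in> ?B}" using B0 by force
      ultimately have "x \<in> {(\<lambda>s. a * w s + b s) |w b. w \<in> z \<and> b \<in> ?B}" unfolding smult by simp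
      then show ?thesis unfolding z0 by blast
    qed
    have \<eta>_comb: "?\<eta> (\<lambda>s. a * (z0 s + b s) + b' s) = a * ?\<eta> z0" if "b \<in> ?B" "b' \<in> ?B" for a b b'
    proof -
      have "?\<eta> (\<lambda>s. a * (z0 s + b s) + b' s) = a * (?\<eta> z0 + ?\<eta> b) + ?\<eta> b'"
        by (simp add: sum.distrib algebra_simps sum_distrib_left)
      then show ?thesis using \<eta>B that by simp
    qed
    \<comment> \<open>The vertex is used only to see that the spanning class \<open>z0\<close> has
      nonzero augmentation.\<close>
    obtain v where v: "v \<in> S" "cdim X v = 0" using acyclic_vertex[OF acyclic] by blast
    have vX: "v \<in> cells X" using v subcomplex_cells[OF S] by blast
    have "(\<lambda>s. of_bool (s = v)) \<in> cell_chains X S 0" using v by (simp add: in_cell_chains)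
    from *[OF this] obtain a b b' where ab: "b \<in> ?B" "b' \<in> ?B"
      "(\<lambda>s. of_bool (s = v)) = (\<lambda>s. a * (z0 s + b s) + b' s)" by blast
    have "?\<eta> (\<lambda>s. of_bool (s = v)) = \<eta> v"
      using vX finite_cells by (simp add: of_bool_def if_distrib cong: if_cong)
    moreover have "\<eta> v \<noteq> 0" using \<eta> vX v unfolding augmentation_def by blast
    ultimately have z0n: "?\<eta> z0 \<noteq> 0" using \<eta>_comb[OF ab(1,2), of a] arg_cong[OF ab(3), of ?\<eta>] by auto
    obtain a b b' where ab: "b \<in> ?B" "b' \<in> ?B" "y = (\<lambda>s. a * (z0 s + b s) + b' s)"
      using *[of y] y(1) 0 by blast
    then have "a = 0" using \<eta>_comb[OF ab(1,2), of a] y(3) z0n by simp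
    then have "y = b'" using ab(3) by simp
    then show ?thesis using ab(2) by simp
  qed
  then show ?thesis by blast
qed

end

section \<open>Maps and homotopies by induction over skeleta\<close>

lemma chain_map_lin_ext:
  assumes "\<And>c. c \<in> cells X \<Longrightarrow> cell_boundary Y (f c) = lin_ext X f (bdry X c)"
  shows "cell_boundary Y (lin_ext X f x) = lin_ext X f (cell_boundary X x)"
proof -
  have "cell_boundary Y (lin_ext X f x) = lin_ext X (\<lambda>c. cell_boundary Y (f c)) x"
    by (simp add: cell_boundary_lin_ext lin_ext_lin_ext)
  also have "\<dots> = lin_ext X (\<lambda>c. lin_ext X f (bdry X c)) x"
    using assms by (intro lin_ext_cong) simp
  also have "\<dots> = lin_ext X f (cell_boundary X x)"
    by (simp add: cell_boundary_lin_ext lin_ext_lin_ext)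
  finally show ?thesis .
qed

text \<open>Over each cell, the image of its boundary is a cycle in the acyclic carrier and is
  filled there. Prescribing the augmentation is what makes the image of the boundary of an edge
  fillable.\<close>

lemma acyclic_carrier_chain_map:
  fixes \<eta> :: "'a set \<Rightarrow> 'k::field" and \<theta> :: "'b set \<Rightarrow> 'k"
  assumes X: "finite_regular_cw X" and Y: "finite_regular_cw Y"
    and \<eta>: "augmentation X \<eta>" and \<theta>: "augmentation Y \<theta>"
    and sub: "\<And>c. c \<in> cells X \<Longrightarrow> subcomplex Y (\<Phi> c)"
    and acyclic: "\<And>c. c \<in> cells X \<Longrightarrow> acyclic_complex TYPE('k) Y (\<Phi> c)"
    and mono: "\<And>c d. c \<in> cells X \<Longrightarrow> d \<in> cells X \<Longrightarrow> cell_face X d c \<Longrightarrow> \<Phi> d \<subseteq> \<Phi> c"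
  shows "\<exists>f :: 'a set \<Rightarrow> 'b set \<Rightarrow> 'k. \<forall>c\<in>cells X. f c \<in> cell_chains Y (\<Phi> c) (cdim X c) \<and>
    cell_boundary Y (f c) = lin_ext X f (bdry X c) \<and> (\<Sum>v\<in>cells Y. \<theta> v * f c v) = \<eta> c"
proof -
  interpret X: regular_cw X by (rule regular_cw.intro[OF X])
  interpret Y: regular_cw Y by (rule regular_cw.intro[OF Y])
  \<comment> \<open>The guard \<open>c \<in> cells X\<close> makes \<open>P\<close> satisfiable for
    every set \<open>c\<close>, as the recursive choice is over the whole type.\<close>
  define P where "P f c w \<longleftrightarrow> (c \<in> cells X \<longrightarrow> w \<in> cell_chains Y (\<Phi> c) (cdim X c) \<and>
      cell_boundary Y w = lin_ext X f (bdry X c) \<and> (\<Sum>v\<in>cells Y. \<theta> v * w v) = \<eta> c)"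
    for f and c and w :: "'b set \<Rightarrow> 'k"
  have "\<exists>f. \<forall>c. P f c (f c)"
  proof (rule dependent_wf_choice[of "measure (cdim X)"])
    fix f g :: "'a set \<Rightarrow> 'b set \<Rightarrow> 'k" and c and w
    \<comment> \<open>The requirement at \<open>c\<close> refers to \<open>f\<close> only through
      the facets of \<open>c\<close>, which have smaller dimension.\<close>
    assume eq: "\<And>d. (d, c) \<in> measure (cdim X) \<Longrightarrow> f d = g d"
    have "lin_ext X f (bdry X c) = lin_ext X g (bdry X c)"
      using eq X.bdry_nonzero X.facets_dim by (intro lin_ext_cong) fastforce
    then show "P f c w = P g c w" unfolding P_def by simp
  next
    fix c and f :: "'a set \<Rightarrow> 'b set \<Rightarrow> 'k"
    assume IH: "\<And>d. (d, c) \<in> measure (cdim X) \<Longrightarrow> P f d (f d)"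
    show "\<exists>w. P f c w"
    proof (cases "c \<in> cells X")
      case False then show ?thesis by (simp add: P_def)
    next
      case c: True
      have facet: "f d \<in> cell_chains Y (\<Phi> c) n" "cell_boundary Y (f d) = lin_ext X f (bdry X d)"
        "(\<Sum>v\<in>cells Y. \<theta> v * f d v) = \<eta> d"
        if "bdry X c d \<noteq> (0::'k)" "cdim X c = Suc n" for d n
      proof -
        have d: "d \<in> X.facets c" using X.bdry_nonzero[OF that(1)] by blast
        have dim: "cdim X d = n" using X.facets_dim[OF d] that(2) by simp
        have "P f d (f d)" using IH dim that(2) by simp
        moreover have "\<Phi> d \<subseteq> \<Phi> c"
          using mono[OF c X.facets_cells[OF d]] X.facets_faces[OF d] by (simp add: X.faces_def)
        ultimately show "f d \<in> cell_chains Y (\<Phi> c) n"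
          "cell_boundary Y (f d) = lin_ext X f (bdry X d)" "(\<Sum>v\<in>cells Y. \<theta> v * f d v) = \<eta> d"
          using X.facets_cells[OF d] dim by (auto simp: P_def intro: cell_chains_mono)
      qed
      let ?y = "lin_ext X f (bdry X c)"
      show ?thesis
      proof (cases "cdim X c")
        case 0
        obtain v where v: "v \<in> \<Phi> c" "cdim Y v = 0" using Y.acyclic_vertex[OF acyclic[OF c]] by blast
        then have vY: "v \<in> cells Y" using Y.subcomplex_cells[OF sub[OF c]] by blast
        \<comment> \<open>The ratio gives the vertex \<open>v\<close> exactly the augmentation of
          \<open>c\<close>, whatever their orientations.\<close>
        let ?w = "\<lambda>s. \<eta> c / \<theta> v * of_bool (s = v)"
        have w: "?w \<in> cell_chains Y (\<Phi> c) 0" using v by (simp add: in_cell_chains)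
        have "bdry X c d = (0::'k)" for d
          using X.bdry_nonzero[of c d] X.facets_dim[of d c] 0 by fastforce
        then have "?y = (\<lambda>t. 0)" by (simp add: lin_ext_def)
        moreover have "\<theta> v \<noteq> 0" using \<theta> vY v unfolding augmentation_def by blast
        then have "(\<Sum>u\<in>cells Y. \<theta> u * ?w u) = \<eta> c"
          using vY Y.finite_cells by (simp add: of_bool_def if_distrib cong: if_cong)
        ultimately have "P f c ?w" using w Y.cell_boundary_0[OF w] 0 by (simp add: P_def)
        then show ?thesis by blast
      next
        case (Suc n)
        have "?y \<in> cell_chains Y (\<Phi> c) n"
          using facet(1)[OF _ Suc] by (intro lin_ext_cell_chains)
        moreover have "cell_boundary Y ?y = (\<lambda>t. 0)"
        proof -
          have "cell_boundary Y ?y = lin_ext X (\<lambda>d. cell_boundary Y (f d)) (bdry X c)"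
            by (simp add: cell_boundary_lin_ext lin_ext_lin_ext)
          also have "\<dots> = lin_ext X (\<lambda>d. lin_ext X f (bdry X d)) (bdry X c)"
            using facet(2)[OF _ Suc] by (intro lin_ext_cong)
          also have "\<dots> = lin_ext X f (lin_ext X (bdry X) (bdry X c))"
            by (simp add: lin_ext_lin_ext)
          also have "\<dots> = (\<lambda>t. 0)" by (simp only: X.lin_ext_bdry_bdry lin_ext_zero)
          finally show ?thesis .
        qed
        \<comment> \<open>For an edge this is the condition under which a 0-cycle is a boundary:
          augmentations are respected on vertices and vanish on the boundary of the edge.\<close>
        moreover have "(\<Sum>v\<in>cells Y. \<theta> v * ?y v) = 0"
        proof -
          have "(\<Sum>v\<in>cells Y. \<theta> v * ?y v) = (\<Sum>d\<in>cells X. bdry X c d * (\<Sum>v\<in>cells Y. \<theta> v * f d v))"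
            by (rule lin_ext_functional)
          also have "\<dots> = (\<Sum>d\<in>cells X. bdry X c d * \<eta> d)"
            by (rule sum.cong) (use facet(3)[OF _ Suc] in auto)
          finally show ?thesis using X.augmentation_bdry[OF \<eta> c] by simp
        qed
        ultimately obtain w where w: "w \<in> cell_chains Y (\<Phi> c) (Suc n)" "cell_boundary Y w = ?y"
          using Y.acyclic_exact[OF sub[OF c] acyclic[OF c] \<theta>] by blast
        have "\<eta> c = 0" using \<eta> c Suc unfolding augmentation_def by fastforce
        then have "P f c w" using w Suc Y.augmentation_positive[OF \<theta> w(1)] by (simp add: P_def)
        then show ?thesis by blast
      qed
    qed
  qed simp
  then show ?thesis unfolding P_def by blast
qed

text \<open>The map \<open>u\<close> stands for the difference of two chain maps with equal
  augmentation, and \<open>h\<close> solves \<open>d h + h d = u\<close>. Everything is relative to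
  a subcomplex \<open>D\<close>, because the carrier of the homotopy is given on one piece of the
  diagram at a time.\<close>

lemma acyclic_carrier_homotopy:
  fixes \<theta> :: "'b set \<Rightarrow> 'k::field" and u :: "'a set \<Rightarrow> 'b set \<Rightarrow> 'k"
  assumes X: "finite_regular_cw X" and Y: "finite_regular_cw Y" and \<theta>: "augmentation Y \<theta>"
    and D: "subcomplex X D"
    and sub: "\<And>c. c \<in> D \<Longrightarrow> subcomplex Y (\<Phi> c)"
    and acyclic: "\<And>c. c \<in> D \<Longrightarrow> acyclic_complex TYPE('k) Y (\<Phi> c)"
    and mono: "\<And>c d. c \<in> D \<Longrightarrow> d \<in> D \<Longrightarrow> cell_face X d c \<Longrightarrow> \<Phi> d \<subseteq> \<Phi> c"
    and u: "\<And>c. c \<in> D \<Longrightarrow> u c \<in> cell_chains Y (\<Phi> c) (cdim X c)"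
      "\<And>c. c \<in> D \<Longrightarrow> cell_boundary Y (u c) = lin_ext X u (bdry X c)"
      "\<And>c. c \<in> D \<Longrightarrow> (\<Sum>v\<in>cells Y. \<theta> v * u c v) = 0"
  shows "\<exists>h :: 'a set \<Rightarrow> 'b set \<Rightarrow> 'k. \<forall>c\<in>D. h c \<in> cell_chains Y (\<Phi> c) (Suc (cdim X c)) \<and>
    cell_boundary Y (h c) = (\<lambda>t. u c t - lin_ext X h (bdry X c) t)"
proof -
  interpret X: regular_cw X by (rule regular_cw.intro[OF X])
  interpret Y: regular_cw Y by (rule regular_cw.intro[OF Y])
  define P where "P h c w \<longleftrightarrow> (c \<in> D \<longrightarrow> w \<in> cell_chains Y (\<Phi> c) (Suc (cdim X c)) \<and>
      cell_boundary Y w = (\<lambda>t. u c t - lin_ext X h (bdry X c) t))"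
    for h and c and w :: "'b set \<Rightarrow> 'k"
  have "\<exists>h. \<forall>c. P h c (h c)"
  proof (rule dependent_wf_choice[of "measure (cdim X)"])
    fix f g :: "'a set \<Rightarrow> 'b set \<Rightarrow> 'k" and c and w
    assume eq: "\<And>d. (d, c) \<in> measure (cdim X) \<Longrightarrow> f d = g d"
    have "lin_ext X f (bdry X c) = lin_ext X g (bdry X c)"
      using eq X.bdry_nonzero X.facets_dim by (intro lin_ext_cong) fastforce
    then show "P f c w = P g c w" unfolding P_def by simp
  next
    fix c and h :: "'a set \<Rightarrow> 'b set \<Rightarrow> 'k"
    assume IH: "\<And>d. (d, c) \<in> measure (cdim X) \<Longrightarrow> P h d (h d)"
    show "\<exists>w. P h c w"
    proof (cases "c \<in> D")
      case False then show ?thesis by (simp add: P_def)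
    next
      case c: True
      have facet: "h d \<in> cell_chains Y (\<Phi> c) (cdim X c)"
        "cell_boundary Y (h d) = (\<lambda>t. u d t - lin_ext X h (bdry X d) t)"
        if "bdry X c d \<noteq> (0::'k)" for d
      proof -
        have d: "d \<in> X.facets c" using X.bdry_nonzero[OF that] by blast
        have face: "cell_face X d c" using X.facets_faces[OF d] by (simp add: X.faces_def)
        have dD: "d \<in> D" using X.subcomplex_face[OF D c X.facets_cells[OF d] face] .
        have "P h d (h d)" using IH X.facets_dim[OF d] by simp
        then show "h d \<in> cell_chains Y (\<Phi> c) (cdim X c)"
          "cell_boundary Y (h d) = (\<lambda>t. u d t - lin_ext X h (bdry X d) t)"
          using dD mono[OF c dD face] X.facets_dim[OF d] by (auto simp: P_def intro: cell_chains_mono)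
      qed
      let ?l = "lin_ext X h (bdry X c)"
      let ?y = "\<lambda>t. u c t - ?l t"
      have y: "?y \<in> cell_chains Y (\<Phi> c) (cdim X c)"
        by (intro cell_chains_diff u(1) c lin_ext_cell_chains facet(1))
      \<comment> \<open>By induction \<open>d h d = u d - h d d = u d\<close>, which equals
        \<open>d u\<close>; thus \<open>u - h d\<close> takes cycles as values.\<close>
      have "cell_boundary Y ?l = lin_ext X u (bdry X c)"
      proof -
        have "cell_boundary Y ?l = lin_ext X (\<lambda>d. cell_boundary Y (h d)) (bdry X c)"
          by (simp add: cell_boundary_lin_ext lin_ext_lin_ext)
        also have "\<dots> = lin_ext X (\<lambda>d t. u d t - lin_ext X h (bdry X d) t) (bdry X c)"
          using facet(2) by (intro lin_ext_cong)
        also have "\<dots> = (\<lambda>t. lin_ext X u (bdry X c) t - lin_ext X h (lin_ext X (bdry X) (bdry X c)) t)"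
          by (simp only: lin_ext_diff_fun lin_ext_lin_ext)
        finally show ?thesis by (simp add: X.lin_ext_bdry_bdry lin_ext_zero)
      qed
      moreover have "cell_boundary Y ?y = (\<lambda>t. cell_boundary Y (u c) t - cell_boundary Y ?l t)"
        unfolding cell_boundary_lin_ext by (rule lin_ext_diff)
      ultimately have "cell_boundary Y ?y = (\<lambda>t. 0)" using u(2)[OF c] by simp
      \<comment> \<open>On a vertex the correction \<open>?l\<close> is an empty sum and
        \<open>u\<close> has augmentation zero; chains of positive degree have none.\<close>
      moreover have "(\<Sum>v\<in>cells Y. \<theta> v * ?y v) = 0"
      proof (cases "cdim X c")
        case 0
        have "bdry X c d = (0::'k)" for d
          using X.bdry_nonzero[of c d] X.facets_dim[of d c] 0 by fastforce
        then have "?l = (\<lambda>t. 0)" by (simp add: lin_ext_def)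
        then show ?thesis using u(3)[OF c] by simp
      next
        case (Suc n)
        then show ?thesis using Y.augmentation_positive[OF \<theta>] y by metis
      qed
      ultimately obtain w where "w \<in> cell_chains Y (\<Phi> c) (Suc (cdim X c))" "cell_boundary Y w = ?y"
        using Y.acyclic_exact[OF sub[OF c] acyclic[OF c] \<theta> y] by blast
      then have "P h c w" by (simp add: P_def)
      then show ?thesis by blast
    qed
  qed simp
  then show ?thesis unfolding P_def by blast
qed

section \<open>The spectral sequence of a filtered complex\<close>

definition coset :: "('s \<Rightarrow> 'k::field) set \<Rightarrow> ('s \<Rightarrow> 'k) \<Rightarrow> ('s \<Rightarrow> 'k) set" where
  "coset B x = {(\<lambda>s. x s + b s) |b. b \<in> B}"

definition vsubspace :: "('s \<Rightarrow> 'k::field) set \<Rightarrow> bool" where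
  "vsubspace B \<longleftrightarrow> (\<lambda>s. 0) \<in> B \<and> (\<forall>x\<in>B. \<forall>y\<in>B. (\<lambda>s. x s + y s) \<in> B) \<and> (\<forall>a. \<forall>x\<in>B. (\<lambda>s. a * x s) \<in> B)"

definition linear_fun :: "(('s \<Rightarrow> 'k::field) \<Rightarrow> 't \<Rightarrow> 'k) \<Rightarrow> bool" where
  "linear_fun f \<longleftrightarrow> (\<forall>x y. f (\<lambda>s. x s + y s) = (\<lambda>t. f x t + f y t)) \<and>
     (\<forall>a x. f (\<lambda>s. a * x s) = (\<lambda>t. a * f x t))"

lemma linear_funD:
  assumes "linear_fun f"
  shows "f (\<lambda>s. x s + y s) = (\<lambda>t. f x t + f y t)" "f (\<lambda>s. a * x s) = (\<lambda>t. a * f x t)"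
    "f (\<lambda>s. x s - y s) = (\<lambda>t. f x t - f y t)" "f (\<lambda>s. 0) = (\<lambda>t. 0)"
proof -
  show add: "f (\<lambda>s. x s + y s) = (\<lambda>t. f x t + f y t)" for x y
    using assms unfolding linear_fun_def by blast
  show scale: "f (\<lambda>s. a * x s) = (\<lambda>t. a * f x t)" for a x
    using assms unfolding linear_fun_def by blast
  show "f (\<lambda>s. x s - y s) = (\<lambda>t. f x t - f y t)"
    using add[of x "\<lambda>s. -1 * y s"] scale[of "-1" y] by simp
  show "f (\<lambda>s. 0) = (\<lambda>t. 0)" using scale[of 0 x] by simp
qed

lemma vsubspaceD:
  assumes "vsubspace B"
  shows "(\<lambda>s. 0) \<in> B" "x \<in> B \<Longrightarrow> y \<in> B \<Longrightarrow> (\<lambda>s. x s + y s) \<in> B"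
    "x \<in> B \<Longrightarrow> (\<lambda>s. a * x s) \<in> B" "x \<in> B \<Longrightarrow> y \<in> B \<Longrightarrow> (\<lambda>s. x s - y s) \<in> B"
proof -
  show 1: "(\<lambda>s. 0) \<in> B" "\<And>x y. x \<in> B \<Longrightarrow> y \<in> B \<Longrightarrow> (\<lambda>s. x s + y s) \<in> B"
    "\<And>a x. x \<in> B \<Longrightarrow> (\<lambda>s. a * x s) \<in> B"
    using assms unfolding vsubspace_def by blast+
  show "x \<in> B \<Longrightarrow> y \<in> B \<Longrightarrow> (\<lambda>s. x s - y s) \<in> B"
    using 1(2)[of x "\<lambda>s. -1 * y s"] 1(3)[of y "-1"] by simp
qed

lemma in_coset: "y \<in> coset B x \<longleftrightarrow> (\<lambda>s. y s - x s) \<in> B"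
proof
  assume "y \<in> coset B x"
  then show "(\<lambda>s. y s - x s) \<in> B" by (auto simp: coset_def)
next
  assume "(\<lambda>s. y s - x s) \<in> B"
  then show "y \<in> coset B x" unfolding coset_def by (intro CollectI exI[of _ "\<lambda>s. y s - x s"]) simp
qed

lemma coset_eq_iff:
  assumes "vsubspace B" shows "coset B x = coset B y \<longleftrightarrow> (\<lambda>s. x s - y s) \<in> B"
proof
  assume "coset B x = coset B y"
  moreover have "x \<in> coset B x" using vsubspaceD(1)[OF assms] by (simp add: in_coset)
  ultimately show "(\<lambda>s. x s - y s) \<in> B" by (simp add: in_coset)
next
  assume xy: "(\<lambda>s. x s - y s) \<in> B"
  have "(\<lambda>s. z s - x s) \<in> B \<longleftrightarrow> (\<lambda>s. z s - y s) \<in> B" for z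
    using vsubspaceD(2)[OF assms _ xy, of "\<lambda>s. z s - x s"] vsubspaceD(4)[OF assms _ xy, of "\<lambda>s. z s - y s"]
    by auto
  then show "coset B x = coset B y" by (auto simp: in_coset)
qed

lemma coset_self: "vsubspace B \<Longrightarrow> coset B (\<lambda>s. 0) = B"
  by (auto simp: in_coset)

lemma coset_add:
  assumes "vsubspace B"
  shows "{(\<lambda>s. x s + y s) |x y. x \<in> coset B u \<and> y \<in> coset B v} = coset B (\<lambda>s. u s + v s)"
proof (intro equalityI subsetI)
  fix z assume "z \<in> {(\<lambda>s. x s + y s) |x y. x \<in> coset B u \<and> y \<in> coset B v}"
  then obtain x y where z: "z = (\<lambda>s. x s + y s)" "(\<lambda>s. x s - u s) \<in> B" "(\<lambda>s. y s - v s) \<in> B"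
    by (auto simp: in_coset)
  then show "z \<in> coset B (\<lambda>s. u s + v s)"
    using vsubspaceD(2)[OF assms z(2,3)] by (simp add: in_coset algebra_simps)
next
  fix z assume "z \<in> coset B (\<lambda>s. u s + v s)"
  then have "(\<lambda>s. (z s - v s) - u s) \<in> B" by (simp add: in_coset algebra_simps)
  then have "(\<lambda>s. z s - v s) \<in> coset B u" "v \<in> coset B v"
    using vsubspaceD(1)[OF assms] by (simp_all add: in_coset)
  then show "z \<in> {(\<lambda>s. x s + y s) |x y. x \<in> coset B u \<and> y \<in> coset B v}"
    by (intro CollectI exI[of _ "\<lambda>s. z s - v s"] exI[of _ v]) simp
qed

lemma coset_image:
  assumes f: "linear_fun f" and B: "vsubspace B" and B': "vsubspace B'" and "\<And>b. b \<in> B \<Longrightarrow> f b \<in> B'"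
  shows "induced_map B' f (coset B x) = coset B' (f x)"
  unfolding induced_map_def
proof (intro equalityI subsetI)
  fix z assume "z \<in> {(\<lambda>t. f y t + b t) |y b. y \<in> coset B x \<and> b \<in> B'}"
  then obtain y b where z: "z = (\<lambda>t. f y t + b t)" "(\<lambda>s. y s - x s) \<in> B" "b \<in> B'"
    by (auto simp: in_coset)
  have "(\<lambda>t. f y t - f x t) \<in> B'" using assms(4)[OF z(2)] linear_funD(3)[OF f] by simp
  then show "z \<in> coset B' (f x)"
    using vsubspaceD(2)[OF B' _ z(3)] z(1) by (fastforce simp: in_coset algebra_simps)
next
  fix z assume z: "z \<in> coset B' (f x)"
  have "x \<in> coset B x" using vsubspaceD(1)[OF B] by (simp add: in_coset)
  then show "z \<in> {(\<lambda>t. f y t + b t) |y b. y \<in> coset B x \<and> b \<in> B'}"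
    using z by (intro CollectI exI[of _ x] exI[of _ "\<lambda>s. z s - f x s"]) (simp add: in_coset)
qed

lemma quotient_carrier: "carrier (quotient_module Z B) = coset B ` Z"
  by (auto simp: quotient_module_def coset_def)

lemma quotient_zero: "\<zero>\<^bsub>quotient_module Z B\<^esub> = B"
  by (simp add: quotient_module_def)

lemma quotient_add:
  assumes "vsubspace B"
  shows "coset B u \<oplus>\<^bsub>quotient_module Z B\<^esub> coset B v = coset B (\<lambda>s. u s + v s)"
  using coset_add[OF assms] by (simp add: quotient_module_def)

lemma quotient_smult:
  assumes "vsubspace B"
  shows "a \<odot>\<^bsub>quotient_module Z B\<^esub> coset B u = coset B (\<lambda>s. a * u s)"
proof -
  have "linear_fun (\<lambda>x s. a * x s)" by (simp add: linear_fun_def algebra_simps)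
  from coset_image[OF this assms assms vsubspaceD(3)[OF assms], of u]
  show ?thesis by (simp add: quotient_module_def induced_map_def)
qed

lemma linear_map_induced:
  assumes f: "linear_fun f" and B: "vsubspace B" "vsubspace B'" "\<And>b. b \<in> B \<Longrightarrow> f b \<in> B'"
    and Z: "\<And>z. z \<in> Z \<Longrightarrow> f z \<in> Z'"
  shows "linear_map (quotient_module Z B) (quotient_module Z' B') (induced_map B' f)"
  unfolding linear_map_def quotient_carrier
  using Z by (auto simp: coset_image[OF f B] quotient_add[OF B(1)] quotient_add[OF B(2)]
      quotient_smult[OF B(1)] quotient_smult[OF B(2)] linear_funD[OF f])

section \<open>Pages of an arbitrary filtered complex\<close>

definition fc_cycles ::
    "(int \<Rightarrow> int \<Rightarrow> ('s \<Rightarrow> 'k::field) set) \<Rightarrow> (('s \<Rightarrow> 'k) \<Rightarrow> 's \<Rightarrow> 'k) \<Rightarrow> int \<Rightarrow> int \<Rightarrow> int \<Rightarrow> ('s \<Rightarrow> 'k) set" where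
  "fc_cycles F d n p q = {x \<in> F p (p + q). d x \<in> F (p - n) (p + q - 1)}"

definition fc_boundaries ::
    "(int \<Rightarrow> int \<Rightarrow> ('s \<Rightarrow> 'k::field) set) \<Rightarrow> (('s \<Rightarrow> 'k) \<Rightarrow> 's \<Rightarrow> 'k) \<Rightarrow> int \<Rightarrow> int \<Rightarrow> int \<Rightarrow> ('s \<Rightarrow> 'k) set" where
  "fc_boundaries F d n p q =
     {(\<lambda>s. z s + d w s) |z w. z \<in> fc_cycles F d (n - 1) (p - 1) (q + 1) \<and>
        w \<in> fc_cycles F d (n - 1) (p + n - 1) (q - n + 2)}"

definition fc_spectral_sequence ::
    "(int \<Rightarrow> int \<Rightarrow> ('s \<Rightarrow> 'k::field) set) \<Rightarrow> (('s \<Rightarrow> 'k) \<Rightarrow> 's \<Rightarrow> 'k) \<Rightarrow> ('k, ('s \<Rightarrow> 'k) set) spectral_sequence" where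
  "fc_spectral_sequence F d =
     \<lparr>page = (\<lambda>n p q. quotient_module (fc_cycles F d (int n) p q) (fc_boundaries F d (int n) p q)),
      page_diff = (\<lambda>n p q. induced_map (fc_boundaries F d (int n) (p - int n) (q + int n - 1)) d),
      next_page = (\<lambda>n p q P.
        induced_map (fc_boundaries F d (int n + 1) p q) (\<lambda>x. x) (P \<inter> fc_cycles F d (int n + 1) p q))\<rparr>"

text \<open>\<open>F p k\<close> is the part of total degree \<open>k\<close> in the
  \<open>p\<close>-th filtration step.\<close>

locale filtered_complex =
  fixes F :: "int \<Rightarrow> int \<Rightarrow> ('s \<Rightarrow> 'k::field) set" and d :: "('s \<Rightarrow> 'k) \<Rightarrow> 's \<Rightarrow> 'k"
  assumes vsubspace_F: "vsubspace (F p k)"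
    and F_mono: "p \<le> p' \<Longrightarrow> F p k \<subseteq> F p' k"
    and linear_d: "linear_fun d"
    and d_F: "x \<in> F p k \<Longrightarrow> d x \<in> F p (k - 1)"
    and d_d: "x \<in> F p k \<Longrightarrow> d (d x) = (\<lambda>s. 0)"
begin

abbreviation "Z \<equiv> fc_cycles F d"
abbreviation "B \<equiv> fc_boundaries F d"

lemma in_Z: "x \<in> Z n p q \<longleftrightarrow> x \<in> F p (p + q) \<and> d x \<in> F (p - n) (p + q - 1)"
  by (simp add: fc_cycles_def)

lemma vsubspace_Z: "vsubspace (Z n p q)"
  using vsubspaceD[OF vsubspace_F] by (simp add: vsubspace_def in_Z linear_funD[OF linear_d])

lemma BI:
  "z \<in> Z (n - 1) (p - 1) (q + 1) \<Longrightarrow> w \<in> Z (n - 1) (p + n - 1) (q - n + 2) \<Longrightarrow>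
     (\<lambda>s. z s + d w s) \<in> B n p q"
  unfolding fc_boundaries_def by blast

lemma BE:
  assumes "u \<in> B n p q"
  obtains z w where "u = (\<lambda>s. z s + d w s)" "z \<in> Z (n - 1) (p - 1) (q + 1)"
    "w \<in> Z (n - 1) (p + n - 1) (q - n + 2)"
  using assms unfolding fc_boundaries_def by blast

lemma vsubspace_B: "vsubspace (B n p q)"
  unfolding vsubspace_def
proof (intro conjI ballI allI)
  show "(\<lambda>s. 0) \<in> B n p q"
    using BI[OF vsubspaceD(1)[OF vsubspace_Z] vsubspaceD(1)[OF vsubspace_Z]]
    by (simp add: linear_funD(4)[OF linear_d])
next
  fix x y assume "x \<in> B n p q" "y \<in> B n p q"
  then obtain z w z' w' where *: "x = (\<lambda>s. z s + d w s)" "y = (\<lambda>s. z' s + d w' s)"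
    "z \<in> Z (n - 1) (p - 1) (q + 1)" "w \<in> Z (n - 1) (p + n - 1) (q - n + 2)"
    "z' \<in> Z (n - 1) (p - 1) (q + 1)" "w' \<in> Z (n - 1) (p + n - 1) (q - n + 2)"
    by (elim BE)
  show "(\<lambda>s. x s + y s) \<in> B n p q"
    using BI[OF vsubspaceD(2)[OF vsubspace_Z *(3,5)] vsubspaceD(2)[OF vsubspace_Z *(4,6)]]
    by (simp add: *(1,2) linear_funD(1)[OF linear_d] algebra_simps)
next
  fix a x assume "x \<in> B n p q"
  then obtain z w where *: "x = (\<lambda>s. z s + d w s)"
    "z \<in> Z (n - 1) (p - 1) (q + 1)" "w \<in> Z (n - 1) (p + n - 1) (q - n + 2)"
    by (elim BE)
  show "(\<lambda>s. a * x s) \<in> B n p q"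
    using BI[OF vsubspaceD(3)[OF vsubspace_Z *(2), of a] vsubspaceD(3)[OF vsubspace_Z *(3), of a]]
    by (simp add: *(1) linear_funD(2)[OF linear_d] algebra_simps)
qed

lemma Z_sub_B: "Z (n - 1) (p - 1) (q + 1) \<subseteq> B n p q"
proof
  fix z assume "z \<in> Z (n - 1) (p - 1) (q + 1)"
  from BI[OF this vsubspaceD(1)[OF vsubspace_Z]] show "z \<in> B n p q"
    by (simp add: linear_funD(4)[OF linear_d])
qed

lemma B_sub_Z: "B n p q \<subseteq> Z n p q"
proof
  fix u assume "u \<in> B n p q"
  then obtain z w where *: "u = (\<lambda>s. z s + d w s)"
    "z \<in> Z (n - 1) (p - 1) (q + 1)" "w \<in> Z (n - 1) (p + n - 1) (q - n + 2)"
    by (elim BE)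
  have z: "z \<in> F p (p + q)" "d z \<in> F (p - n) (p + q - 1)"
    using *(2) F_mono[of "p - 1" p] by (auto simp: in_Z)
  have w: "w \<in> F (p + n - 1) (p + q + 1)" "d w \<in> F p (p + q)"
    using *(3) by (auto simp: in_Z algebra_simps)
  show "u \<in> Z n p q"
    using vsubspaceD(2)[OF vsubspace_F z(1) w(2)] z(2)
    by (simp add: in_Z *(1) linear_funD(1)[OF linear_d] d_d[OF w(1)])
qed

lemma d_B: assumes "x \<in> B n p q" shows "d x \<in> B n (p - n) (q + n - 1)"
proof -
  obtain z w where *: "x = (\<lambda>s. z s + d w s)"
    "z \<in> Z (n - 1) (p - 1) (q + 1)" "w \<in> Z (n - 1) (p + n - 1) (q - n + 2)"
    using assms by (elim BE)
  have w: "w \<in> F (p + n - 1) (p + q + 1)" using *(3) by (auto simp: in_Z algebra_simps)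
  have "d x = (\<lambda>s. 0 + d z s)" by (simp add: *(1) linear_funD(1)[OF linear_d] d_d[OF w])
  \<comment> \<open>The first component \<open>z\<close> of \<open>x\<close> reappears as the chain
    under \<open>d\<close>: the shifted indices \<open>(p - n) + n - 1\<close> and
    \<open>(q + n - 1) - n + 2\<close> are its own.\<close>
  moreover have "(\<lambda>s. 0 + d z s) \<in> B n (p - n) (q + n - 1)"
    by (rule BI) (use vsubspaceD(1)[OF vsubspace_Z] *(2) in \<open>simp_all add: algebra_simps\<close>)
  ultimately show ?thesis by simp
qed

text \<open>Since \<open>d u = d z\<close>, a cycle of the next page forces \<open>d z\<close> one
  step lower, so \<open>z\<close> is admissible for the next page too. This makes
  \<open>next_page\<close> independent of the representative.\<close>

lemma B_inter_Z: assumes "u \<in> B n p q" "u \<in> Z (n + 1) p q" shows "u \<in> B (n + 1) p q"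
proof -
  obtain z w where *: "u = (\<lambda>s. z s + d w s)"
    "z \<in> Z (n - 1) (p - 1) (q + 1)" "w \<in> Z (n - 1) (p + n - 1) (q - n + 2)"
    using assms(1) by (elim BE)
  have w: "w \<in> F (p + n - 1) (p + q + 1)" "d w \<in> F p (p + q)"
    using *(3) by (auto simp: in_Z algebra_simps)
  have "d u = d z" by (simp add: *(1) linear_funD(1)[OF linear_d] d_d[OF w(1)])
  then have "z \<in> Z n (p - 1) (q + 1)"
    using assms(2) *(2) by (simp add: in_Z algebra_simps)
  moreover have "w \<in> Z n (p + n) (q - n + 1)"
    using w F_mono[of "p + n - 1" "p + n"] by (auto simp: in_Z algebra_simps)
  ultimately show ?thesis
    unfolding *(1) by (intro BI) (simp_all add: algebra_simps)
qed

text \<open>If the page differential vanishes, \<open>d x = z + d w\<close> with \<open>w\<close>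
  itself a page boundary. Subtracting \<open>w\<close> keeps the class and leaves the boundary
  \<open>z\<close>, which lies one filtration step lower.\<close>

lemma lift_next_page:
  assumes x: "x \<in> Z n p q" and dx: "d x \<in> B n (p - n) (q + n - 1)"
  shows "\<exists>y\<in>Z (n + 1) p q. (\<lambda>s. y s - x s) \<in> B n p q"
proof -
  obtain z w where *: "d x = (\<lambda>s. z s + d w s)" "z \<in> Z (n - 1) (p - n - 1) (q + n)"
    "w \<in> Z (n - 1) (p - 1) (q + 1)"
    using dx by (elim BE) (simp add: algebra_simps)
  have wB: "w \<in> B n p q" using Z_sub_B *(3) by blast
  let ?y = "\<lambda>s. x s - w s"
  have w: "w \<in> F p (p + q)" using subsetD[OF B_sub_Z wB] by (simp add: in_Z)
  have "d ?y = z" by (simp add: linear_funD(3)[OF linear_d] *(1))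
  moreover have "z \<in> F (p - (n + 1)) (p + q - 1)" using *(2) by (simp add: in_Z algebra_simps)
  ultimately have "?y \<in> Z (n + 1) p q"
    using vsubspaceD(4)[OF vsubspace_F _ w] x by (simp add: in_Z)
  moreover have "(\<lambda>s. ?y s - x s) \<in> B n p q"
    using vsubspaceD(3)[OF vsubspace_B wB, of "-1"] by simp
  ultimately show ?thesis by (intro bexI[of _ ?y])
qed

text \<open>The page boundaries allow \<open>w\<close> in \<open>F_{p+n-1}\<close>, which contains
  \<open>F_p\<close> once \<open>n \<ge> 1\<close>. The chain \<open>z\<close> is admissible because
  \<open>d z = d u\<close> and \<open>u\<close> is a page cycle.\<close>

lemma homotopic_zero:
  assumes "1 \<le> n" "u \<in> Z n p q" "z \<in> F (p - 1) (p + q)" "w \<in> F p (p + q + 1)"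
    and u: "u = (\<lambda>s. z s + d w s)"
  shows "u \<in> B n p q"
  unfolding u
proof (rule BI)
  have "d u = d z" by (simp add: u linear_funD(1)[OF linear_d] d_d[OF assms(4)])
  then show "z \<in> Z (n - 1) (p - 1) (q + 1)" using assms(2,3) by (simp add: in_Z algebra_simps)
  \<comment> \<open>The bound on \<open>d w\<close> is \<open>(p + n - 1) - (n - 1) = p\<close>, so
    \<open>w \<in> F_p\<close> suffices.\<close>
  show "w \<in> Z (n - 1) (p + n - 1) (q - n + 2)"
    using F_mono[of p "p + n - 1"] assms(1,4) d_F[OF assms(4)] by (auto simp: in_Z algebra_simps)
qed

lemma next_page_coset:
  assumes "x \<in> Z n p q" "y \<in> Z (n + 1) p q" "(\<lambda>s. y s - x s) \<in> B n p q"
  shows "induced_map (B (n + 1) p q) (\<lambda>x. x) (coset (B n p q) x \<inter> Z (n + 1) p q) = coset (B (n + 1) p q) y"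
    (is "?l = ?r")
proof (intro equalityI subsetI)
  fix u assume "u \<in> ?l"
  then obtain v b where v: "u = (\<lambda>s. v s + b s)" "(\<lambda>s. v s - x s) \<in> B n p q" "v \<in> Z (n + 1) p q"
    "b \<in> B (n + 1) p q"
    by (auto simp: induced_map_def in_coset)
  have "(\<lambda>s. v s - y s) \<in> B n p q" using vsubspaceD(4)[OF vsubspace_B v(2) assms(3)] by simp
  then have "(\<lambda>s. v s - y s) \<in> B (n + 1) p q"
    using vsubspaceD(4)[OF vsubspace_Z v(3) assms(2)] by (rule B_inter_Z)
  from vsubspaceD(2)[OF vsubspace_B this v(4)] show "u \<in> ?r"
    by (simp add: v(1) in_coset algebra_simps)
next
  fix u assume "u \<in> ?r"
  then show "u \<in> ?l"
    using assms(2,3) unfolding induced_map_def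
    by (intro CollectI exI[of _ y] exI[of _ "\<lambda>s. u s - y s"]) (simp add: in_coset)
qed

end

section \<open>Morphisms induced by filtered maps\<close>

locale filtered_map = S: filtered_complex F d + T: filtered_complex G e
  for F :: "int \<Rightarrow> int \<Rightarrow> ('s \<Rightarrow> 'k::field) set" and d
    and G :: "int \<Rightarrow> int \<Rightarrow> ('t \<Rightarrow> 'k) set" and e +
  fixes \<phi> :: "('s \<Rightarrow> 'k) \<Rightarrow> 't \<Rightarrow> 'k"
  assumes linear: "linear_fun \<phi>"
    and map_F: "x \<in> F p k \<Longrightarrow> \<phi> x \<in> G p k"
    and commute: "x \<in> F p k \<Longrightarrow> \<phi> (d x) = e (\<phi> x)"
begin

lemma map_Z: "x \<in> S.Z n p q \<Longrightarrow> \<phi> x \<in> T.Z n p q"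
  unfolding S.in_Z T.in_Z using map_F commute by metis

lemma map_B: assumes "x \<in> S.B n p q" shows "\<phi> x \<in> T.B n p q"
proof -
  obtain z w where *: "x = (\<lambda>s. z s + d w s)"
    "z \<in> S.Z (n - 1) (p - 1) (q + 1)" "w \<in> S.Z (n - 1) (p + n - 1) (q - n + 2)"
    using assms by (elim S.BE)
  have w: "w \<in> F (p + n - 1) (p + q + 1)" using *(3) by (auto simp: S.in_Z algebra_simps)
  have "\<phi> x = (\<lambda>s. \<phi> z s + e (\<phi> w) s)"
    by (simp add: *(1) linear_funD(1)[OF linear] commute[OF w])
  then show ?thesis using T.BI[OF map_Z[OF *(2)] map_Z[OF *(3)]] by simp
qed

lemma induced_coset: "induced_map (T.B n p q) \<phi> (coset (S.B n p q) x) = coset (T.B n p q) (\<phi> x)"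
  by (rule coset_image[OF linear S.vsubspace_B T.vsubspace_B map_B])

lemma ss_morphism_induced:
  "ss_morphism n (fc_spectral_sequence F d) (fc_spectral_sequence G e)
     (\<lambda>m p q. induced_map (T.B (int m) p q) \<phi>)"
  unfolding ss_morphism_def
proof (intro allI impI conjI ballI)
  fix m p q
  show "linear_map (page (fc_spectral_sequence F d) m p q) (page (fc_spectral_sequence G e) m p q)
     (induced_map (T.B (int m) p q) \<phi>)"
    unfolding fc_spectral_sequence_def spectral_sequence.simps
    by (rule linear_map_induced[OF linear S.vsubspace_B T.vsubspace_B map_B map_Z])
next
  fix m p q P
  assume "P \<in> carrier (page (fc_spectral_sequence F d) m p q)"
  then obtain x where x: "x \<in> S.Z (int m) p q" "P = coset (S.B (int m) p q) x"
    by (auto simp: fc_spectral_sequence_def quotient_carrier)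
  have dS: "page_diff (fc_spectral_sequence F d) m p q P = coset (S.B (int m) (p - int m) (q + int m - 1)) (d x)"
    unfolding fc_spectral_sequence_def spectral_sequence.simps x(2)
    by (rule coset_image[OF S.linear_d S.vsubspace_B S.vsubspace_B S.d_B])
  have dT: "page_diff (fc_spectral_sequence G e) m p q (induced_map (T.B (int m) p q) \<phi> P)
      = coset (T.B (int m) (p - int m) (q + int m - 1)) (e (\<phi> x))"
    unfolding fc_spectral_sequence_def spectral_sequence.simps x(2) induced_coset
    by (rule coset_image[OF T.linear_d T.vsubspace_B T.vsubspace_B T.d_B])
  have com: "\<phi> (d x) = e (\<phi> x)" using x(1) by (auto simp: S.in_Z commute)
  show "induced_map (T.B (int m) (p - int m) (q + int m - 1)) \<phi> (page_diff (fc_spectral_sequence F d) m p q P)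
     = page_diff (fc_spectral_sequence G e) m p q (induced_map (T.B (int m) p q) \<phi> P)"
    unfolding dS dT induced_coset com ..
  assume "page_diff (fc_spectral_sequence F d) m p q P =
    \<zero>\<^bsub>page (fc_spectral_sequence F d) m (p - int m) (q + int m - 1)\<^esub>"
  then have "coset (S.B (int m) (p - int m) (q + int m - 1)) (d x) = S.B (int m) (p - int m) (q + int m - 1)"
    unfolding dS by (simp add: fc_spectral_sequence_def quotient_zero)
  then have "d x \<in> S.B (int m) (p - int m) (q + int m - 1)"
    using coset_eq_iff[OF S.vsubspace_B, of _ _ _ "d x" "\<lambda>s. 0"]
    by (simp add: coset_self[OF S.vsubspace_B])
  \<comment> \<open>A representative that survives to the next page maps to one that survives, so
    both next-page maps are evaluated on \<open>y\<close> and \<open>\<phi> y\<close>.\<close>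
  from S.lift_next_page[OF x(1) this] obtain y where y: "y \<in> S.Z (int m + 1) p q"
    "(\<lambda>s. y s - x s) \<in> S.B (int m) p q" by blast
  have "(\<lambda>t. \<phi> y t - \<phi> x t) \<in> T.B (int m) p q"
    using map_B[OF y(2)] by (simp add: linear_funD(3)[OF linear])
  then have "next_page (fc_spectral_sequence G e) m p q (induced_map (T.B (int m) p q) \<phi> P)
      = coset (T.B (int m + 1) p q) (\<phi> y)"
    unfolding x(2) induced_coset fc_spectral_sequence_def spectral_sequence.simps
    by (rule T.next_page_coset[OF map_Z[OF x(1)] map_Z[OF y(1)]])
  moreover have "next_page (fc_spectral_sequence F d) m p q P = coset (S.B (int m + 1) p q) y"
    unfolding x(2) fc_spectral_sequence_def spectral_sequence.simps
    by (rule S.next_page_coset[OF x(1) y])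
  ultimately show "induced_map (T.B (int (m + 1)) p q) \<phi> (next_page (fc_spectral_sequence F d) m p q P)
     = next_page (fc_spectral_sequence G e) m p q (induced_map (T.B (int m) p q) \<phi> P)"
    using induced_coset[of "int m + 1" p q y] by (simp add: add.commute)
qed

end

section \<open>The double complex of a diagram\<close>

definition face_coeff :: "'i::linorder set set \<Rightarrow> 'i set \<Rightarrow> 'i set \<Rightarrow> 'k::field" where
  "face_coeff K \<tau> \<sigma> =
     (if \<tau> \<in> K then \<Sum>v\<in>\<sigma>. if \<sigma> - {v} = \<tau> then (-1) ^ card {j \<in> \<sigma>. j < v} else 0 else 0)"

text \<open>As a matrix acting on simplices alone, the horizontal differential commutes with
  operations on cells by exchanging two sums.\<close>

lemma dc_horizontal_altdef:
  "dc_horizontal K x (\<tau>, c) = (\<Sum>\<sigma>\<in>K. face_coeff K \<tau> \<sigma> * x (\<sigma>, c))"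
  by (auto simp: dc_horizontal_def face_coeff_def sum_distrib_right intro!: sum.cong)

lemma face_coeff_nonzero:
  assumes "face_coeff K \<tau> \<sigma> \<noteq> (0::'k::field)"
  shows "\<tau> \<in> K" "\<exists>v\<in>\<sigma>. \<tau> = \<sigma> - {v}"
proof -
  show "\<tau> \<in> K" using assms by (auto simp: face_coeff_def split: if_splits)
  show "\<exists>v\<in>\<sigma>. \<tau> = \<sigma> - {v}"
  proof (rule ccontr)
    assume "\<not> ?thesis"
    then have "(\<Sum>v\<in>\<sigma>. if \<sigma> - {v} = \<tau> then (-1) ^ card {j \<in> \<sigma>. j < v} else 0) = (0::'k)"
      by (intro sum.neutral) auto
    then show False using assms by (simp add: face_coeff_def split: if_splits)
  qed
qed

text \<open>The pairs are matched explicitly, as \<open>S = - S\<close> does not give \<open>S = 0\<close> in characteristic two.\<close>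

lemma sum_antisymmetric:
  fixes T :: "'i::linorder \<Rightarrow> 'i \<Rightarrow> 'k::ab_group_add"
  assumes "finite S" "\<And>v w. v \<in> S \<Longrightarrow> w \<in> S \<Longrightarrow> v < w \<Longrightarrow> T w v = - T v w"
  shows "(\<Sum>v\<in>S. \<Sum>w\<in>S - {v}. T v w) = 0"
proof -
  have "(\<Sum>w\<in>S - {v}. T v w) =
      (\<Sum>w\<in>S. if v < w then T v w else 0) + (\<Sum>w\<in>S. if w < v then T v w else 0)" for v
  proof -
    have "(\<Sum>w\<in>S - {v}. T v w) = (\<Sum>w\<in>S. if w \<noteq> v then T v w else 0)"
      using assms(1) by (simp add: sum.If_cases Diff_eq Compl_eq)
    also have "\<dots> = (\<Sum>w\<in>S. (if v < w then T v w else 0) + (if w < v then T v w else 0))"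
      by (intro sum.cong) auto
    finally show ?thesis by (simp add: sum.distrib)
  qed
  then have "(\<Sum>v\<in>S. \<Sum>w\<in>S - {v}. T v w) = (\<Sum>v\<in>S. \<Sum>w\<in>S. if v < w then T v w else 0)
      + (\<Sum>v\<in>S. \<Sum>w\<in>S. if w < v then T v w else 0)"
    by (simp add: sum.distrib)
  also have "(\<Sum>v\<in>S. \<Sum>w\<in>S. if w < v then T v w else 0) = (\<Sum>w\<in>S. \<Sum>v\<in>S. if w < v then T v w else 0)"
    by (rule sum.swap)
  also have "\<dots> = (\<Sum>w\<in>S. \<Sum>v\<in>S. - (if w < v then T w v else 0))"
    using assms(2) by (intro sum.cong) auto
  finally show ?thesis by (simp add: sum_negf)
qed

text \<open>Deleting the later vertex \<open>w\<close> leaves the position of \<open>v\<close>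
  unchanged, whereas deleting \<open>v\<close> lowers the position of \<open>w\<close> by
  one.\<close>

lemma vertex_sign_swap:
  fixes \<sigma> :: "'i::linorder set"
  assumes "finite \<sigma>" "v \<in> \<sigma>" "w \<in> \<sigma>" "v < w"
  defines "s \<equiv> \<lambda>\<sigma> v. (-1) ^ card {j \<in> \<sigma>. j < v} :: 'k::field"
  shows "s \<sigma> w * s (\<sigma> - {w}) v = - (s \<sigma> v * s (\<sigma> - {v}) w)"
proof -
  have "{j \<in> \<sigma> - {w}. j < v} = {j \<in> \<sigma>. j < v}"
    using assms(4) by (intro Collect_cong) (auto dest: order.asym)
  moreover have "{j \<in> \<sigma>. j < w} = insert v {j \<in> \<sigma> - {v}. j < w}"
    using assms(2,4) by (intro equalityI subsetI) auto
  then have "card {j \<in> \<sigma>. j < w} = Suc (card {j \<in> \<sigma> - {v}. j < w})"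
    using assms(1) by simp
  ultimately show ?thesis by (simp add: s_def)
qed

section \<open>The total complex and its filtration\<close>

locale cw_diagram = regular_cw X for X :: "'a cw" +
  fixes K :: "'i::linorder set set" and D :: "'i set \<Rightarrow> real \<Rightarrow> 'a set set"
  assumes finite_K: "finite K"
    and simplex: "\<sigma> \<in> K \<Longrightarrow> finite \<sigma> \<and> \<sigma> \<noteq> {}"
    and face_in_K: "\<sigma> \<in> K \<Longrightarrow> \<tau> \<subseteq> \<sigma> \<Longrightarrow> \<tau> \<noteq> {} \<Longrightarrow> \<tau> \<in> K"
    and D_subcomplex: "\<sigma> \<in> K \<Longrightarrow> subcomplex X (D \<sigma> r)"
    and D_antimono: "\<tau> \<subseteq> \<sigma> \<Longrightarrow> D \<sigma> r \<subseteq> D \<tau> r"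
    and D_mono: "r \<le> s \<Longrightarrow> D \<sigma> r \<subseteq> D \<sigma> s"
begin

lemma face_coeff_dim:
  assumes "face_coeff K \<tau> \<sigma> \<noteq> (0::'k::field)" "\<sigma> \<in> K"
  shows "card \<sigma> = card \<tau> + 1" "1 \<le> card \<tau>" "\<tau> \<subseteq> \<sigma>"
proof -
  obtain v where v: "v \<in> \<sigma>" "\<tau> = \<sigma> - {v}" using face_coeff_nonzero(2)[OF assms(1)] by blast
  then show "\<tau> \<subseteq> \<sigma>" by blast
  show "card \<sigma> = card \<tau> + 1"
    using card_Suc_Diff1[OF conjunct1[OF simplex[OF assms(2)]] v(1)] unfolding v(2) by linarith
  show "1 \<le> card \<tau>"
    using simplex[OF face_coeff_nonzero(1)[OF assms(1)]] by (simp add: Suc_le_eq card_gt_0_iff)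
qed

text \<open>The sum is rewritten over ordered pairs of deleted vertices, where the two orders of
  deletion carry opposite signs.\<close>

lemma face_coeff_face_coeff:
  assumes \<sigma>: "\<sigma> \<in> K"
  shows "(\<Sum>\<tau>\<in>K. face_coeff K \<rho> \<tau> * face_coeff K \<tau> \<sigma>) = (0 :: 'k::field)"
proof (cases "\<rho> \<in> K")
  case False
  then show ?thesis by (simp add: face_coeff_def)
next
  case True
  let ?s = "\<lambda>\<sigma> v. (-1) ^ card {j \<in> \<sigma>. j < v} :: 'k"
  let ?A = "\<lambda>\<tau>. face_coeff K \<rho> \<tau> :: 'k"
  have fin: "finite \<sigma>" using simplex[OF \<sigma>] by blast
  have 1: "?A \<tau> = (\<Sum>w\<in>\<tau>. if \<tau> - {w} = \<rho> then ?s \<tau> w else 0)" for \<tau>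
    using True by (simp add: face_coeff_def)
  have 2: "(if \<sigma> - {v} \<in> K then ?A (\<sigma> - {v}) * ?s \<sigma> v else 0) = ?A (\<sigma> - {v}) * ?s \<sigma> v" for v
  proof (cases "\<sigma> - {v} = {}")
    case True
    have "?A (\<sigma> - {v}) = 0" unfolding 1 unfolding True by simp
    then show ?thesis by simp
  next
    case False
    then show ?thesis using face_in_K[OF \<sigma>, of "\<sigma> - {v}"] by auto
  qed
  have "(\<Sum>\<tau>\<in>K. ?A \<tau> * face_coeff K \<tau> \<sigma>) =
      (\<Sum>\<tau>\<in>K. \<Sum>v\<in>\<sigma>. if \<tau> = \<sigma> - {v} then ?A \<tau> * ?s \<sigma> v else 0)"
    by (intro sum.cong refl) (auto simp: face_coeff_def[of K _ \<sigma>] sum_distrib_left intro!: sum.cong)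
  also have "\<dots> = (\<Sum>v\<in>\<sigma>. \<Sum>\<tau>\<in>K. if \<tau> = \<sigma> - {v} then ?A \<tau> * ?s \<sigma> v else 0)"
    by (rule sum.swap)
  also have "\<dots> = (\<Sum>v\<in>\<sigma>. ?A (\<sigma> - {v}) * ?s \<sigma> v)"
    using finite_K by (simp add: 2)
  also have "\<dots> = (\<Sum>v\<in>\<sigma>. \<Sum>w\<in>\<sigma> - {v}. if \<sigma> - {v} - {w} = \<rho> then ?s \<sigma> v * ?s (\<sigma> - {v}) w else 0)"
    unfolding 1 sum_distrib_right by (intro sum.cong refl) (simp add: mult.commute)
  also have "\<dots> = 0"
  proof (rule sum_antisymmetric[OF fin])
    fix v w assume vw: "v \<in> \<sigma>" "w \<in> \<sigma>" "v < w"
    have "\<sigma> - {w} - {v} = \<sigma> - {v} - {w}" by blast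
    then show "(if \<sigma> - {w} - {v} = \<rho> then ?s \<sigma> w * ?s (\<sigma> - {w}) v else 0) =
        - (if \<sigma> - {v} - {w} = \<rho> then ?s \<sigma> v * ?s (\<sigma> - {v}) w else 0)"
      using vertex_sign_swap[OF fin vw, where ?'k = 'k] by simp
  qed
  finally show ?thesis .
qed

lemma horizontal_horizontal: "dc_horizontal K (dc_horizontal K x) s = (0 :: 'k::field)"
proof (cases s)
  case (Pair \<rho> c)
  have "dc_horizontal K (dc_horizontal K x) (\<rho>, c) =
      (\<Sum>\<tau>\<in>K. \<Sum>\<sigma>\<in>K. face_coeff K \<rho> \<tau> * face_coeff K \<tau> \<sigma> * x (\<sigma>, c))"
    by (simp add: dc_horizontal_altdef sum_distrib_left mult.assoc)
  also have "\<dots> = (\<Sum>\<sigma>\<in>K. \<Sum>\<tau>\<in>K. face_coeff K \<rho> \<tau> * face_coeff K \<tau> \<sigma> * x (\<sigma>, c))"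
    by (rule sum.swap)
  also have "\<dots> = (\<Sum>\<sigma>\<in>K. (\<Sum>\<tau>\<in>K. face_coeff K \<rho> \<tau> * face_coeff K \<tau> \<sigma>) * x (\<sigma>, c))"
    by (simp add: sum_distrib_right)
  also have "\<dots> = 0" by (intro sum.neutral ballI) (simp add: face_coeff_face_coeff)
  finally show ?thesis using Pair by simp
qed

lemma vertical_vertical: "dc_vertical X (dc_vertical X x) s = (0 :: 'k::field)"
proof (cases s)
  case (Pair \<sigma> c)
  have "cell_boundary X (\<lambda>e. dc_vertical X x (\<sigma>, e)) =
      (\<lambda>e. (-1) ^ (card \<sigma> - 1) * cell_boundary X (cell_boundary X (\<lambda>e. x (\<sigma>, e))) e)"
    by (simp add: dc_vertical_def cell_boundary_lin_ext lin_ext_scale)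
  then show ?thesis using Pair by (simp add: dc_vertical_def cell_boundary_cell_boundary)
qed

text \<open>Passing to a face lowers \<open>card\<close> by one, which flips the sign of the
  vertical differential; up to that sign the two differentials commute.\<close>

lemma vertical_horizontal:
  "dc_vertical X (dc_horizontal K x) s + dc_horizontal K (dc_vertical X x) s = (0 :: 'k::field)"
proof (cases s)
  case (Pair \<tau> c)
  have "dc_vertical X (dc_horizontal K x) (\<tau>, c) =
      (\<Sum>e\<in>cells X. \<Sum>\<sigma>\<in>K. (-1) ^ (card \<tau> - 1) * of_int (incidence X e c) * face_coeff K \<tau> \<sigma> * x (\<sigma>, e))"
    by (simp add: dc_vertical_def dc_horizontal_altdef cell_boundary_def sum_distrib_left mult.assoc)
  also have "\<dots> = (\<Sum>\<sigma>\<in>K. \<Sum>e\<in>cells X. (-1) ^ (card \<tau> - 1) * of_int (incidence X e c) * face_coeff K \<tau> \<sigma> * x (\<sigma>, e))"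
    by (rule sum.swap)
  finally have 1: "dc_vertical X (dc_horizontal K x) (\<tau>, c) = \<dots>" .
  have 2: "dc_horizontal K (dc_vertical X x) (\<tau>, c) =
      (\<Sum>\<sigma>\<in>K. \<Sum>e\<in>cells X. face_coeff K \<tau> \<sigma> * (-1) ^ (card \<sigma> - 1) * of_int (incidence X e c) * x (\<sigma>, e))"
    by (simp add: dc_vertical_def dc_horizontal_altdef cell_boundary_def sum_distrib_left mult.assoc)
  have "(-1) ^ (card \<tau> - 1) * a * face_coeff K \<tau> \<sigma> * b + face_coeff K \<tau> \<sigma> * (-1) ^ (card \<sigma> - 1) * a * b = 0"
    if "\<sigma> \<in> K" for \<sigma> and a b :: 'k
  proof (cases "face_coeff K \<tau> \<sigma> = (0::'k)")
    case False
    then have "card \<sigma> - 1 = Suc (card \<tau> - 1)" using face_coeff_dim[OF False that] by simp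
    then show ?thesis by (simp add: algebra_simps)
  qed simp
  then have "dc_vertical X (dc_horizontal K x) (\<tau>, c) + dc_horizontal K (dc_vertical X x) (\<tau>, c) = 0"
    unfolding 1 2 sum.distrib[symmetric] by (intro sum.neutral ballI)
  then show ?thesis using Pair by simp
qed

lemma linear_vertical: "linear_fun (dc_vertical X)"
  by (auto simp: linear_fun_def dc_vertical_def cell_boundary_lin_ext lin_ext_add lin_ext_scale algebra_simps)

lemma linear_horizontal: "linear_fun (dc_horizontal K :: ('i set \<times> 'c set \<Rightarrow> 'k::field) \<Rightarrow> _)"
proof -
  have "dc_horizontal K (\<lambda>s. x s + y s) t = dc_horizontal K x t + dc_horizontal K y t"
    and "dc_horizontal K (\<lambda>s. a * x s) t = a * dc_horizontal K x t" for x y :: "'i set \<times> 'c set \<Rightarrow> 'k" and a t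
    by (cases t; simp add: dc_horizontal_altdef algebra_simps sum.distrib sum_distrib_left)+
  then show ?thesis by (simp add: linear_fun_def fun_eq_iff)
qed

lemma linear_differential: "linear_fun (dc_differential X K)"
  unfolding linear_fun_def dc_differential_def linear_funD(1,2)[OF linear_vertical]
    linear_funD(1,2)[OF linear_horizontal]
  by (simp add: algebra_simps)

lemma differential_differential: "dc_differential X K (dc_differential X K x) = (\<lambda>s. 0 :: 'k::field)"
proof
  fix s
  have "dc_differential X K (dc_differential X K x) s =
      (dc_vertical X (dc_vertical X x) s + dc_vertical X (dc_horizontal K x) s) +
      (dc_horizontal K (dc_vertical X x) s + dc_horizontal K (dc_horizontal K x) s)"
    by (simp add: dc_differential_def[of X K "dc_differential X K x"])
      (simp add: dc_differential_def linear_funD(1)[OF linear_vertical] linear_funD(1)[OF linear_horizontal])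
  then show "dc_differential X K (dc_differential X K x) s = 0"
    using vertical_horizontal[of x s] by (simp add: horizontal_horizontal vertical_vertical algebra_simps)
qed

lemma in_filtration:
  "x \<in> dc_filtration X K D r p k \<longleftrightarrow> (\<forall>\<sigma> c. x (\<sigma>, c) \<noteq> 0 \<longrightarrow>
     \<sigma> \<in> K \<and> c \<in> D \<sigma> r \<and> int (card \<sigma>) - 1 \<le> p \<and> int (card \<sigma>) - 1 + int (cdim X c) = k)"
  by (auto simp: dc_filtration_def chain_module_def)

lemma filtration_vanish:
  assumes "x \<in> dc_filtration X K D r p k" "p < int (card \<sigma>) - 1"
  shows "x (\<sigma>, c) = 0"
proof (rule ccontr)
  assume "x (\<sigma>, c) \<noteq> 0"
  then have "int (card \<sigma>) - 1 \<le> p" using assms(1) unfolding in_filtration by blast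
  then show False using assms(2) by simp
qed

lemma vertical_in_filtration:
  fixes x :: "'i set \<times> 'a set \<Rightarrow> 'k::field"
  assumes "x \<in> dc_filtration X K D r p k"
  shows "dc_vertical X x \<in> dc_filtration X K D r p (k - 1)"
  unfolding in_filtration
proof (intro allI impI)
  fix \<sigma> c assume "dc_vertical X x (\<sigma>, c) \<noteq> 0"
  then have "cell_boundary X (\<lambda>e. x (\<sigma>, e)) c \<noteq> 0" by (simp add: dc_vertical_def)
  then obtain e where e: "e \<in> cells X" "of_int (incidence X e c) * x (\<sigma>, e) \<noteq> 0"
    unfolding cell_boundary_def by (meson sum.neutral)
  then have "incidence X e c \<noteq> 0" by (cases "incidence X e c = 0") simp_all
  then have c: "c \<in> facets e" using incidence_nonzero by blast
  have x: "\<sigma> \<in> K" "e \<in> D \<sigma> r" "int (card \<sigma>) - 1 \<le> p" "int (card \<sigma>) - 1 + int (cdim X e) = k"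
    using assms e(2) unfolding in_filtration by auto
  have "c \<in> D \<sigma> r"
    using subcomplex_face[OF D_subcomplex[OF x(1)] x(2) facets_cells[OF c]] facets_faces[OF c]
    by (simp add: faces_def)
  then show "\<sigma> \<in> K \<and> c \<in> D \<sigma> r \<and> int (card \<sigma>) - 1 \<le> p \<and> int (card \<sigma>) - 1 + int (cdim X c) = k - 1"
    using x facets_dim[OF c] by simp
qed

lemma horizontal_in_filtration:
  fixes x :: "'i set \<times> 'a set \<Rightarrow> 'k::field"
  assumes "x \<in> dc_filtration X K D r p k"
  shows "dc_horizontal K x \<in> dc_filtration X K D r (p - 1) (k - 1)"
  unfolding in_filtration
proof (intro allI impI)
  fix \<tau> c assume "dc_horizontal K x (\<tau>, c) \<noteq> 0"
  then obtain \<sigma> where \<sigma>: "\<sigma> \<in> K" "face_coeff K \<tau> \<sigma> * x (\<sigma>, c) \<noteq> 0"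
    unfolding dc_horizontal_altdef by (meson sum.neutral)
  then have fc: "face_coeff K \<tau> \<sigma> \<noteq> (0::'k)" and "x (\<sigma>, c) \<noteq> 0" by auto
  then have x: "c \<in> D \<sigma> r" "int (card \<sigma>) - 1 \<le> p" "int (card \<sigma>) - 1 + int (cdim X c) = k"
    using assms unfolding in_filtration by auto
  show "\<tau> \<in> K \<and> c \<in> D \<tau> r \<and> int (card \<tau>) - 1 \<le> p - 1 \<and> int (card \<tau>) - 1 + int (cdim X c) = k - 1"
    using x face_coeff_dim[OF fc \<sigma>(1)] face_coeff_nonzero(1)[OF fc] D_antimono[of \<tau> \<sigma> r] by auto
qed

lemma filtered_complex:
  "filtered_complex (dc_filtration X K D r :: int \<Rightarrow> int \<Rightarrow> ('i set \<times> 'a set \<Rightarrow> 'k::field) set)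
     (dc_differential X K)"
proof
  have vs: "vsubspace (dc_filtration X K D r p k :: ('i set \<times> 'a set \<Rightarrow> 'k) set)" for p k
    unfolding vsubspace_def in_filtration
  proof (intro conjI ballI allI impI)
    fix x y :: "'i set \<times> 'a set \<Rightarrow> 'k" and \<sigma> c
    assume xy: "x \<in> dc_filtration X K D r p k" "y \<in> dc_filtration X K D r p k"
      and "x (\<sigma>, c) + y (\<sigma>, c) \<noteq> 0"
    then have "x (\<sigma>, c) \<noteq> 0 \<or> y (\<sigma>, c) \<noteq> 0" by auto
    then have "\<sigma> \<in> K \<and> c \<in> D \<sigma> r \<and> int (card \<sigma>) - 1 \<le> p \<and> int (card \<sigma>) - 1 + int (cdim X c) = k"
      using xy unfolding in_filtration by blast
    then show "\<sigma> \<in> K" "c \<in> D \<sigma> r" "int (card \<sigma>) - 1 \<le> p" "int (card \<sigma>) - 1 + int (cdim X c) = k"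
      by auto
  qed (auto simp: in_filtration)
  then show "vsubspace (dc_filtration X K D r p k :: ('i set \<times> 'a set \<Rightarrow> 'k) set)" for p k .
  show mono: "dc_filtration X K D r p k \<subseteq> (dc_filtration X K D r p' k :: ('i set \<times> 'a set \<Rightarrow> 'k) set)"
    if "p \<le> p'" for p p' k
    using that by (fastforce simp: in_filtration)
  show "linear_fun (dc_differential X K :: ('i set \<times> 'a set \<Rightarrow> 'k) \<Rightarrow> _)"
    by (rule linear_differential)
  show "dc_differential X K x \<in> dc_filtration X K D r p (k - 1)"
    if "x \<in> dc_filtration X K D r p k" for x :: "'i set \<times> 'a set \<Rightarrow> 'k" and p k
    unfolding dc_differential_def
    using vsubspaceD(2)[OF vs vertical_in_filtration[OF that]] horizontal_in_filtration[OF that]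
      mono[of "p - 1" p "k - 1"] by auto
  show "dc_differential X K (dc_differential X K x) = (\<lambda>s. 0)" for x :: "'i set \<times> 'a set \<Rightarrow> 'k"
    by (rule differential_differential)
qed

lemma filtration_mono: "r \<le> s \<Longrightarrow> dc_filtration X K D r p k \<subseteq> dc_filtration X K D s p k"
  using D_mono by (fastforce simp: in_filtration)

lemma filtered_map_trans:
  assumes "r \<le> s"
  shows "filtered_map (dc_filtration X K D r :: int \<Rightarrow> int \<Rightarrow> ('i set \<times> 'a set \<Rightarrow> 'k::field) set)
     (dc_differential X K) (dc_filtration X K D s) (dc_differential X K) (\<lambda>x. x)"
  unfolding filtered_map_def filtered_map_axioms_def
  using filtered_complex filtration_mono[OF assms] by (auto simp: linear_fun_def)

text \<open>In horizontal degree \<open>p\<close>, both \<open>d x\<close>, which lies in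
  \<open>F_{p-n}\<close> with \<open>n \<ge> 1\<close>, and the horizontal part, which lies in
  \<open>F_{p-1}\<close>, vanish. Only the vertical part is left, so it vanishes too.\<close>

lemma column_cycle:
  fixes x :: "'i set \<times> 'a set \<Rightarrow> 'k::field"
  assumes x: "x \<in> fc_cycles (dc_filtration X K D r) (dc_differential X K) n p q"
    and n: "1 \<le> n" and \<sigma>: "\<sigma> \<in> K" "int (card \<sigma>) - 1 = p"
  shows "cell_boundary X (\<lambda>c. x (\<sigma>, c)) = (\<lambda>c. 0)"
proof
  fix c
  have xF: "x \<in> dc_filtration X K D r p (p + q)"
    and dx: "dc_differential X K x \<in> dc_filtration X K D r (p - n) (p + q - 1)"
    using x by (auto simp: fc_cycles_def)
  have "dc_differential X K x (\<sigma>, c) = 0"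
    using filtration_vanish[OF dx] n \<sigma>(2) by simp
  moreover have "dc_horizontal K x (\<sigma>, c) = 0"
    using filtration_vanish[OF horizontal_in_filtration[OF xF]] \<sigma>(2) by simp
  ultimately show "cell_boundary X (\<lambda>c. x (\<sigma>, c)) c = 0"
    by (simp add: dc_differential_def dc_vertical_def)
qed

text \<open>Primitives of the single columns, chosen with no compatibility between simplices, form
  one chain \<open>w\<close> in \<open>F_p\<close>. Then \<open>y - d w\<close> is zero in
  horizontal degree \<open>p\<close>, so it lies in \<open>F_{p-1}\<close> and
  \<open>homotopic_zero\<close> applies.\<close>

lemma boundary_if_columns_boundary:
  fixes y :: "'i set \<times> 'a set \<Rightarrow> 'k::field"
  assumes y: "y \<in> fc_cycles (dc_filtration X K D s) (dc_differential X K) n p q" and n: "1 \<le> n"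
    and ex: "\<And>\<sigma>. \<sigma> \<in> K \<Longrightarrow> int (card \<sigma>) - 1 = p \<Longrightarrow>
      \<exists>w. (\<forall>c. w c \<noteq> 0 \<longrightarrow> c \<in> D \<sigma> s \<and> int (cdim X c) = q + 1) \<and> cell_boundary X w = (\<lambda>c. y (\<sigma>, c))"
  shows "y \<in> fc_boundaries (dc_filtration X K D s) (dc_differential X K) n p q"
proof -
  interpret fc: filtered_complex "dc_filtration X K D s :: int \<Rightarrow> int \<Rightarrow> ('i set \<times> 'a set \<Rightarrow> 'k) set"
    "dc_differential X K" by (rule filtered_complex)
  define W where "W \<sigma> = (SOME w. (\<forall>c. w c \<noteq> 0 \<longrightarrow> c \<in> D \<sigma> s \<and> int (cdim X c) = q + 1) \<and>
      cell_boundary X w = (\<lambda>c. y (\<sigma>, c)))" for \<sigma>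
  have W: "W \<sigma> c \<noteq> 0 \<Longrightarrow> c \<in> D \<sigma> s \<and> int (cdim X c) = q + 1"
    "cell_boundary X (W \<sigma>) = (\<lambda>c. y (\<sigma>, c))"
    if "\<sigma> \<in> K" "int (card \<sigma>) - 1 = p" for \<sigma> c
    using someI_ex[OF ex[OF that]] unfolding W_def[symmetric] by auto
  \<comment> \<open>The sign cancels the one in the vertical differential.\<close>
  define w where "w = (\<lambda>(\<sigma>, c). if \<sigma> \<in> K \<and> int (card \<sigma>) - 1 = p then (-1) ^ (card \<sigma> - 1) * W \<sigma> c else 0)"
  have w: "w \<in> dc_filtration X K D s p (p + q + 1)"
    using W(1) by (auto simp: in_filtration w_def split: if_splits)
  let ?z = "\<lambda>t. y t - dc_differential X K w t"
  have yF: "y \<in> dc_filtration X K D s p (p + q)" using y by (simp add: fc_cycles_def)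
  have zF: "?z \<in> dc_filtration X K D s p (p + q)"
    using vsubspaceD(4)[OF fc.vsubspace_F yF] fc.d_F[OF w] by simp
  have z0: "?z (\<sigma>, c) = 0" if \<sigma>: "\<sigma> \<in> K" "int (card \<sigma>) - 1 = p" for \<sigma> c
  proof -
    have "dc_horizontal K w (\<sigma>, c) = 0"
      using filtration_vanish[OF horizontal_in_filtration[OF w]] \<sigma>(2) by simp
    moreover have "cell_boundary X (\<lambda>e. w (\<sigma>, e)) c = (-1) ^ (card \<sigma> - 1) * y (\<sigma>, c)"
    proof -
      have "(\<lambda>e. w (\<sigma>, e)) = (\<lambda>e. (-1) ^ (card \<sigma> - 1) * W \<sigma> e)" using \<sigma> by (simp add: w_def)
      then show ?thesis
        using fun_cong[OF W(2)[OF \<sigma>], of c] by (simp add: cell_boundary_lin_ext lin_ext_scale)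
    qed
    ultimately show ?thesis by (simp add: dc_differential_def dc_vertical_def)
  qed
  have "?z \<in> dc_filtration X K D s (p - 1) (p + q)"
    unfolding in_filtration
  proof (intro allI impI)
    fix \<sigma> c assume nz: "?z (\<sigma>, c) \<noteq> 0"
    then have "\<sigma> \<in> K \<and> c \<in> D \<sigma> s \<and> int (card \<sigma>) - 1 \<le> p \<and> int (card \<sigma>) - 1 + int (cdim X c) = p + q"
      using zF unfolding in_filtration by blast
    moreover have "\<not> (\<sigma> \<in> K \<and> int (card \<sigma>) - 1 = p)" using z0 nz by blast
    ultimately show "\<sigma> \<in> K \<and> c \<in> D \<sigma> s \<and> int (card \<sigma>) - 1 \<le> p - 1 \<and> int (card \<sigma>) - 1 + int (cdim X c) = p + q"
      by auto
  qed
  from fc.homotopic_zero[OF n y this w] show ?thesis by simp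
qed

end

section \<open>Double complexes as filtered complexes, and their maps\<close>

lemma dc_cycles_fc: "dc_cycles n X K D r p q = fc_cycles (dc_filtration X K D r) (dc_differential X K) n p q"
  by (simp add: dc_cycles_def fc_cycles_def)

lemma dc_boundaries_fc:
  "dc_boundaries n X K D r p q = fc_boundaries (dc_filtration X K D r) (dc_differential X K) n p q"
  by (simp add: dc_boundaries_def fc_boundaries_def dc_cycles_fc)

lemma dc_spectral_sequence_fc:
  "dc_spectral_sequence X K D r = fc_spectral_sequence (dc_filtration X K D r) (dc_differential X K)"
  by (simp add: dc_spectral_sequence_def fc_spectral_sequence_def dc_cycles_fc dc_boundaries_fc)

definition dc_map :: "'a cw \<Rightarrow> ('a set \<Rightarrow> 'b set \<Rightarrow> 'k::field) \<Rightarrow> ('i set \<times> 'a set \<Rightarrow> 'k) \<Rightarrow> 'i set \<times> 'b set \<Rightarrow> 'k" where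
  "dc_map X f x = (\<lambda>(\<sigma>, e). lin_ext X f (\<lambda>c. x (\<sigma>, c)) e)"

lemma linear_dc_map: "linear_fun (dc_map X f)"
  by (auto simp: linear_fun_def dc_map_def lin_ext_add lin_ext_scale)

lemma dc_map_nonzero:
  assumes "dc_map X f x (\<sigma>, e) \<noteq> 0"
  obtains c where "c \<in> cells X" "x (\<sigma>, c) \<noteq> 0" "f c e \<noteq> 0"
proof -
  obtain c where "c \<in> cells X" "x (\<sigma>, c) * f c e \<noteq> 0"
    using assms unfolding dc_map_def lin_ext_def by (auto elim: sum.not_neutral_contains_not_neutral)
  then show ?thesis using that by auto
qed

text \<open>The same \<open>f\<close> acts in every column, so it commutes strictly with a
  differential that changes only the simplex.\<close>

lemma dc_map_horizontal:
  fixes x :: "'i::linorder set \<times> 'a set \<Rightarrow> 'k::field" and f :: "'a set \<Rightarrow> 'b set \<Rightarrow> 'k"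
  shows "dc_map X f (dc_horizontal K x) = dc_horizontal K (dc_map X f x)"
proof
  fix t :: "'i set \<times> 'b set"
  obtain \<tau> e where t: "t = (\<tau>, e)" by fastforce
  have "dc_map X f (dc_horizontal K x) (\<tau>, e) =
      (\<Sum>c\<in>cells X. \<Sum>\<sigma>\<in>K. face_coeff K \<tau> \<sigma> * (x (\<sigma>, c) * f c e))"
    by (simp add: dc_map_def lin_ext_def dc_horizontal_altdef sum_distrib_right mult.assoc)
  also have "\<dots> = (\<Sum>\<sigma>\<in>K. \<Sum>c\<in>cells X. face_coeff K \<tau> \<sigma> * (x (\<sigma>, c) * f c e))"
    by (rule sum.swap)
  also have "\<dots> = dc_horizontal K (dc_map X f x) (\<tau>, e)"
    by (simp add: dc_map_def lin_ext_def dc_horizontal_altdef sum_distrib_left)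
  finally show "dc_map X f (dc_horizontal K x) t = dc_horizontal K (dc_map X f x) t" using t by simp
qed

lemma dc_map_vertical:
  fixes x :: "'i set \<times> 'a set \<Rightarrow> 'k::field" and f :: "'a set \<Rightarrow> 'b set \<Rightarrow> 'k"
  assumes "\<And>c. c \<in> cells X \<Longrightarrow> cell_boundary Y (f c) = lin_ext X f (bdry X c)"
  shows "dc_map X f (dc_vertical X x) = dc_vertical Y (dc_map X f x)"
proof
  fix t :: "'i set \<times> 'b set"
  obtain \<sigma> e where t: "t = (\<sigma>, e)" by fastforce
  have "dc_map X f (dc_vertical X x) (\<sigma>, e) =
      (-1) ^ (card \<sigma> - 1) * lin_ext X f (cell_boundary X (\<lambda>c. x (\<sigma>, c))) e"
    by (simp add: dc_map_def dc_vertical_def lin_ext_scale)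
  also have "\<dots> = dc_vertical Y (dc_map X f x) (\<sigma>, e)"
    using chain_map_lin_ext[of X Y f, OF assms] by (simp add: dc_map_def dc_vertical_def)
  finally show "dc_map X f (dc_vertical X x) t = dc_vertical Y (dc_map X f x) t" using t by simp
qed

lemma dc_map_differential:
  fixes x :: "'i::linorder set \<times> 'a set \<Rightarrow> 'k::field" and f :: "'a set \<Rightarrow> 'b set \<Rightarrow> 'k"
  assumes "\<And>c. c \<in> cells X \<Longrightarrow> cell_boundary Y (f c) = lin_ext X f (bdry X c)"
  shows "dc_map X f (dc_differential X K x) = dc_differential Y K (dc_map X f x)"
proof -
  have "dc_map X f (dc_vertical X x) = dc_vertical Y (dc_map X f x)"
    by (rule dc_map_vertical) (rule assms)
  then show ?thesis
    by (simp add: dc_differential_def linear_funD(1)[OF linear_dc_map] dc_map_horizontal)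
qed

lemma filtered_map_dc_map:
  fixes f :: "'a set \<Rightarrow> 'b set \<Rightarrow> 'k::field" and K :: "'i::linorder set set"
  assumes X: "cw_diagram X K D" and Y: "cw_diagram Y K L"
    and f: "\<And>c. c \<in> cells X \<Longrightarrow> cell_boundary Y (f c) = lin_ext X f (bdry X c)"
    and L: "\<And>\<sigma> c. \<sigma> \<in> K \<Longrightarrow> c \<in> D \<sigma> r \<Longrightarrow> f c \<in> cell_chains Y (L \<sigma> s) (cdim X c)"
  shows "filtered_map (dc_filtration X K D r) (dc_differential X K)
    (dc_filtration Y K L s) (dc_differential Y K) (dc_map X f)"
  unfolding filtered_map_def filtered_map_axioms_def
proof (intro conjI allI impI)
  fix x :: "'i set \<times> 'a set \<Rightarrow> 'k" and p k
  assume x: "x \<in> dc_filtration X K D r p k"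
  show "dc_map X f x \<in> dc_filtration Y K L s p k"
    unfolding cw_diagram.in_filtration[OF Y]
  proof (intro allI impI)
    fix \<sigma> e assume "dc_map X f x (\<sigma>, e) \<noteq> 0"
    then obtain c where c: "x (\<sigma>, c) \<noteq> 0" "f c e \<noteq> 0" by (rule dc_map_nonzero)
    then have "\<sigma> \<in> K" "c \<in> D \<sigma> r" "int (card \<sigma>) - 1 \<le> p" "int (card \<sigma>) - 1 + int (cdim X c) = k"
      using x unfolding cw_diagram.in_filtration[OF X] by auto
    then show "\<sigma> \<in> K \<and> e \<in> L \<sigma> s \<and> int (card \<sigma>) - 1 \<le> p \<and> int (card \<sigma>) - 1 + int (cdim Y e) = k"
      using L[of \<sigma> c] c(2) by (auto simp: in_cell_chains)
  qed
qed (use cw_diagram.filtered_complex[OF X] cw_diagram.filtered_complex[OF Y] linear_dc_map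
      dc_map_differential[of X Y f, OF f] in auto)

section \<open>Interleavings from carriers\<close>

lemma dc_morphism_dc_map:
  fixes f :: "'a set \<Rightarrow> 'b set \<Rightarrow> 'k::field" and K :: "'i::linorder set set"
  assumes f: "\<And>c. c \<in> cells X \<Longrightarrow> cell_boundary Y (f c) = lin_ext X f (bdry X c)"
    and L: "\<And>\<sigma> r c. \<sigma> \<in> K \<Longrightarrow> c \<in> D \<sigma> r \<Longrightarrow> f c \<in> cell_chains Y (L \<sigma> (r + \<epsilon>)) (cdim X c)"
  shows "dc_morphism \<epsilon> K X D Y L (\<lambda>r. dc_map X f)"
  unfolding dc_morphism_def
proof (intro allI conjI ballI impI)
  have supp: "\<sigma> \<in> K \<and> e \<in> L \<sigma> (r + \<epsilon>) \<and> (\<exists>c. x (\<sigma>, c) \<noteq> 0 \<and> cdim Y e = cdim X c)"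
    if x: "x \<in> carrier (dc_total K D r)" and nz: "dc_map X f x (\<sigma>, e) \<noteq> 0"
    for x :: "'i set \<times> 'a set \<Rightarrow> 'k" and \<sigma> e r
  proof -
    obtain c where c: "x (\<sigma>, c) \<noteq> 0" "f c e \<noteq> 0" using nz by (rule dc_map_nonzero)
    have "\<sigma> \<in> K" "c \<in> D \<sigma> r" using x c(1) by (auto simp: dc_total_def chain_module_def)
    then show ?thesis using L[of \<sigma> c r] c by (auto simp: in_cell_chains)
  qed
  fix r
  show "linear_map (dc_total K D r) (dc_total K L (r + \<epsilon>)) (dc_map X f)"
    unfolding linear_map_def
  proof (intro conjI ballI allI)
    show "dc_map X f \<in> carrier (dc_total K D r) \<rightarrow> carrier (dc_total K L (r + \<epsilon>))"
    proof
      fix x :: "'i set \<times> 'a set \<Rightarrow> 'k" assume "x \<in> carrier (dc_total K D r)"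
      from supp[OF this] show "dc_map X f x \<in> carrier (dc_total K L (r + \<epsilon>))"
        by (auto simp: dc_total_def[of K L] chain_module_def)
    qed
  qed (simp_all add: dc_total_def chain_module_def linear_funD[OF linear_dc_map])
  show "dc_map X f \<in> carrier (dc_component X K D r p q) \<rightarrow> carrier (dc_component Y K L (r + \<epsilon>) p q)" for p q
  proof
    fix x :: "'i set \<times> 'a set \<Rightarrow> 'k" assume x: "x \<in> carrier (dc_component X K D r p q)"
    then have tot: "x \<in> carrier (dc_total K D r)" by (auto simp: dc_component_def dc_total_def chain_module_def)
    show "dc_map X f x \<in> carrier (dc_component Y K L (r + \<epsilon>) p q)"
      using supp[OF tot] x by (fastforce simp: dc_component_def chain_module_def)
  qed
  fix x :: "'i set \<times> 'a set \<Rightarrow> 'k"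
  show "dc_map X f (dc_vertical X x) = dc_vertical Y (dc_map X f x)"
    by (rule dc_map_vertical) (rule f)
  show "dc_map X f (dc_horizontal K x) = dc_horizontal K (dc_map X f x)"
    by (rule dc_map_horizontal)
\<comment> \<open>What remains is naturality in the filtration parameter, immediate because one map
  serves all values.\<close>
qed simp

lemma dc_ss_page:
  "page (dc_spectral_sequence X K D r) m p q = quotient_module
     (fc_cycles (dc_filtration X K D r) (dc_differential X K) (int m) p q)
     (fc_boundaries (dc_filtration X K D r) (dc_differential X K) (int m) p q)"
  by (simp add: dc_spectral_sequence_fc fc_spectral_sequence_def)

lemma dc_induced_fc:
  "dc_induced \<epsilon> K Y L (\<lambda>r. \<phi>) r m p q = induced_map
     (fc_boundaries (dc_filtration Y K L (r + \<epsilon>)) (dc_differential Y K) (int m) p q) \<phi>"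
  by (simp add: dc_induced_def dc_boundaries_fc)

lemma ss_trans_fc:
  "ss_trans (persistent_spectral_sequence X K D) r s m p q = induced_map
     (fc_boundaries (dc_filtration X K D s) (dc_differential X K) (int m) p q) (\<lambda>x. x)"
  by (simp add: persistent_spectral_sequence_def dc_boundaries_fc)

lemma ss_at_dc: "ss_at (persistent_spectral_sequence X K D) = dc_spectral_sequence X K D"
  by (simp add: persistent_spectral_sequence_def)

lemma ss_shift_morphism_dc_map:
  fixes \<phi> :: "('i::linorder set \<times> 'a set \<Rightarrow> 'k::field) \<Rightarrow> 'i set \<times> 'b set \<Rightarrow> 'k"
  assumes X: "cw_diagram X K D" and Y: "cw_diagram Y K L"
    and \<phi>: "\<And>r. filtered_map (dc_filtration X K D r) (dc_differential X K)
      (dc_filtration Y K L (r + \<epsilon>)) (dc_differential Y K) \<phi>"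
  shows "ss_shift_morphism \<epsilon> n (persistent_spectral_sequence X K D) (persistent_spectral_sequence Y K L)
    (dc_induced \<epsilon> K Y L (\<lambda>r. \<phi>))"
  unfolding ss_shift_morphism_def ss_at_dc
proof (intro conjI allI impI ballI)
  fix r
  have "dc_induced \<epsilon> K Y L (\<lambda>r. \<phi>) r = (\<lambda>m p q. induced_map
     (fc_boundaries (dc_filtration Y K L (r + \<epsilon>)) (dc_differential Y K) (int m) p q) \<phi>)"
    by (intro ext) (simp add: dc_induced_fc)
  then show "ss_morphism n (dc_spectral_sequence X K D r) (dc_spectral_sequence Y K L (r + \<epsilon>))
     (dc_induced \<epsilon> K Y L (\<lambda>r. \<phi>) r)"
    using filtered_map.ss_morphism_induced[OF \<phi>] by (simp add: dc_spectral_sequence_fc)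
next
  fix r s m p q and P :: "('i set \<times> 'a set \<Rightarrow> 'k) set"
  assume rs: "(r::real) \<le> s" and P: "P \<in> carrier (page (dc_spectral_sequence X K D r) m p q)"
  obtain x where x: "P = coset (fc_boundaries (dc_filtration X K D r) (dc_differential X K) (int m) p q) x"
    using P unfolding dc_ss_page quotient_carrier by blast
  have rs': "r + \<epsilon> \<le> s + \<epsilon>" using rs by simp
  show "dc_induced \<epsilon> K Y L (\<lambda>r. \<phi>) s m p q (ss_trans (persistent_spectral_sequence X K D) r s m p q P) =
     ss_trans (persistent_spectral_sequence Y K L) (r + \<epsilon>) (s + \<epsilon>) m p q (dc_induced \<epsilon> K Y L (\<lambda>r. \<phi>) r m p q P)"
    unfolding dc_induced_fc ss_trans_fc x
      filtered_map.induced_coset[OF cw_diagram.filtered_map_trans[OF X rs]]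
      filtered_map.induced_coset[OF cw_diagram.filtered_map_trans[OF Y rs']]
      filtered_map.induced_coset[OF \<phi>] ..
qed

text \<open>On a page cycle \<open>x\<close>, the assumption \<open>ex\<close> is applied to each
  column of horizontal degree \<open>p\<close>. This shows that \<open>\<psi> (\<phi> x) - x\<close>
  is a page boundary at the shifted value, so both sides are the same coset.\<close>

lemma induced_round_trip:
  fixes \<phi> :: "('i::linorder set \<times> 'a set \<Rightarrow> 'k::field) \<Rightarrow> 'i set \<times> 'b set \<Rightarrow> 'k"
  assumes X: "cw_diagram X K D" and \<epsilon>: "\<epsilon> \<ge> 0" and m: "m \<ge> 1"
    and \<phi>: "\<And>r. filtered_map (dc_filtration X K D r) (dc_differential X K)
      (dc_filtration Y K L (r + \<epsilon>)) (dc_differential Y K) \<phi>"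
    and \<psi>: "\<And>r. filtered_map (dc_filtration Y K L r) (dc_differential Y K)
      (dc_filtration X K D (r + \<epsilon>)) (dc_differential X K) \<psi>"
    and ex: "\<And>\<sigma> r n x. \<sigma> \<in> K \<Longrightarrow> (\<lambda>c. x (\<sigma>, c)) \<in> cell_chains X (D \<sigma> r) n \<Longrightarrow>
      cell_boundary X (\<lambda>c. x (\<sigma>, c)) = (\<lambda>c. 0) \<Longrightarrow>
      \<exists>w\<in>cell_chains X (D \<sigma> (r + 2 * \<epsilon>)) (Suc n).
        cell_boundary X w = (\<lambda>c. \<psi> (\<phi> x) (\<sigma>, c) - x (\<sigma>, c))"
    and P: "P \<in> carrier (page (dc_spectral_sequence X K D r) m p q)"
  shows "dc_induced \<epsilon> K X D (\<lambda>r. \<psi>) (r + \<epsilon>) m p q (dc_induced \<epsilon> K Y L (\<lambda>r. \<phi>) r m p q P) =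
    ss_trans (persistent_spectral_sequence X K D) r (r + 2 * \<epsilon>) m p q P"
proof -
  let ?F = "dc_filtration X K D :: real \<Rightarrow> int \<Rightarrow> int \<Rightarrow> ('i set \<times> 'a set \<Rightarrow> 'k) set"
  let ?d = "dc_differential X K :: ('i set \<times> 'a set \<Rightarrow> 'k) \<Rightarrow> _"
  interpret X: cw_diagram X K D by (rule X)
  have rr: "r + \<epsilon> + \<epsilon> = r + 2 * \<epsilon>" by simp
  have le: "r \<le> r + 2 * \<epsilon>" using \<epsilon> by simp
  obtain x where x: "x \<in> fc_cycles (?F r) ?d (int m) p q"
    "P = coset (fc_boundaries (?F r) ?d (int m) p q) x"
    using P unfolding dc_ss_page quotient_carrier by blast
  interpret T: filtered_complex "?F (r + 2 * \<epsilon>)" ?d by (rule X.filtered_complex)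
  let ?y = "\<lambda>s. \<psi> (\<phi> x) s - x s"
  have \<psi>\<phi>: "\<psi> (\<phi> x) \<in> T.Z (int m) p q"
    using filtered_map.map_Z[OF \<psi>[of "r + \<epsilon>"] filtered_map.map_Z[OF \<phi> x(1)]] unfolding rr .
  have xT: "x \<in> T.Z (int m) p q"
    using filtered_map.map_Z[OF X.filtered_map_trans[OF le] x(1)] .
  have y: "?y \<in> T.Z (int m) p q" by (rule vsubspaceD(4)[OF T.vsubspace_Z \<psi>\<phi> xT])
  have xF: "x \<in> ?F r p (p + q)" using x(1) by (simp add: fc_cycles_def)
  have "?y \<in> T.B (int m) p q"
  proof (rule X.boundary_if_columns_boundary[OF y])
    show "1 \<le> int m" using m by simp
    fix \<sigma> assume \<sigma>: "\<sigma> \<in> K" "int (card \<sigma>) - 1 = p"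
    have supp: "c \<in> D \<sigma> r \<and> int (cdim X c) = q" if "x (\<sigma>, c) \<noteq> 0" for c
      using xF that \<sigma>(2) unfolding X.in_filtration by force
    have x\<sigma>: "(\<lambda>c. x (\<sigma>, c)) \<in> cell_chains X (D \<sigma> r) (nat q)"
      unfolding in_cell_chains using supp by force
    have cyc: "cell_boundary X (\<lambda>c. x (\<sigma>, c)) = (\<lambda>c. 0)"
      by (rule X.column_cycle[OF x(1) _ \<sigma>]) (use m in simp)
    obtain w where w: "w \<in> cell_chains X (D \<sigma> (r + 2 * \<epsilon>)) (Suc (nat q))"
      "cell_boundary X w = (\<lambda>c. \<psi> (\<phi> x) (\<sigma>, c) - x (\<sigma>, c))"
      using ex[OF \<sigma>(1) x\<sigma> cyc] by blast
    show "\<exists>w. (\<forall>c. w c \<noteq> 0 \<longrightarrow> c \<in> D \<sigma> (r + 2 * \<epsilon>) \<and> int (cdim X c) = q + 1) \<and>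
        cell_boundary X w = (\<lambda>c. ?y (\<sigma>, c))"
    \<comment> \<open>The page index \<open>q\<close> is an integer while cell dimensions are
      naturals. For negative \<open>q\<close> the bound obtained through \<open>nat q\<close> says
      nothing, but the column is zero.\<close>
    proof (cases "0 \<le> q")
      case True
      then show ?thesis using w by (intro exI[of _ w]) (auto simp: in_cell_chains)
    next
      case False
      have "?y (\<sigma>, c) = 0" for c
      proof (rule ccontr)
        assume "?y (\<sigma>, c) \<noteq> 0"
        then have "int (cdim X c) = q"
          using y \<sigma>(2) unfolding T.in_Z X.in_filtration by force
        then show False using False by simp
      qed
      then show ?thesis
        by (intro exI[of _ "\<lambda>c. 0"]) (simp add: cell_boundary_lin_ext lin_ext_zero)
    qed
  qed
  then have "coset (T.B (int m) p q) (\<psi> (\<phi> x)) = coset (T.B (int m) p q) x"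
    by (simp add: coset_eq_iff[OF T.vsubspace_B])
  moreover have "dc_induced \<epsilon> K X D (\<lambda>r. \<psi>) (r + \<epsilon>) m p q (dc_induced \<epsilon> K Y L (\<lambda>r. \<phi>) r m p q P) =
      coset (T.B (int m) p q) (\<psi> (\<phi> x))"
    unfolding dc_induced_fc x(2) filtered_map.induced_coset[OF \<phi>] rr
    by (rule filtered_map.induced_coset[OF \<psi>[of "r + \<epsilon>"], unfolded rr])
  moreover have "ss_trans (persistent_spectral_sequence X K D) r (r + 2 * \<epsilon>) m p q P = coset (T.B (int m) p q) x"
    unfolding ss_trans_fc x(2) filtered_map.induced_coset[OF X.filtered_map_trans[OF le]] ..
  ultimately show ?thesis by simp
qed

section \<open>One chain map for the whole cover\<close>

locale covered_cw = regular_cw X for X :: "'a cw" +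
  fixes A :: "real \<Rightarrow> 'a set set" and I :: "'i::linorder set" and U :: "'i \<Rightarrow> 'a set set" and K
  assumes filtered: "filtered_cw X A" and cover: "cw_cover X I U" and K: "K = nerve I U"
    and finite_K: "finite K"
begin

abbreviation "D \<equiv> cover_diagram A U"

lemma A_subcomplex: "subcomplex X (A r)" and A_mono: "r \<le> s \<Longrightarrow> A r \<subseteq> A s"
  and A_union: "(\<Union>r. A r) = cells X"
  using filtered by (auto simp: filtered_cw_def mono_def)

lemma U_subcomplex: "i \<in> I \<Longrightarrow> subcomplex X (U i)" and U_union: "(\<Union>i\<in>I. U i) = cells X"
  using cover by (auto simp: cw_cover_def)

lemma in_K: "\<sigma> \<in> K \<longleftrightarrow> finite \<sigma> \<and> \<sigma> \<noteq> {} \<and> \<sigma> \<subseteq> I \<and> (\<Inter>j\<in>\<sigma>. U j) \<noteq> {}"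
  by (auto simp: K nerve_def)

lemma in_D: "c \<in> D \<sigma> r \<longleftrightarrow> (\<forall>j\<in>\<sigma>. c \<in> U j) \<and> c \<in> A r"
  by (auto simp: cover_diagram_def)

lemma diagram: "cw_diagram X K D"
proof
  show "finite K" by (rule finite_K)
  show "finite \<sigma> \<and> \<sigma> \<noteq> {}" if "\<sigma> \<in> K" for \<sigma> using that by (simp add: in_K)
  show "\<tau> \<in> K" if "\<sigma> \<in> K" "\<tau> \<subseteq> \<sigma>" "\<tau> \<noteq> {}" for \<sigma> \<tau>
  proof -
    have "(\<Inter>j\<in>\<sigma>. U j) \<subseteq> (\<Inter>j\<in>\<tau>. U j)" using that(2) by blast
    then show ?thesis using that by (auto simp: in_K intro: finite_subset)
  qed
  show "subcomplex X (D \<sigma> r)" if "\<sigma> \<in> K" for \<sigma> r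
    unfolding subcomplex_def
  proof (intro conjI ballI impI)
    show "D \<sigma> r \<subseteq> cells X" using subcomplex_cells[OF A_subcomplex] by (auto simp: cover_diagram_def)
    fix c d assume *: "c \<in> D \<sigma> r" "d \<in> cells X" "cell_face X d c"
    have "d \<in> U j" if "j \<in> \<sigma>" for j
      using subcomplex_face[OF U_subcomplex _ *(2,3)] * that \<open>\<sigma> \<in> K\<close> by (auto simp: in_D in_K)
    then show "d \<in> D \<sigma> r"
      using subcomplex_face[OF A_subcomplex _ *(2,3)] * by (simp add: in_D)
  qed
  show "D \<sigma> r \<subseteq> D \<tau> r" if "\<tau> \<subseteq> \<sigma>" for \<sigma> \<tau> r
    using that unfolding cover_diagram_def by blast
  show "D \<sigma> r \<subseteq> D \<sigma> s" if "r \<le> s" for \<sigma> r s using A_mono[OF that] by (auto simp: in_D)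
qed

definition top_simplex :: "'a set \<Rightarrow> 'i set" where
  "top_simplex c = {i \<in> I. c \<in> U i}"

lemma top_simplex_in_K: assumes "c \<in> cells X" shows "top_simplex c \<in> K"
proof -
  \<comment> \<open>The index set \<open>I\<close> may be infinite; finiteness comes from the
    vertices, whose singletons are simplices of the finite nerve.\<close>
  have "(\<lambda>i. {i}) ` top_simplex c \<subseteq> K" by (auto simp: in_K top_simplex_def)
  then have "finite ((\<lambda>i. {i}) ` top_simplex c)" using finite_K by (rule finite_subset)
  then have "finite (top_simplex c)" by (rule finite_imageD) simp
  moreover have "top_simplex c \<noteq> {}" using assms U_union by (auto simp: top_simplex_def)
  moreover have "c \<in> (\<Inter>j\<in>top_simplex c. U j)" by (simp add: top_simplex_def)
  ultimately show ?thesis unfolding in_K by (auto simp: top_simplex_def)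
qed

lemma in_D_top_simplex: "c \<in> D (top_simplex c) r \<longleftrightarrow> c \<in> A r"
  by (simp add: in_D top_simplex_def)

lemma in_D_imp: "\<sigma> \<in> K \<Longrightarrow> c \<in> D \<sigma> r \<Longrightarrow> \<sigma> \<subseteq> top_simplex c \<and> c \<in> A r"
  by (auto simp: in_D in_K top_simplex_def)

lemma carried_chain_map:
  fixes \<eta> :: "'a set \<Rightarrow> 'k::field" and \<theta> :: "'b set \<Rightarrow> 'k"
  assumes Y: "finite_regular_cw Y" and \<eta>: "augmentation X \<eta>" and \<theta>: "augmentation Y \<theta>"
    and F: "eps_K_acyclic_carrier TYPE('k) \<epsilon> K X D Y L F"
  shows "\<exists>f :: 'a set \<Rightarrow> 'b set \<Rightarrow> 'k.
    (\<forall>c\<in>cells X. cell_boundary Y (f c) = lin_ext X f (bdry X c) \<and> (\<Sum>v\<in>cells Y. \<theta> v * f c v) = \<eta> c) \<and>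
    (\<forall>\<sigma>\<in>K. \<forall>r. \<forall>c\<in>D \<sigma> r. f c \<in> cell_chains Y (F \<sigma> r c) (cdim X c))"
proof -
  interpret Y: regular_cw Y by (rule regular_cw.intro[OF Y])
  have carrier: "acyclic_carrier TYPE('k) X (D \<sigma> r) Y (L \<sigma> (r + \<epsilon>)) (F \<sigma> r)" if "\<sigma> \<in> K" for \<sigma> r
    using F that unfolding eps_K_acyclic_carrier_def eps_acyclic_carrier_def by blast
  have mono_r: "F \<sigma> r c \<subseteq> F \<sigma> s c" if "\<sigma> \<in> K" "r \<le> s" "c \<in> D \<sigma> r" for \<sigma> r s c
    using F that unfolding eps_K_acyclic_carrier_def eps_acyclic_carrier_def by blast
  have mono_\<sigma>: "F \<sigma> r c \<subseteq> F \<tau> r c" if "\<sigma> \<in> K" "\<tau> \<in> K" "\<tau> \<subseteq> \<sigma>" "c \<in> D \<sigma> r" for \<sigma> \<tau> r c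
    using F that unfolding eps_K_acyclic_carrier_def by blast
  have Fsub: "subcomplex Y (F \<sigma> r c)" "acyclic_complex TYPE('k) Y (F \<sigma> r c)"
    if "\<sigma> \<in> K" "c \<in> D \<sigma> r" for \<sigma> r c
    using carrier[OF that(1), of r] that(2) unfolding acyclic_carrier_def cell_carrier_def by blast+
  have Fface: "F \<sigma> r d \<subseteq> F \<sigma> r c" if "\<sigma> \<in> K" "c \<in> D \<sigma> r" "d \<in> D \<sigma> r" "cell_face X d c" for \<sigma> r c d
    using carrier[OF that(1), of r] that(2-) unfolding acyclic_carrier_def cell_carrier_def by blast
  \<comment> \<open>Carriers of \<open>c\<close> at two filtration values are comparable by
    monotonicity, so one of least cardinality is contained in every other.\<close>
  have "\<exists>r0. c \<in> A r0 \<and> (\<forall>r. c \<in> A r \<longrightarrow> F (top_simplex c) r0 c \<subseteq> F (top_simplex c) r c)"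
    if c: "c \<in> cells X" for c
  proof -
    let ?\<sigma> = "top_simplex c"
    have fin: "finite (F ?\<sigma> r c)" if "c \<in> A r" for r
      by (rule finite_subset[OF Y.subcomplex_cells[OF Fsub(1)[OF top_simplex_in_K[OF c]]] Y.finite_cells])
        (simp add: in_D_top_simplex that)
    have "\<exists>r. c \<in> A r" using c A_union by blast
    then obtain r0 where r0: "c \<in> A r0" "\<And>r. c \<in> A r \<Longrightarrow> card (F ?\<sigma> r0 c) \<le> card (F ?\<sigma> r c)"
      using exists_least_iff[of "\<lambda>n. \<exists>r. c \<in> A r \<and> card (F ?\<sigma> r c) = n"] by (metis not_le)
    have "F ?\<sigma> r0 c \<subseteq> F ?\<sigma> r c" if r: "c \<in> A r" for r
    proof (cases "r0 \<le> r")
      case True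
      then show ?thesis using mono_r[OF top_simplex_in_K[OF c]] r0(1) by (simp add: in_D_top_simplex)
    next
      case False
      then have "F ?\<sigma> r c \<subseteq> F ?\<sigma> r0 c"
        using mono_r[OF top_simplex_in_K[OF c], of r r0] r by (simp add: in_D_top_simplex)
      then show ?thesis using card_seteq[OF fin[OF r0(1)] _ r0(2)[OF r]] by simp
    qed
    then show ?thesis using r0(1) by blast
  qed
  then obtain r0 where r0: "\<And>c. c \<in> cells X \<Longrightarrow> c \<in> A (r0 c)"
    "\<And>c r. c \<in> cells X \<Longrightarrow> c \<in> A r \<Longrightarrow> F (top_simplex c) (r0 c) c \<subseteq> F (top_simplex c) r c"
    by metis
  define \<Phi> where "\<Phi> c = F (top_simplex c) (r0 c) c" for c
  \<comment> \<open>Two comparisons in turn: from \<open>r0 c\<close> to \<open>r\<close> at the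
    largest simplex, then from that simplex down to its face \<open>\<sigma>\<close>.\<close>
  have \<Phi>_sub: "\<Phi> c \<subseteq> F \<sigma> r c" if \<sigma>: "\<sigma> \<in> K" and c: "c \<in> D \<sigma> r" "c \<in> cells X" for \<sigma> r c
  proof -
    have *: "\<sigma> \<subseteq> top_simplex c" "c \<in> A r" using in_D_imp[OF \<sigma> c(1)] by auto
    have "\<Phi> c \<subseteq> F (top_simplex c) r c" unfolding \<Phi>_def by (rule r0(2)[OF c(2) *(2)])
    also have "\<dots> \<subseteq> F \<sigma> r c"
      using mono_\<sigma>[OF top_simplex_in_K[OF c(2)] \<sigma> *(1)] *(2) by (simp add: in_D_top_simplex)
    finally show ?thesis .
  qed
  have "\<exists>f :: 'a set \<Rightarrow> 'b set \<Rightarrow> 'k. \<forall>c\<in>cells X. f c \<in> cell_chains Y (\<Phi> c) (cdim X c) \<and>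
    cell_boundary Y (f c) = lin_ext X f (bdry X c) \<and> (\<Sum>v\<in>cells Y. \<theta> v * f c v) = \<eta> c"
  proof (rule acyclic_carrier_chain_map[OF regular Y \<eta> \<theta>])
    show "subcomplex Y (\<Phi> c)" "acyclic_complex TYPE('k) Y (\<Phi> c)" if "c \<in> cells X" for c
      unfolding \<Phi>_def using Fsub[OF top_simplex_in_K[OF that]] r0(1)[OF that]
      by (simp_all add: in_D_top_simplex)
    \<comment> \<open>The face \<open>d\<close> belongs to the same piece and value that were
      selected for \<open>c\<close>, and \<open>\<Phi> d\<close> lies below every carrier of
      \<open>d\<close>, in particular below this one.\<close>
    show "\<Phi> d \<subseteq> \<Phi> c" if cd: "c \<in> cells X" "d \<in> cells X" "cell_face X d c" for c d
    proof -
      let ?\<sigma> = "top_simplex c"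
      have c: "c \<in> D ?\<sigma> (r0 c)" using r0(1)[OF cd(1)] by (simp add: in_D_top_simplex)
      have d: "d \<in> D ?\<sigma> (r0 c)"
        using cw_diagram.D_subcomplex[OF diagram top_simplex_in_K[OF cd(1)]] subcomplex_face c cd by blast
      have "\<Phi> d \<subseteq> F ?\<sigma> (r0 c) d" by (rule \<Phi>_sub[OF top_simplex_in_K[OF cd(1)] d cd(2)])
      also have "\<dots> \<subseteq> \<Phi> c" unfolding \<Phi>_def by (rule Fface[OF top_simplex_in_K[OF cd(1)] c d cd(3)])
      finally show ?thesis .
    qed
  qed
  then obtain f :: "'a set \<Rightarrow> 'b set \<Rightarrow> 'k" where f: "\<And>c. c \<in> cells X \<Longrightarrow> f c \<in> cell_chains Y (\<Phi> c) (cdim X c)"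
    "\<And>c. c \<in> cells X \<Longrightarrow> cell_boundary Y (f c) = lin_ext X f (bdry X c)"
    "\<And>c. c \<in> cells X \<Longrightarrow> (\<Sum>v\<in>cells Y. \<theta> v * f c v) = \<eta> c" by blast
  have "f c \<in> cell_chains Y (F \<sigma> r c) (cdim X c)" if \<sigma>: "\<sigma> \<in> K" and c: "c \<in> D \<sigma> r" for \<sigma> r c
  proof -
    have "c \<in> cells X" using subcomplex_cells[OF A_subcomplex] in_D_imp[OF \<sigma> c] by blast
    then show ?thesis using cell_chains_mono[OF f(1) \<Phi>_sub[OF \<sigma> c]] by blast
  qed
  then show ?thesis using f(2,3) by blast
qed

text \<open>The homotopy lemma is applied to \<open>g f\<close> minus the identity on one piece,
  with the shift carrier \<open>J\<close> carrying both terms. The homotopy depends on the simplex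
  and the filtration value, so it is used only on a single column cycle \<open>z\<close>.\<close>

lemma round_trip_homotopy:
  fixes f :: "'a set \<Rightarrow> 'b set \<Rightarrow> 'k::field"
  assumes Y: "finite_regular_cw Y" and \<eta>: "augmentation X \<eta>"
    and f: "\<And>c. c \<in> cells X \<Longrightarrow> cell_boundary Y (f c) = lin_ext X f (bdry X c)"
      "\<And>c. c \<in> cells X \<Longrightarrow> (\<Sum>v\<in>cells Y. \<theta> v * f c v) = \<eta> c"
      "\<And>\<sigma> r c. \<sigma> \<in> K \<Longrightarrow> c \<in> D \<sigma> r \<Longrightarrow> f c \<in> cell_chains Y (F \<sigma> r c) (cdim X c)"
    and g: "\<And>e. e \<in> cells Y \<Longrightarrow> cell_boundary X (g e) = lin_ext Y g (bdry Y e)"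
      "\<And>e. e \<in> cells Y \<Longrightarrow> (\<Sum>v\<in>cells X. \<eta> v * g e v) = \<theta> e"
      "\<And>\<sigma> r e. \<sigma> \<in> K \<Longrightarrow> e \<in> L \<sigma> r \<Longrightarrow> g e \<in> cell_chains X (G \<sigma> r e) (cdim Y e)"
    and FL: "\<And>\<sigma> r c. \<sigma> \<in> K \<Longrightarrow> c \<in> D \<sigma> r \<Longrightarrow> F \<sigma> r c \<subseteq> L \<sigma> (r + \<epsilon>)"
    and IX: "shift_K_acyclic_carrier TYPE('k) (2 * \<epsilon>) K X D J"
    and comp: "\<And>\<tau> a. \<tau> \<in> K \<Longrightarrow> carrier_le (D \<tau> a) (carrier_comp (G \<tau> (a + \<epsilon>)) (F \<tau> a)) (J \<tau> a)"
    and \<sigma>: "\<sigma> \<in> K" and z: "z \<in> cell_chains X (D \<sigma> r) n" "cell_boundary X z = (\<lambda>c. 0)"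
  shows "\<exists>w\<in>cell_chains X (D \<sigma> (r + 2 * \<epsilon>)) (Suc n).
    cell_boundary X w = (\<lambda>c. lin_ext Y g (lin_ext X f z) c - z c)"
proof -
  interpret Y: regular_cw Y by (rule regular_cw.intro[OF Y])
  let ?D = "D \<sigma> r"
  have D: "subcomplex X ?D" using cw_diagram.D_subcomplex[OF diagram \<sigma>] .
  note DX = subsetD[OF subcomplex_cells[OF D]]
  have J: "acyclic_carrier TYPE('k) X ?D X (D \<sigma> (r + 2 * \<epsilon>)) (J \<sigma> r)"
    and Jid: "carried_by ?D (J \<sigma> r) (\<lambda>x :: 'a set \<Rightarrow> 'k. x)"
    using IX \<sigma> unfolding shift_K_acyclic_carrier_def shift_carrier_def eps_acyclic_carrier_def by blast+
  \<comment> \<open>Evaluating \<open>carried_by\<close> on the basis chain of \<open>c\<close> says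
    that \<open>c\<close> lies in its own carrier.\<close>
  have cJ: "c \<in> J \<sigma> r c" if "c \<in> ?D" for c
    using Jid that unfolding carried_by_def by (metis of_bool_eq_1_iff zero_neq_one)
  let ?\<delta> = "\<lambda>c t. of_bool (t = c) :: 'k"
  define u where "u c = (\<lambda>t. lin_ext Y g (f c) t - ?\<delta> c t)" for c
  have \<delta>: "lin_ext X ?\<delta> x t = x t" if "t \<in> cells X" for x t
    using that finite_cells by (simp add: lin_ext_def of_bool_def if_distrib cong: if_cong)
  \<comment> \<open>The support condition is needed because \<open>lin_ext\<close> drops
    coefficients outside \<open>cells X\<close>.\<close>
  have \<delta>': "lin_ext X ?\<delta> x = x" if "\<And>t. x t \<noteq> 0 \<Longrightarrow> t \<in> cells X" for x
  proof
    fix t show "lin_ext X ?\<delta> x t = x t"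
    proof (cases "t \<in> cells X")
      case False
      then have "x t = 0" using that by blast
      moreover have "lin_ext X ?\<delta> x t = 0"
        unfolding lin_ext_def using False by (intro sum.neutral) auto
      ultimately show ?thesis by simp
    qed (rule \<delta>)
  qed
  have bd\<delta>: "cell_boundary X (?\<delta> c) = bdry X c" if "c \<in> cells X" for c
    using that finite_cells
    by (simp add: fun_eq_iff cell_boundary_def bdry_def of_bool_def if_distrib cong: if_cong)
  have lin_u: "lin_ext X u x = (\<lambda>t. lin_ext Y g (lin_ext X f x) t - x t)"
    if "\<And>t. x t \<noteq> 0 \<Longrightarrow> t \<in> cells X" for x
  proof -
    have "lin_ext X ?\<delta> x = x" by (rule \<delta>') (rule that)
    then show ?thesis by (simp add: u_def[abs_def] lin_ext_diff_fun lin_ext_lin_ext)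
  qed
  have "\<exists>h :: 'a set \<Rightarrow> 'a set \<Rightarrow> 'k. \<forall>c\<in>?D. h c \<in> cell_chains X (J \<sigma> r c) (Suc (cdim X c)) \<and>
    cell_boundary X (h c) = (\<lambda>t. u c t - lin_ext X h (bdry X c) t)"
  proof (rule acyclic_carrier_homotopy[OF regular regular \<eta> D])
    show "subcomplex X (J \<sigma> r c)" "acyclic_complex TYPE('k) X (J \<sigma> r c)" if "c \<in> ?D" for c
      using J that unfolding acyclic_carrier_def cell_carrier_def by blast+
    show "J \<sigma> r d \<subseteq> J \<sigma> r c" if "c \<in> ?D" "d \<in> ?D" "cell_face X d c" for c d
      using J that unfolding acyclic_carrier_def cell_carrier_def by blast
  next
    fix c assume c: "c \<in> ?D"
    have "lin_ext Y g (f c) \<in> cell_chains X (J \<sigma> r c) (cdim X c)"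
    proof (rule lin_ext_cell_chains)
      fix e assume e: "e \<in> cells Y" "f c e \<noteq> 0"
      have eF: "e \<in> F \<sigma> r c" "cdim Y e = cdim X c"
        using f(3)[OF \<sigma> c] e(2) by (auto simp: in_cell_chains)
      then have "g e \<in> cell_chains X (G \<sigma> (r + \<epsilon>) e) (cdim X c)"
        using g(3)[OF \<sigma>, of e "r + \<epsilon>"] FL[OF \<sigma> c] by auto
      moreover have "G \<sigma> (r + \<epsilon>) e \<subseteq> J \<sigma> r c"
        using comp[OF \<sigma>, of r] c eF(1) unfolding carrier_le_def carrier_comp_def by blast
      ultimately show "g e \<in> cell_chains X (J \<sigma> r c) (cdim X c)" by (rule cell_chains_mono)
    qed
    moreover have "?\<delta> c \<in> cell_chains X (J \<sigma> r c) (cdim X c)"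
      using cJ[OF c] by (simp add: in_cell_chains)
    ultimately show "u c \<in> cell_chains X (J \<sigma> r c) (cdim X c)"
      unfolding u_def by (rule cell_chains_diff)
    have cf: "cell_boundary X (lin_ext Y g (f c)) = lin_ext Y g (lin_ext X f (bdry X c))"
      using chain_map_lin_ext[of Y X g, OF g(1)] f(1)[OF DX[OF c]] by simp
    have "cell_boundary X (u c) = (\<lambda>t. cell_boundary X (lin_ext Y g (f c)) t - cell_boundary X (?\<delta> c) t)"
      unfolding u_def cell_boundary_lin_ext by (rule lin_ext_diff)
    also have "\<dots> = lin_ext X u (bdry X c)"
      unfolding cf bd\<delta>[OF DX[OF c]] using bdry_nonzero facets_cells by (intro lin_u[symmetric]) blast
    finally show "cell_boundary X (u c) = lin_ext X u (bdry X c)" .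
    \<comment> \<open>As \<open>g\<close> turns \<open>\<eta>\<close> into \<open>\<theta>\<close>
      and \<open>f\<close> turns \<open>\<theta>\<close> into \<open>\<eta>\<close>, the composite
      preserves the augmentation of every cell.\<close>
    have "(\<Sum>v\<in>cells X. \<eta> v * lin_ext Y g (f c) v) = (\<Sum>e\<in>cells Y. f c e * \<theta> e)"
      unfolding lin_ext_functional by (intro sum.cong refl) (simp add: g(2))
    also have "\<dots> = \<eta> c" using f(2)[OF DX[OF c]] by (simp add: mult.commute)
    finally have "(\<Sum>v\<in>cells X. \<eta> v * lin_ext Y g (f c) v) = \<eta> c" .
    moreover have "(\<Sum>v\<in>cells X. \<eta> v * ?\<delta> c v) = \<eta> c"
      using DX[OF c] finite_cells by (simp add: of_bool_def if_distrib cong: if_cong)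
    ultimately show "(\<Sum>v\<in>cells X. \<eta> v * u c v) = 0"
      by (simp add: u_def right_diff_distrib sum_subtractf)
  qed
  then obtain h :: "'a set \<Rightarrow> 'a set \<Rightarrow> 'k" where
    h: "\<And>c. c \<in> ?D \<Longrightarrow> h c \<in> cell_chains X (J \<sigma> r c) (Suc (cdim X c))"
      "\<And>c. c \<in> ?D \<Longrightarrow> cell_boundary X (h c) = (\<lambda>t. u c t - lin_ext X h (bdry X c) t)" by blast
  have zD: "c \<in> ?D" "cdim X c = n" if "z c \<noteq> 0" for c using z(1) that by (auto simp: in_cell_chains)
  show ?thesis
  proof (intro bexI[of _ "lin_ext X h z"])
    show "lin_ext X h z \<in> cell_chains X (D \<sigma> (r + 2 * \<epsilon>)) (Suc n)"
    proof (rule lin_ext_cell_chains)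
      fix c assume "z c \<noteq> 0"
      note c = zD[OF this]
      have "J \<sigma> r c \<subseteq> D \<sigma> (r + 2 * \<epsilon>)"
        using J c(1) unfolding acyclic_carrier_def cell_carrier_def by blast
      then show "h c \<in> cell_chains X (D \<sigma> (r + 2 * \<epsilon>)) (Suc n)"
        using cell_chains_mono[OF h(1)[OF c(1)]] c(2) by simp
    qed
    have "cell_boundary X (lin_ext X h z) = lin_ext X (\<lambda>c. cell_boundary X (h c)) z"
      by (simp add: cell_boundary_lin_ext lin_ext_lin_ext)
    also have "\<dots> = lin_ext X (\<lambda>c t. u c t - lin_ext X h (bdry X c) t) z"
      by (intro lin_ext_cong h(2) zD(1))
    also have "\<dots> = (\<lambda>t. lin_ext X u z t - lin_ext X h (cell_boundary X z) t)"
      by (simp only: lin_ext_diff_fun lin_ext_lin_ext cell_boundary_lin_ext)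
    \<comment> \<open>The term \<open>h d z\<close> vanishes because \<open>z\<close> is a
      cycle.\<close>
    also have "\<dots> = lin_ext X u z" by (simp add: z(2) lin_ext_zero)
    also have "\<dots> = (\<lambda>c. lin_ext Y g (lin_ext X f z) c - z c)"
      using zD(1) DX by (intro lin_u) blast
    finally show "cell_boundary X (lin_ext X h z) = (\<lambda>c. lin_ext Y g (lin_ext X f z) c - z c)" .
  qed
qed

end

theorem proposition6p4:
  fixes X :: "'a cw" and A :: "real \<Rightarrow> 'a set set"
    and Y :: "'b cw" and B :: "real \<Rightarrow> 'b set set"
    and I J :: "'i::linorder set"
    and U :: "'i \<Rightarrow> 'a set set" and V :: "'i \<Rightarrow> 'b set set"
    and K :: "'i set set" and \<epsilon> :: real
    and F :: "'i set \<Rightarrow> real \<Rightarrow> 'a set \<Rightarrow> 'b set set"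
    and G :: "'i set \<Rightarrow> real \<Rightarrow> 'b set \<Rightarrow> 'a set set"
    and I\<^sub>X :: "'i set \<Rightarrow> real \<Rightarrow> 'a set \<Rightarrow> 'a set set"
    and I\<^sub>Y :: "'i set \<Rightarrow> real \<Rightarrow> 'b set \<Rightarrow> 'b set set"
  defines "D \<equiv> cover_diagram A U" and "L \<equiv> cover_diagram B V"
  assumes "filtered_cw X A" and "tame A" and "cw_cover X I U"
    and "filtered_cw Y B" and "tame B" and "cw_cover Y J V"
    and "K = nerve I U" and "K = nerve J V" and "finite K"
    and "\<epsilon> \<ge> 0"
    and "eps_K_acyclic_carrier TYPE('k::field) \<epsilon> K X D Y L F"
    and "eps_K_acyclic_carrier TYPE('k) \<epsilon> K Y L X D G"
    and "shift_K_acyclic_carrier TYPE('k) (2 * \<epsilon>) K X D I\<^sub>X"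
    and "shift_K_acyclic_carrier TYPE('k) (2 * \<epsilon>) K Y L I\<^sub>Y"
    and "\<And>\<tau> a. \<tau> \<in> K \<Longrightarrow> carrier_le (D \<tau> a) (carrier_comp (G \<tau> (a + \<epsilon>)) (F \<tau> a)) (I\<^sub>X \<tau> a)"
    and "\<And>\<tau> a. \<tau> \<in> K \<Longrightarrow> carrier_le (L \<tau> a) (carrier_comp (F \<tau> (a + \<epsilon>)) (G \<tau> a)) (I\<^sub>Y \<tau> a)"
  shows "\<exists>(\<phi> :: real \<Rightarrow> ('i set \<times> 'a set \<Rightarrow> 'k) \<Rightarrow> 'i set \<times> 'b set \<Rightarrow> 'k)
          (\<psi> :: real \<Rightarrow> ('i set \<times> 'b set \<Rightarrow> 'k) \<Rightarrow> 'i set \<times> 'a set \<Rightarrow> 'k).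
    dc_morphism \<epsilon> K X D Y L \<phi> \<and> dc_morphism \<epsilon> K Y L X D \<psi> \<and>
    ss_interleaving \<epsilon> 1
      (persistent_spectral_sequence X K D) (persistent_spectral_sequence Y K L)
      (dc_induced \<epsilon> K Y L \<phi>) (dc_induced \<epsilon> K X D \<psi>)"
proof -
  interpret X: covered_cw X A I U K
    using assms(3,5,9,11) by unfold_locales (auto simp: filtered_cw_def)
  interpret Y: covered_cw Y B J V K
    using assms(6,8,10,11) by unfold_locales (auto simp: filtered_cw_def)
  have DX: "cw_diagram X K D" and DY: "cw_diagram Y K L"
    unfolding D_def L_def by (rule X.diagram, rule Y.diagram)
  \<comment> \<open>The same pair of augmentations is used to build \<open>f\<close> and
    \<open>g\<close>, so that both composites preserve augmentations.\<close>
  obtain \<eta> :: "'a set \<Rightarrow> 'k" where \<eta>: "augmentation X \<eta>" using X.augmentation_exists by blast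
  obtain \<theta> :: "'b set \<Rightarrow> 'k" where \<theta>: "augmentation Y \<theta>" using Y.augmentation_exists by blast
  have FL: "F \<sigma> r c \<subseteq> L \<sigma> (r + \<epsilon>)" if "\<sigma> \<in> K" "c \<in> D \<sigma> r" for \<sigma> r c
    using assms(13) that
    unfolding eps_K_acyclic_carrier_def eps_acyclic_carrier_def acyclic_carrier_def cell_carrier_def by blast
  have GD: "G \<sigma> r e \<subseteq> D \<sigma> (r + \<epsilon>)" if "\<sigma> \<in> K" "e \<in> L \<sigma> r" for \<sigma> r e
    using assms(14) that
    unfolding eps_K_acyclic_carrier_def eps_acyclic_carrier_def acyclic_carrier_def cell_carrier_def by blast
  obtain f :: "'a set \<Rightarrow> 'b set \<Rightarrow> 'k" where
    f: "\<And>c. c \<in> cells X \<Longrightarrow> cell_boundary Y (f c) = lin_ext X f (bdry X c)"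
      "\<And>c. c \<in> cells X \<Longrightarrow> (\<Sum>v\<in>cells Y. \<theta> v * f c v) = \<eta> c"
      "\<And>\<sigma> r c. \<sigma> \<in> K \<Longrightarrow> c \<in> D \<sigma> r \<Longrightarrow> f c \<in> cell_chains Y (F \<sigma> r c) (cdim X c)"
    using X.carried_chain_map[OF Y.regular \<eta> \<theta> assms(13)[unfolded D_def]] unfolding D_def by blast
  obtain g :: "'b set \<Rightarrow> 'a set \<Rightarrow> 'k" where
    g: "\<And>e. e \<in> cells Y \<Longrightarrow> cell_boundary X (g e) = lin_ext Y g (bdry Y e)"
      "\<And>e. e \<in> cells Y \<Longrightarrow> (\<Sum>v\<in>cells X. \<eta> v * g e v) = \<theta> e"
      "\<And>\<sigma> r e. \<sigma> \<in> K \<Longrightarrow> e \<in> L \<sigma> r \<Longrightarrow> g e \<in> cell_chains X (G \<sigma> r e) (cdim Y e)"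
    using Y.carried_chain_map[OF X.regular \<theta> \<eta> assms(14)[unfolded L_def]] unfolding L_def by blast
  let ?\<phi> = "dc_map X f :: ('i set \<times> 'a set \<Rightarrow> 'k) \<Rightarrow> _" and ?\<psi> = "dc_map Y g :: ('i set \<times> 'b set \<Rightarrow> 'k) \<Rightarrow> _"
  have fL: "f c \<in> cell_chains Y (L \<sigma> (r + \<epsilon>)) (cdim X c)" if "\<sigma> \<in> K" "c \<in> D \<sigma> r" for \<sigma> r c
    by (rule cell_chains_mono[OF f(3)[OF that] FL[OF that]])
  have gD: "g e \<in> cell_chains X (D \<sigma> (r + \<epsilon>)) (cdim Y e)" if "\<sigma> \<in> K" "e \<in> L \<sigma> r" for \<sigma> r e
    by (rule cell_chains_mono[OF g(3)[OF that] GD[OF that]])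
  have \<phi>: "filtered_map (dc_filtration X K D r) (dc_differential X K)
      (dc_filtration Y K L (r + \<epsilon>)) (dc_differential Y K) ?\<phi>" for r
    by (rule filtered_map_dc_map[OF DX DY f(1) fL])
  have \<psi>: "filtered_map (dc_filtration Y K L r) (dc_differential Y K)
      (dc_filtration X K D (r + \<epsilon>)) (dc_differential X K) ?\<psi>" for r
    by (rule filtered_map_dc_map[OF DY DX g(1) gD])
  have \<psi>\<phi>: "\<exists>w\<in>cell_chains X (D \<sigma> (r + 2 * \<epsilon>)) (Suc n).
      cell_boundary X w = (\<lambda>c. ?\<psi> (?\<phi> x) (\<sigma>, c) - x (\<sigma>, c))"
    if "\<sigma> \<in> K" "(\<lambda>c. x (\<sigma>, c)) \<in> cell_chains X (D \<sigma> r) n" "cell_boundary X (\<lambda>c. x (\<sigma>, c)) = (\<lambda>c. 0)"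
    for \<sigma> r n x
    using X.round_trip_homotopy[OF Y.regular \<eta> f[unfolded D_def] g FL[unfolded D_def]
        assms(15)[unfolded D_def] assms(17)[unfolded D_def] that[unfolded D_def]]
    by (simp add: dc_map_def D_def)
  have \<phi>\<psi>: "\<exists>w\<in>cell_chains Y (L \<sigma> (r + 2 * \<epsilon>)) (Suc n).
      cell_boundary Y w = (\<lambda>c. ?\<phi> (?\<psi> y) (\<sigma>, c) - y (\<sigma>, c))"
    if "\<sigma> \<in> K" "(\<lambda>c. y (\<sigma>, c)) \<in> cell_chains Y (L \<sigma> r) n" "cell_boundary Y (\<lambda>c. y (\<sigma>, c)) = (\<lambda>c. 0)"
    for \<sigma> r n y
    using Y.round_trip_homotopy[OF X.regular \<theta> g[unfolded L_def] f GD[unfolded L_def]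
        assms(16)[unfolded L_def] assms(18)[unfolded L_def] that[unfolded L_def]]
    by (simp add: dc_map_def L_def)
  have "dc_morphism \<epsilon> K X D Y L (\<lambda>r. ?\<phi>)"
    by (rule dc_morphism_dc_map) (erule f(1), erule (1) fL)
  moreover have "dc_morphism \<epsilon> K Y L X D (\<lambda>r. ?\<psi>)"
    by (rule dc_morphism_dc_map) (erule g(1), erule (1) gD)
  moreover have "ss_interleaving \<epsilon> 1
      (persistent_spectral_sequence X K D) (persistent_spectral_sequence Y K L)
      (dc_induced \<epsilon> K Y L (\<lambda>r. ?\<phi>)) (dc_induced \<epsilon> K X D (\<lambda>r. ?\<psi>))"
    unfolding ss_interleaving_def ss_at_dc
    by (intro conjI allI impI ballI ss_shift_morphism_dc_map[OF DX DY \<phi>]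
        ss_shift_morphism_dc_map[OF DY DX \<psi>] induced_round_trip[OF DX assms(12) _ \<phi> \<psi> \<psi>\<phi>]
        induced_round_trip[OF DY assms(12) _ \<psi> \<phi> \<phi>\<psi>])
  ultimately show ?thesis by blast
qed

end
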